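(* Let $R$ be a commutative Noetherian ring of Krull dimension one with a unique minimal prime ideal $\mathfrak p$, and suppose that $D:=R/\mathfrak p$ is a principal ideal domain. Then the following conditions are equivalent: (i) $R$ is iso-Artinian; (ii) $\mathfrak pR_{\mathfrak p}=0$; (iii) $\mathfrak p$ has finite length as an $R$-module; (iv) the $D$-module $\mathfrak p/\mathfrak p^2$ is torsion; (v) $\operatorname{rank}_D(\mathfrak p/\mathfrak p^2)=0$; (vi) there exists $s\in R\setminus\mathfrak p$ such that $s\mathfrak p=0$. Consequently, $R$ is not iso-Artinian if and only if $\operatorname{rank}_D(\mathfrak p/\mathfrak p^2)>0$.
   Context: All rings are commutative with identity and all modules are unital. A commutative ring $R$ is called iso-Artinian if for every descending chain of ideals $I_1\supseteq I_2\supseteq I_3\supseteq\cdots$ of $R$ there exists $n_0$ such that $I_n\cong I_{n_0}$ as $R$-modules for every $n\ge n_0$. For a module $M$ over an integral domain $D$ with fraction field $K$, $\operatorname{rank}_D M=\dim_K(M\otimes_D K)$. *)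

theory Defs
  imports
    "HOL-Algebra.Ring_Divisibility"
    "HOL-Algebra.Ideal_Product"
    "HOL-Algebra.Free_Abelian_Groups"
    "HOL-Library.Extended_Nat"
    "Jordan_Normal_Form.Missing_VectorSpace"
begin

section \<open>Prime ideals and Krull dimension\<close>

definition minimal_primes :: "('a, 'b) ring_scheme \<Rightarrow> 'a set set" where
  "minimal_primes R =
     {P. primeideal P R \<and> (\<forall>Q. primeideal Q R \<and> Q \<subseteq> P \<longrightarrow> Q = P)}"

text \<open>The zero ring gets dimension \<open>Sup {} = 0\<close> under this definition.\<close>

definition krull_dim :: "('a, 'b) ring_scheme \<Rightarrow> enat" where
  "krull_dim R = Sup {enat n | n. \<exists>P :: nat \<Rightarrow> 'a set.
     (\<forall>i\<le>n. primeideal (P i) R) \<and> (\<forall>i<n. P i \<subset> P (Suc i))}"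


section \<open>Modules\<close>

definition module_isomorphic ::
    "('a, 'r) ring_scheme \<Rightarrow> ('a, 'b, 'm) module_scheme \<Rightarrow> ('a, 'c, 'n) module_scheme \<Rightarrow> bool"
  where
  "module_isomorphic R M N \<longleftrightarrow>
     (\<exists>f \<in> LinearCombinations.module_hom R M N. bij_betw f (carrier M) (carrier N))"

definition module_length :: "('a, 'r) ring_scheme \<Rightarrow> ('a, 'b, 'm) module_scheme \<Rightarrow> enat" where
  "module_length R M = Sup {enat n | n. \<exists>N :: nat \<Rightarrow> 'b set.
     (\<forall>i\<le>n. Module.submodule (N i) R M) \<and> (\<forall>i<n. N i \<subset> N (Suc i))}"

definition finite_length :: "('a, 'r) ring_scheme \<Rightarrow> ('a, 'b, 'm) module_scheme \<Rightarrow> bool" where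
  "finite_length R M \<longleftrightarrow> module_length R M < \<infinity>"

definition torsion_module :: "('a, 'r) ring_scheme \<Rightarrow> ('a, 'b, 'm) module_scheme \<Rightarrow> bool" where
  "torsion_module D M \<longleftrightarrow>
     (\<forall>m \<in> carrier M. \<exists>d \<in> carrier D - {\<zero>\<^bsub>D\<^esub>}. d \<odot>\<^bsub>M\<^esub> m = \<zero>\<^bsub>M\<^esub>)"

text \<open>An ideal as a module over the ring. The record fields \<open>mult\<close> and \<open>one\<close> play no role
  for modules.\<close>

definition ideal_module :: "('a, 'r) ring_scheme \<Rightarrow> 'a set \<Rightarrow> ('a, 'a) module" where
  "ideal_module R I =
     \<lparr>carrier = I, monoid.mult = monoid.mult R, one = \<one>\<^bsub>R\<^esub>, ring.zero = \<zero>\<^bsub>R\<^esub>, ring.add = ring.add R,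
      smult = monoid.mult R\<rparr>"

definition iso_artinian :: "('a, 'r) ring_scheme \<Rightarrow> bool" where
  "iso_artinian R \<longleftrightarrow>
     (\<forall>I :: nat \<Rightarrow> 'a set. (\<forall>n. ideal (I n) R) \<and> (\<forall>n. I (Suc n) \<subseteq> I n) \<longrightarrow>
        (\<exists>n\<^sub>0. \<forall>n\<ge>n\<^sub>0. module_isomorphic R (ideal_module R (I n)) (ideal_module R (I n\<^sub>0))))"

text \<open>\<open>I/I\<^sup>2\<close> as a module over \<open>R/I\<close>: the carrier consists of the additive cosets \<open>I\<^sup>2 + x\<close> with
  \<open>x \<in> I\<close>, and \<open>(I + r) \<odot> (I\<^sup>2 + x) = I\<^sup>2 + r x\<close>.\<close>

definition conormal_module :: "('a, 'r) ring_scheme \<Rightarrow> 'a set \<Rightarrow> ('a set, 'a set) module" where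
  "conormal_module R I =
     \<lparr>carrier = (\<lambda>x. (I \<cdot>\<^bsub>R\<^esub> I) +>\<^bsub>R\<^esub> x) ` I,
      monoid.mult = undefined, one = undefined,
      ring.zero = I \<cdot>\<^bsub>R\<^esub> I, ring.add = set_add R,
      smult = rcoset_mult R (I \<cdot>\<^bsub>R\<^esub> I)\<rparr>"


section \<open>Localization\<close>

definition loc_rel :: "('a, 'r) ring_scheme \<Rightarrow> 'a set \<Rightarrow> (('a \<times> 'a) \<times> ('a \<times> 'a)) set" where
  "loc_rel R S = {((a, s), (b, t)). a \<in> carrier R \<and> b \<in> carrier R \<and> s \<in> S \<and> t \<in> S \<and>
     (\<exists>u\<in>S. u \<otimes>\<^bsub>R\<^esub> (t \<otimes>\<^bsub>R\<^esub> a) = u \<otimes>\<^bsub>R\<^esub> (s \<otimes>\<^bsub>R\<^esub> b))}"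

text \<open>The fraction \<open>a/s\<close>, as an equivalence class.\<close>

definition loc_frac :: "('a, 'r) ring_scheme \<Rightarrow> 'a set \<Rightarrow> 'a \<Rightarrow> 'a \<Rightarrow> ('a \<times> 'a) set" where
  "loc_frac R S a s = loc_rel R S `` {(a, s)}"

text \<open>\<open>S\<^sup>-\<^sup>1R\<close>, for \<open>S\<close> multiplicatively closed with \<open>\<one> \<in> S\<close>.\<close>

definition localization :: "('a, 'r) ring_scheme \<Rightarrow> 'a set \<Rightarrow> ('a \<times> 'a) set ring" where
  "localization R S =
     \<lparr>carrier = (carrier R \<times> S) // loc_rel R S,
      monoid.mult = (\<lambda>X Y. \<Union>x\<in>X. \<Union>y\<in>Y. case (x, y) of ((a, s), (b, t)) \<Rightarrow>
                       loc_frac R S (a \<otimes>\<^bsub>R\<^esub> b) (s \<otimes>\<^bsub>R\<^esub> t)),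
      one = loc_frac R S \<one>\<^bsub>R\<^esub> \<one>\<^bsub>R\<^esub>,
      ring.zero = loc_frac R S \<zero>\<^bsub>R\<^esub> \<one>\<^bsub>R\<^esub>,
      ring.add = (\<lambda>X Y. \<Union>x\<in>X. \<Union>y\<in>Y. case (x, y) of ((a, s), (b, t)) \<Rightarrow>
                     loc_frac R S (t \<otimes>\<^bsub>R\<^esub> a \<oplus>\<^bsub>R\<^esub> s \<otimes>\<^bsub>R\<^esub> b) (s \<otimes>\<^bsub>R\<^esub> t))\<rparr>"

definition loc_map :: "('a, 'r) ring_scheme \<Rightarrow> 'a set \<Rightarrow> 'a \<Rightarrow> ('a \<times> 'a) set" where
  "loc_map R S a = loc_frac R S a \<one>\<^bsub>R\<^esub>"

definition localization_at_prime :: "('a, 'r) ring_scheme \<Rightarrow> 'a set \<Rightarrow> ('a \<times> 'a) set ring" where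
  "localization_at_prime R P = localization R (carrier R - P)"

text \<open>The extension \<open>I R\<^sub>P\<close> of an ideal \<open>I\<close> of \<open>R\<close> to \<open>R\<^sub>P\<close>.\<close>

definition extended_ideal :: "('a, 'r) ring_scheme \<Rightarrow> 'a set \<Rightarrow> 'a set \<Rightarrow> ('a \<times> 'a) set set" where
  "extended_ideal R P I =
     Idl\<^bsub>localization_at_prime R P\<^esub> (loc_map R (carrier R - P) ` I)"

definition fraction_field :: "('a, 'r) ring_scheme \<Rightarrow> ('a \<times> 'a) set ring" where
  "fraction_field D = localization D (carrier D - {\<zero>\<^bsub>D\<^esub>})"

definition fraction_map :: "('a, 'r) ring_scheme \<Rightarrow> 'a \<Rightarrow> ('a \<times> 'a) set" where
  "fraction_map D = loc_map D (carrier D - {\<zero>\<^bsub>D\<^esub>})"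


section \<open>Base change and rank\<close>

text \<open>For a ring homomorphism \<open>\<phi> : D \<rightarrow> K\<close> and a \<open>D\<close>-module \<open>M\<close>, the tensor product \<open>M \<otimes>\<^sub>D K\<close> is the
  free abelian group on \<open>M \<times> K\<close> modulo the subgroup generated by the bilinearity and balancing
  relations below; \<open>k \<in> K\<close> acts on it by \<open>k \<odot> (m \<otimes> l) = m \<otimes> k l\<close>.\<close>

definition tensor_relations ::
    "('d, 'r) ring_scheme \<Rightarrow> ('k, 's) ring_scheme \<Rightarrow> ('d \<Rightarrow> 'k) \<Rightarrow> ('d, 'm, 't) module_scheme
       \<Rightarrow> ('m \<times> 'k \<Rightarrow>\<^sub>0 int) set"
  where
  "tensor_relations D K \<phi> M =
     {frag_of (m \<oplus>\<^bsub>M\<^esub> m', l) - frag_of (m, l) - frag_of (m', l) | m m' l.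
        m \<in> carrier M \<and> m' \<in> carrier M \<and> l \<in> carrier K} \<union>
     {frag_of (m, l \<oplus>\<^bsub>K\<^esub> l') - frag_of (m, l) - frag_of (m, l') | m l l'.
        m \<in> carrier M \<and> l \<in> carrier K \<and> l' \<in> carrier K} \<union>
     {frag_of (d \<odot>\<^bsub>M\<^esub> m, l) - frag_of (m, \<phi> d \<otimes>\<^bsub>K\<^esub> l) | d m l.
        d \<in> carrier D \<and> m \<in> carrier M \<and> l \<in> carrier K}"

definition tensor_kernel ::
    "('d, 'r) ring_scheme \<Rightarrow> ('k, 's) ring_scheme \<Rightarrow> ('d \<Rightarrow> 'k) \<Rightarrow> ('d, 'm, 't) module_scheme
       \<Rightarrow> ('m \<times> 'k \<Rightarrow>\<^sub>0 int) set"
  where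
  "tensor_kernel D K \<phi> M =
     generate (free_Abelian_group (carrier M \<times> carrier K)) (tensor_relations D K \<phi> M)"

definition base_change ::
    "('d, 'r) ring_scheme \<Rightarrow> ('k, 's) ring_scheme \<Rightarrow> ('d \<Rightarrow> 'k) \<Rightarrow> ('d, 'm, 't) module_scheme
       \<Rightarrow> ('k, ('m \<times> 'k \<Rightarrow>\<^sub>0 int) set) module"
  where
  "base_change D K \<phi> M =
     (let F = free_Abelian_group (carrier M \<times> carrier K); T = tensor_kernel D K \<phi> M in
      \<lparr>carrier = carrier (F Mod T),
       monoid.mult = undefined, one = undefined,
       ring.zero = \<one>\<^bsub>F Mod T\<^esub>, ring.add = monoid.mult (F Mod T),
       smult = (\<lambda>k X. \<Union>x\<in>X. T #>\<^bsub>F\<^esub> frag_extend (\<lambda>(m, l). frag_of (m, k \<otimes>\<^bsub>K\<^esub> l)) x)\<rparr>)"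

text \<open>\<^const>\<open>vectorspace.dim\<close> is only meaningful for spaces with a finite generating set, hence the
  explicit \<open>\<infinity>\<close>.\<close>

definition vs_dim :: "('k, 's) ring_scheme \<Rightarrow> ('k, 'v, 't) module_scheme \<Rightarrow> enat" where
  "vs_dim K V = (if vectorspace.fin_dim K V then enat (vectorspace.dim K V) else \<infinity>)"

definition module_rank :: "('d, 'r) ring_scheme \<Rightarrow> ('d, 'm, 't) module_scheme \<Rightarrow> enat" where
  "module_rank D M =
     (let K = fraction_field D in vs_dim K (base_change D K (fraction_map D) M))"

end

theory Submission
  imports Defs
begin

text \<open>
  Every condition is compared with the last one: some \<open>s \<notin> \<pp>\<close> annihilates \<open>\<pp>\<close>. Since \<open>R\<close> has dimension one,
  \<open>\<pp>\<close> lies in every prime ideal, and since \<open>D\<close> is a principal ideal domain, every other prime ideal is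
  maximal.

  \<^item> That \<open>\<pp>R\<^sub>\<pp> = 0\<close>, respectively that \<open>\<pp>/\<pp>\<^sup>2\<close> is torsion, says that every element of \<open>\<pp>\<close>,
    respectively of \<open>\<pp>/\<pp>\<^sup>2\<close>, is annihilated by some element outside \<open>\<pp>\<close>. As \<open>R\<close> is Noetherian, a single element serves for all of \<open>\<pp>\<close>
    (\<open>uniform_annihilator\<close>). If \<open>s\<pp> \<subseteq> \<pp>\<^sup>2\<close>, then multiplication by \<open>s\<close> pushes \<open>\<pp>\<close> ever deeper, and
    because \<open>\<pp>\<close> is contained in every prime, \<open>s\<^sup>n\<pp> = 0\<close> for some \<open>n\<close>
    (\<open>annihilator_of_conormal_torsion\<close>).

  \<^item> For finite length: \<open>R/sR\<close> has finite length for \<open>s \<notin> \<pp>\<close>, because its prime ideals are maximal; hence so has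
    \<open>\<pp>\<close> if \<open>s\<pp> = 0\<close>. Conversely, if descending chains below \<open>\<pp>\<close> stop, then so does
    \<open>xR \<supseteq> sxR \<supseteq> s\<^sup>2xR \<supseteq> \<dots>\<close> for each \<open>x \<in> \<pp>\<close>, and \<open>s\<^sup>n(1 - sr)x = 0\<close>.

  \<^item> Suppose \<open>R\<close> is iso-Artinian. Consider the chain \<open>I\<^sub>n = \<pp> + s\<^sup>nR\<close>, where \<open>s \<notin> \<pp>\<close> lies in a larger prime. The
    torsion submodule of \<open>I\<^sub>n/\<pp>I\<^sub>n\<close> over \<open>D\<close> is \<open>\<pp>/(s\<^sup>n\<pp> + \<pp>\<^sup>2)\<close>, so \<open>I\<^sub>n \<cong> I\<^sub>n\<^sub>+\<^sub>1\<close> forces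
    \<open>s\<^sup>n\<pp> \<subseteq> s\<^sup>n\<^sup>+\<^sup>1\<pp> + \<pp>\<^sup>2\<close>, and Nakayama's lemma makes \<open>\<pp>/\<pp>\<^sup>2\<close> torsion
    (\<open>annihilator_of_iso_artinian\<close>).

  \<^item> Suppose \<open>s\<pp> = 0\<close> with \<open>s \<notin> \<pp>\<close>. In a descending chain \<open>I\<^sub>n\<close> the intersections \<open>T = I\<^sub>n \<inter> \<pp>\<close> and
    the sums \<open>I\<^sub>n + sR\<close> become constant, by finite length. If no \<open>I\<^sub>n\<close> falls into \<open>\<pp>\<close>, then
    \<open>I\<^sub>n = T + y\<^sub>nR\<close> with \<open>y\<^sub>n \<notin> \<pp>\<close>, and the module structure of \<open>I\<^sub>n\<close> depends only on \<open>T\<close> and on the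
    way \<open>y\<^sub>n\<close> multiplies \<open>\<pp>\<close> into \<open>T\<close>. Modulo \<open>T + sR\<close> the elements \<open>y\<^sub>n\<close> are associated: they
    generate the same ideal, and a Fitting decomposition of \<open>R/sR\<close> turns the factor between two of
    them into a unit modulo \<open>s\<close>. Multiplication by this unit on \<open>T\<close> extends to an isomorphism of the
    ideals (\<open>fitting_element\<close>, \<open>ideal_isomorphism\<close>, \<open>iso_artinian_of_annihilator\<close>).

  \<^item> The rank condition is a general fact about a module \<open>M\<close> over a domain with fraction field \<open>K\<close>: the
    space \<open>M \<otimes> K\<close> vanishes iff \<open>M\<close> is torsion (\<open>rank_zero_iff_torsion\<close>). A torsion element gives
    \<open>m \<otimes> l = dm \<otimes> l/d = 0\<close>; conversely \<open>m \<otimes> a/s \<mapsto> am/s\<close> maps \<open>M \<otimes> K\<close> to the localization of \<open>M\<close>,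
    where \<open>m/1 = 0\<close> means that \<open>m\<close> is torsion.

  Arguments that usually pass to a quotient or choose generators
  are carried out by Noetherian induction on ideals of \<open>R\<close> instead.
\<close>


section \<open>Ideals and intervals of finite length\<close>

context cring begin

lemma ideal_closed:
  assumes "ideal I R"
  shows ideal_carr: "\<And>x. x \<in> I \<Longrightarrow> x \<in> carrier R"
    and ideal_zero: "\<zero> \<in> I"
    and ideal_add: "\<And>x y. x \<in> I \<Longrightarrow> y \<in> I \<Longrightarrow> x \<oplus> y \<in> I"
    and ideal_neg: "\<And>x. x \<in> I \<Longrightarrow> \<ominus> x \<in> I"
    and ideal_diff: "\<And>x y. x \<in> I \<Longrightarrow> y \<in> I \<Longrightarrow> x \<ominus> y \<in> I"
    and ideal_lmult: "\<And>r x. r \<in> carrier R \<Longrightarrow> x \<in> I \<Longrightarrow> r \<otimes> x \<in> I"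
    and ideal_rmult: "\<And>r x. r \<in> carrier R \<Longrightarrow> x \<in> I \<Longrightarrow> x \<otimes> r \<in> I"
proof -
  interpret I: ideal I R by fact
  show "\<And>x. x \<in> I \<Longrightarrow> x \<in> carrier R" "\<zero> \<in> I" "\<And>x y. x \<in> I \<Longrightarrow> y \<in> I \<Longrightarrow> x \<oplus> y \<in> I"
    "\<And>x. x \<in> I \<Longrightarrow> \<ominus> x \<in> I" "\<And>r x. r \<in> carrier R \<Longrightarrow> x \<in> I \<Longrightarrow> r \<otimes> x \<in> I"
    "\<And>r x. r \<in> carrier R \<Longrightarrow> x \<in> I \<Longrightarrow> x \<otimes> r \<in> I"
    by (auto simp: I.I_l_closed I.I_r_closed)
  then show "\<And>x y. x \<in> I \<Longrightarrow> y \<in> I \<Longrightarrow> x \<ominus> y \<in> I"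
    unfolding a_minus_def by blast
qed

lemma ideal_add_cancel:
  assumes "ideal I R" "x \<in> carrier R" "y \<in> I"
  shows "x \<oplus> y \<in> I \<longleftrightarrow> x \<in> I" "y \<oplus> x \<in> I \<longleftrightarrow> x \<in> I"
proof -
  have yc: "y \<in> carrier R" using ideal_carr assms by blast
  have "x = (x \<oplus> y) \<ominus> y" using assms(2) yc by algebra
  then show 1: "x \<oplus> y \<in> I \<longleftrightarrow> x \<in> I"
    using ideal_add[OF assms(1)] ideal_diff[OF assms(1)] assms(3) by metis
  then show "y \<oplus> x \<in> I \<longleftrightarrow> x \<in> I" using a_comm[OF assms(2) yc] by simp
qed

lemma adjoin_iff: "x \<in> A <+>\<^bsub>R\<^esub> PIdl s \<longleftrightarrow> (\<exists>a\<in>A. \<exists>r\<in>carrier R. x = a \<oplus> r \<otimes> s)"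
  unfolding set_add_def' cgenideal_def by auto

lemma adjoin_ideal:
  assumes "ideal A R" "s \<in> carrier R"
  shows "ideal (A <+>\<^bsub>R\<^esub> PIdl s) R"
  using assms add_ideals cgenideal_ideal by blast

lemma adjoin_supset:
  assumes "ideal A R" "s \<in> carrier R"
  shows "A \<subseteq> A <+>\<^bsub>R\<^esub> PIdl s" "s \<in> A <+>\<^bsub>R\<^esub> PIdl s"
proof -
  show "A \<subseteq> A <+>\<^bsub>R\<^esub> PIdl s"
  proof
    fix a assume a: "a \<in> A"
    then have "a = a \<oplus> \<zero> \<otimes> s" using assms ideal_carr by auto
    then show "a \<in> A <+>\<^bsub>R\<^esub> PIdl s" using a adjoin_iff by blast
  qed
  have "s = \<zero> \<oplus> \<one> \<otimes> s" using assms by simp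
  then show "s \<in> A <+>\<^bsub>R\<^esub> PIdl s" using ideal_zero[OF assms(1)] adjoin_iff by blast
qed

lemma adjoin_least:
  assumes "ideal J R" "A \<subseteq> J" "s \<in> J"
  shows "A <+>\<^bsub>R\<^esub> PIdl s \<subseteq> J"
  using assms ideal_add[OF assms(1)] ideal_lmult[OF assms(1)] unfolding adjoin_iff subset_iff by blast

lemma colon_ideal:
  assumes "ideal A R" "x \<in> carrier R"
  shows "ideal {r \<in> carrier R. x \<otimes> r \<in> A} R"
  using ideal.helper_max_prime[OF assms(1) is_cring assms(2)] .

lemma not_primeE:
  assumes "ideal A R" "\<not> primeideal A R" "A \<noteq> carrier R"
  obtains a b where "a \<in> carrier R" "b \<in> carrier R" "a \<otimes> b \<in> A" "a \<notin> A" "b \<notin> A"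
  using ideal.primeidealCE[OF assms(1) is_cring assms(2)] assms(3) by metis

end

text \<open>The length of \<open>B/A\<close> is finite. A rank that is strictly monotone on the ideals between \<open>A\<close> and \<open>B\<close>
  bounds the length of every chain there by its value at \<open>B\<close>. With an arbitrary rank in place of the
  length, additivity along \<open>A \<subseteq> B \<subseteq> C\<close> is just adding two functions.\<close>
definition finite_length_between :: "('a, 'b) ring_scheme \<Rightarrow> 'a set \<Rightarrow> 'a set \<Rightarrow> bool" where
  "finite_length_between R A B \<longleftrightarrow>
     (\<exists>rk :: 'a set \<Rightarrow> nat. \<forall>I J. ideal I R \<and> ideal J R \<and> A \<subseteq> I \<and> I \<subset> J \<and> J \<subseteq> B \<longrightarrow> rk I < rk J)"

lemma finite_length_between_refl: "finite_length_between R A A"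
  unfolding finite_length_between_def by (rule exI[of _ "\<lambda>_. 0"]) auto

context cring begin

text \<open>The rank of \<open>I\<close> is the rank of \<open>I \<inter> B\<close> plus that of \<open>I + B\<close>; by the modular law a strict inclusion
  \<open>I \<subset> J\<close> is strict in at least one of the two.\<close>
lemma finite_length_between_trans:
  assumes B: "ideal B R"
    and AB: "finite_length_between R A B" and BC: "finite_length_between R B C"
    and "A \<subseteq> B" "B \<subseteq> C" and C: "ideal C R"
  shows "finite_length_between R A C"
proof -
  obtain l where l: "\<And>I J. ideal I R \<Longrightarrow> ideal J R \<Longrightarrow> A \<subseteq> I \<Longrightarrow> I \<subset> J \<Longrightarrow> J \<subseteq> B \<Longrightarrow> l I < (l J :: nat)"
    using AB unfolding finite_length_between_def by metis
  obtain k where k: "\<And>I J. ideal I R \<Longrightarrow> ideal J R \<Longrightarrow> B \<subseteq> I \<Longrightarrow> I \<subset> J \<Longrightarrow> J \<subseteq> C \<Longrightarrow> k I < (k J :: nat)"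
    using BC unfolding finite_length_between_def by metis
  have "l (I \<inter> B) + k (I <+>\<^bsub>R\<^esub> B) < l (J \<inter> B) + k (J <+>\<^bsub>R\<^esub> B)"
    if I: "ideal I R" and J: "ideal J R" and "A \<subseteq> I" "I \<subset> J" "J \<subseteq> C" for I J
  proof -
    have sum: "B \<subseteq> I <+>\<^bsub>R\<^esub> B" if "ideal I R" for I
    proof
      fix b assume b: "b \<in> B"
      then have "b = \<zero> \<oplus> b" using ideal_carr[OF B] by auto
      then show "b \<in> I <+>\<^bsub>R\<^esub> B" using ideal_zero[OF that] b unfolding set_add_def' by blast
    qed
    have mono1: "I \<inter> B \<subseteq> J \<inter> B" and mono2: "I <+>\<^bsub>R\<^esub> B \<subseteq> J <+>\<^bsub>R\<^esub> B"
      using \<open>I \<subset> J\<close> unfolding set_add_def' by blast+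
    have "J <+>\<^bsub>R\<^esub> B \<subseteq> C"
      using \<open>J \<subseteq> C\<close> \<open>B \<subseteq> C\<close> ideal_add[OF C] unfolding set_add_def' by blast
    have *: "I \<inter> B \<noteq> J \<inter> B \<or> I <+>\<^bsub>R\<^esub> B \<noteq> J <+>\<^bsub>R\<^esub> B"
    proof (rule ccontr)
      assume "\<not> ?thesis"
      then have eq: "I \<inter> B = J \<inter> B" "I <+>\<^bsub>R\<^esub> B = J <+>\<^bsub>R\<^esub> B" by auto
      obtain x where x: "x \<in> J" "x \<notin> I" using \<open>I \<subset> J\<close> by blast
      have "x = x \<oplus> \<zero>" using ideal_carr[OF J] x by auto
      then have "x \<in> J <+>\<^bsub>R\<^esub> B" using x ideal_zero[OF B] unfolding set_add_def' by blast
      then obtain i b where ib: "i \<in> I" "b \<in> B" "x = i \<oplus> b"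
        using eq(2) unfolding set_add_def' by blast
      have "b \<in> J" using ideal_add_cancel[OF J, of b i] ib x \<open>I \<subset> J\<close> ideal_carr[OF B] by blast
      then have "b \<in> I" using eq(1) ib by blast
      then show False using x ib ideal_add[OF I] by blast
    qed
    have le1: "l (I \<inter> B) \<le> l (J \<inter> B)"
      using l[OF i_intersect[OF I B] i_intersect[OF J B]] mono1 \<open>A \<subseteq> I\<close> \<open>A \<subseteq> B\<close>
      by (cases "I \<inter> B = J \<inter> B") (auto intro: less_imp_le)
    have le2: "k (I <+>\<^bsub>R\<^esub> B) \<le> k (J <+>\<^bsub>R\<^esub> B)"
      using k[OF add_ideals[OF I B] add_ideals[OF J B]] mono2 sum[OF I] \<open>J <+>\<^bsub>R\<^esub> B \<subseteq> C\<close>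
      by (cases "I <+>\<^bsub>R\<^esub> B = J <+>\<^bsub>R\<^esub> B") (auto intro: less_imp_le)
    from * show ?thesis
    proof
      assume "I \<inter> B \<noteq> J \<inter> B"
      then have "l (I \<inter> B) < l (J \<inter> B)"
        using l[OF i_intersect[OF I B] i_intersect[OF J B]] mono1 \<open>A \<subseteq> I\<close> \<open>A \<subseteq> B\<close> by blast
      then show ?thesis using le2 by simp
    next
      assume "I <+>\<^bsub>R\<^esub> B \<noteq> J <+>\<^bsub>R\<^esub> B"
      then have "k (I <+>\<^bsub>R\<^esub> B) < k (J <+>\<^bsub>R\<^esub> B)"
        using k[OF add_ideals[OF I B] add_ideals[OF J B]] mono2 sum[OF I] \<open>J <+>\<^bsub>R\<^esub> B \<subseteq> C\<close> by blast
      then show ?thesis using le1 by simp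
    qed
  qed
  then show ?thesis unfolding finite_length_between_def
    by (intro exI[of _ "\<lambda>I. l (I \<inter> B) + k (I <+>\<^bsub>R\<^esub> B)"]) blast
qed

text \<open>Multiplication by \<open>x\<close> identifies \<open>R/(A : x)\<close> with \<open>(A + xR)/A\<close>, so a rank is pulled back along
  \<open>I \<mapsto> (I : x)\<close>.\<close>
lemma finite_length_between_adjoin:
  assumes A: "ideal A R" and x: "x \<in> carrier R"
    and fin: "finite_length_between R {r \<in> carrier R. x \<otimes> r \<in> A} (carrier R)"
  shows "finite_length_between R A (A <+>\<^bsub>R\<^esub> PIdl x)"
proof -
  define c where "c I = {r \<in> carrier R. x \<otimes> r \<in> I}" for I
  obtain l where l: "\<And>I J. ideal I R \<Longrightarrow> ideal J R \<Longrightarrow> c A \<subseteq> I \<Longrightarrow> I \<subset> J \<Longrightarrow> J \<subseteq> carrier R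
      \<Longrightarrow> l I < (l J :: nat)"
    using fin unfolding finite_length_between_def c_def by metis
  have "l (c I) < l (c J)"
    if I: "ideal I R" and J: "ideal J R" and AI: "A \<subseteq> I" and "I \<subset> J" "J \<subseteq> A <+>\<^bsub>R\<^esub> PIdl x" for I J
  proof (rule l)
    show "ideal (c I) R" "ideal (c J) R" unfolding c_def using colon_ideal I J x by auto
    show "c A \<subseteq> c I" "c J \<subseteq> carrier R" using AI unfolding c_def by auto
    obtain y where y: "y \<in> J" "y \<notin> I" using \<open>I \<subset> J\<close> by blast
    then obtain a r where ar: "a \<in> A" "r \<in> carrier R" "y = a \<oplus> r \<otimes> x"
      using \<open>J \<subseteq> A <+>\<^bsub>R\<^esub> PIdl x\<close> adjoin_iff by blast
    have rx: "r \<otimes> x \<in> carrier R" "x \<otimes> r = r \<otimes> x" using ar x m_comm by auto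
    have "x \<otimes> r \<in> J" "x \<otimes> r \<notin> I"
      using ideal_add_cancel[OF J rx(1), of a] ideal_add_cancel[OF I rx(1), of a] y ar rx AI \<open>I \<subset> J\<close>
      by auto
    then show "c I \<subset> c J" using \<open>I \<subset> J\<close> ar unfolding c_def by blast
  qed
  then show ?thesis unfolding finite_length_between_def
    by (intro exI[of _ "\<lambda>I. l (c I)"]) blast
qed

lemma finite_length_between_maximalideal:
  assumes "\<And>J. ideal J R \<Longrightarrow> A \<subset> J \<Longrightarrow> J = carrier R"
  shows "finite_length_between R A (carrier R)"
  unfolding finite_length_between_def
  by (rule exI[of _ "\<lambda>I. if I = carrier R then 1 else 0"]) (use assms in auto)

end

lemma finite_length_between_dcc:
  assumes "finite_length_between R A B"
    and "\<And>n. ideal (I n) R" "\<And>n. A \<subseteq> I n" "\<And>n. I n \<subseteq> B" "\<And>n :: nat. I (Suc n) \<subseteq> I n"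
  obtains n\<^sub>0 where "\<And>n. n \<ge> n\<^sub>0 \<Longrightarrow> I n = I n\<^sub>0"
proof -
  obtain l where l: "\<And>I J. ideal I R \<Longrightarrow> ideal J R \<Longrightarrow> A \<subseteq> I \<Longrightarrow> I \<subset> J \<Longrightarrow> J \<subseteq> B \<Longrightarrow> l I < (l J :: nat)"
    using assms(1) unfolding finite_length_between_def by metis
  obtain n0 where n0: "\<And>n. l (I n0) \<le> l (I n)"
    using ex_has_least_nat[of "\<lambda>_. True" 0 "\<lambda>n. l (I n)"] by auto
  have anti: "I n \<subseteq> I m" if "m \<le> n" for m n
    using that by (rule lift_Suc_antimono_le[of I, rotated]) (rule assms(5))
  have "I n = I n0" if "n \<ge> n0" for n
    using l[of "I n" "I n0"] n0[of n] anti[OF that] assms(2-4) by (meson leD psubsetI)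
  then show ?thesis using that by blast
qed

text \<open>To prove a property of an ideal, one may assume it for all strictly larger ideals. This replaces
  choosing finite generating sets throughout.\<close>
lemma (in noetherian_ring) noetherian_induct [consumes 1, case_names step]:
  assumes "ideal I R"
    and step: "\<And>I. ideal I R \<Longrightarrow> (\<And>J. ideal J R \<Longrightarrow> I \<subset> J \<Longrightarrow> P J) \<Longrightarrow> P I"
  shows "P I"
proof (rule ccontr)
  assume "\<not> P I"
  define S where "S = {J. ideal J R \<and> \<not> P J}"
  have "\<exists>M\<in>S. \<forall>X\<in>S. M \<subseteq> X \<longrightarrow> X = M"
  proof (rule subset_Zorn)
    fix C assume C: "subset.chain S C"
    show "\<exists>U\<in>S. \<forall>X\<in>C. X \<subseteq> U"
    proof (cases "C = {}")
      case True
      then show ?thesis using \<open>ideal I R\<close> \<open>\<not> P I\<close> S_def by auto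
    next
      case False
      have "subset.chain {I. ideal I R} C" using C unfolding pred_on.chain_def S_def by auto
      then have "\<Union>C \<in> C" using ideal_chain_is_trivial False by blast
      moreover have "C \<subseteq> S" using C unfolding pred_on.chain_def by auto
      ultimately show ?thesis by blast
    qed
  qed
  then show False using step unfolding S_def by blast
qed


section \<open>Annihilation of the minimal prime up to torsion\<close>

text \<open>The consequences of the hypotheses on \<open>R\<close> that the argument needs: \<open>\<pp>\<close> is the least prime ideal, it
  is not the only one, and every ideal is principal modulo \<open>\<pp>\<close>.\<close>
locale unique_minimal_prime = cring R + noetherian_ring R for R (structure) and \<pp> +
  assumes prime: "primeideal \<pp> R"
    and least: "primeideal Q R \<Longrightarrow> \<pp> \<subseteq> Q"
    and principal: "ideal I R \<Longrightarrow> \<exists>y\<in>I. \<forall>x\<in>I. \<exists>r\<in>carrier R. x \<ominus> r \<otimes> y \<in> \<pp>"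
    and not_maximal: "\<exists>Q. primeideal Q R \<and> \<pp> \<subset> Q"
begin

lemma p_ideal: "ideal \<pp> R" using prime primeideal.axioms(1) by blast

lemmas p_closed = ideal_carr[OF p_ideal] ideal_zero[OF p_ideal] ideal_add[OF p_ideal]
  ideal_neg[OF p_ideal] ideal_diff[OF p_ideal] ideal_lmult[OF p_ideal] ideal_rmult[OF p_ideal]

lemma p_prime: "a \<in> carrier R \<Longrightarrow> b \<in> carrier R \<Longrightarrow> a \<otimes> b \<in> \<pp> \<Longrightarrow> a \<in> \<pp> \<or> b \<in> \<pp>"
  using primeideal.I_prime[OF prime] by blast

lemma p_compl_mult: "a \<in> carrier R - \<pp> \<Longrightarrow> b \<in> carrier R - \<pp> \<Longrightarrow> a \<otimes> b \<in> carrier R - \<pp>"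
  using p_prime by blast

lemma one_notin_p: "\<one> \<in> carrier R - \<pp>"
  using ideal.one_imp_carrier[OF p_ideal] primeideal.I_notcarr[OF prime] by auto

lemma p_compl_pow: "s \<in> carrier R - \<pp> \<Longrightarrow> s [^] (n::nat) \<in> carrier R - \<pp>"
  by (induction n) (use one_notin_p p_compl_mult in auto)

text \<open>Nonzero primes of a principal ideal domain are maximal, stated upstairs: \<open>Q = \<pp> + yR\<close> and
  \<open>J = \<pp> + zR\<close>, and \<open>y \<equiv> rz\<close> with \<open>z \<notin> Q\<close> gives \<open>r \<equiv> ty\<close>, hence \<open>tz \<equiv> 1\<close> modulo \<open>\<pp>\<close>.\<close>
lemma prime_above_maximal:
  assumes Q: "primeideal Q R" and "Q \<noteq> \<pp>" and J: "ideal J R" "Q \<subset> J"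
  shows "J = carrier R"
proof -
  have Qi: "ideal Q R" using Q primeideal.axioms(1) by blast
  have pQ: "\<pp> \<subset> Q" using least[OF Q] \<open>Q \<noteq> \<pp>\<close> by auto
  obtain y where y: "y \<in> Q" "\<And>x. x \<in> Q \<Longrightarrow> \<exists>r\<in>carrier R. x \<ominus> r \<otimes> y \<in> \<pp>"
    using principal[OF Qi] by blast
  obtain z where z: "z \<in> J" "\<And>x. x \<in> J \<Longrightarrow> \<exists>r\<in>carrier R. x \<ominus> r \<otimes> z \<in> \<pp>"
    using principal[OF J(1)] by blast
  have yc: "y \<in> carrier R" and zc: "z \<in> carrier R"
    using ideal_carr[OF Qi y(1)] ideal_carr[OF J(1) z(1)] .
  have split: "x = (x \<ominus> r \<otimes> w) \<oplus> r \<otimes> w" if "x \<in> carrier R" "r \<in> carrier R" "w \<in> carrier R" for x r w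
    using that by algebra
  have ynp: "y \<notin> \<pp>"
  proof
    assume "y \<in> \<pp>"
    have "x \<in> \<pp>" if x: "x \<in> Q" for x
    proof -
      obtain r where r: "r \<in> carrier R" "x \<ominus> r \<otimes> y \<in> \<pp>" using y(2)[OF x] by blast
      then show ?thesis
        using split[OF ideal_carr[OF Qi x] r(1) yc] p_closed(3)[OF r(2) p_closed(6)[OF r(1) \<open>y \<in> \<pp>\<close>]] by simp
    qed
    then show False using pQ by blast
  qed
  have znQ: "z \<notin> Q"
  proof
    assume "z \<in> Q"
    have "x \<in> Q" if x: "x \<in> J" for x
    proof -
      obtain r where r: "r \<in> carrier R" "x \<ominus> r \<otimes> z \<in> \<pp>" using z(2)[OF x] by blast
      then have "x \<ominus> r \<otimes> z \<in> Q" using pQ by blast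
      then show ?thesis
        using split[OF ideal_carr[OF J(1) x] r(1) zc] ideal_add[OF Qi] ideal_lmult[OF Qi r(1) \<open>z \<in> Q\<close>]
        by metis
    qed
    then show False using J(2) by blast
  qed
  obtain r where r: "r \<in> carrier R" "y \<ominus> r \<otimes> z \<in> \<pp>" using z(2)[of y] y(1) J(2) by blast
  have "r \<otimes> z = y \<ominus> (y \<ominus> r \<otimes> z)" using yc zc r by algebra
  also have "\<dots> \<in> Q" using ideal_diff[OF Qi y(1)] r(2) pQ by blast
  finally have "r \<in> Q" using primeideal.I_prime[OF Q r(1) zc] znQ by blast
  then obtain t where t: "t \<in> carrier R" "r \<ominus> t \<otimes> y \<in> \<pp>" using y(2) by blast
  have "y \<otimes> (\<one> \<ominus> t \<otimes> z) = (y \<ominus> r \<otimes> z) \<oplus> z \<otimes> (r \<ominus> t \<otimes> y)" using yc zc r(1) t(1) by algebra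
  also have "\<dots> \<in> \<pp>" using p_closed(3)[OF r(2) p_closed(6)[OF zc t(2)]] .
  finally have "\<one> \<ominus> t \<otimes> z \<in> \<pp>" using p_prime ynp yc zc t(1) by (meson m_closed minus_closed one_closed)
  then have 1: "\<one> \<ominus> t \<otimes> z \<in> J" using pQ J(2) by blast
  have "\<one> = (\<one> \<ominus> t \<otimes> z) \<oplus> t \<otimes> z" using zc t(1) by algebra
  then have "\<one> \<in> J" using ideal_add[OF J(1) 1 ideal_lmult[OF J(1) t(1) z(1)]] by simp
  then show ?thesis using ideal.one_imp_carrier[OF J(1)] by blast
qed

text \<open>In other words, \<open>R/A\<close> has finite length. If \<open>A\<close> is prime, it is maximal. Otherwise \<open>ab \<in> A\<close> with
  \<open>a, b \<notin> A\<close>, and \<open>R/A\<close> is an extension of \<open>R/(A + aR)\<close> by \<open>(A + aR)/A \<cong> R/(A : a)\<close>, where both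
  \<open>A + aR\<close> and \<open>A : a\<close> are strictly larger than \<open>A\<close>.\<close>
lemma finite_length_between_above_p:
  assumes "ideal A R" and "s \<in> A" "s \<in> carrier R - \<pp>"
  shows "finite_length_between R A (carrier R)"
  using assms(1,2)
proof (induction rule: noetherian_induct)
  case (step A)
  consider "A = carrier R" | "primeideal A R" | "A \<noteq> carrier R" "\<not> primeideal A R" by blast
  then show ?case
  proof cases
    case 1
    then show ?thesis by (simp add: finite_length_between_refl)
  next
    case 2
    have "A \<noteq> \<pp>" using step.prems assms(3) by blast
    show ?thesis
      by (rule finite_length_between_maximalideal, rule prime_above_maximal[OF 2 \<open>A \<noteq> \<pp>\<close>])
  next
    case 3
    obtain a b where ab: "a \<in> carrier R" "b \<in> carrier R" "a \<otimes> b \<in> A" "a \<notin> A" "b \<notin> A"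
      using not_primeE[OF step.hyps 3(2,1)] .
    let ?C = "{r \<in> carrier R. a \<otimes> r \<in> A}"
    note Aa = adjoin_ideal[OF step.hyps ab(1)] adjoin_supset[OF step.hyps ab(1)]
    have C: "ideal ?C R" using colon_ideal[OF step.hyps ab(1)] .
    have "A \<subseteq> ?C"
    proof
      fix x assume x: "x \<in> A"
      then show "x \<in> ?C" using ideal_carr[OF step.hyps x] ideal_lmult[OF step.hyps ab(1) x] by simp
    qed
    moreover have "b \<in> ?C" using ab by simp
    ultimately have "A \<subset> ?C" "s \<in> ?C" using ab(5) step.prems by auto
    then have "finite_length_between R ?C (carrier R)" by (rule step.IH[OF C])
    then have lower: "finite_length_between R A (A <+>\<^bsub>R\<^esub> PIdl a)"
      using finite_length_between_adjoin[OF step.hyps ab(1)] by blast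
    have "A \<subset> A <+>\<^bsub>R\<^esub> PIdl a" using Aa(2,3) ab(4) by auto
    then have upper: "finite_length_between R (A <+>\<^bsub>R\<^esub> PIdl a) (carrier R)"
      using Aa(2) step.prems by (intro step.IH[OF Aa(1)]) auto
    have "A <+>\<^bsub>R\<^esub> PIdl a \<subseteq> carrier R" using ideal_carr[OF Aa(1)] by auto
    then show ?thesis by (rule finite_length_between_trans[OF Aa(1) lower upper Aa(2) _ oneideal])
  qed
qed

text \<open>Going up from \<open>A\<close> to \<open>A + xR\<close> with \<open>x \<in> \<pp>\<close> adds a quotient of \<open>R/sR\<close>, which has finite length.\<close>
lemma finite_length_p:
  assumes s: "s \<in> carrier R - \<pp>" "\<And>x. x \<in> \<pp> \<Longrightarrow> s \<otimes> x = \<zero>"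
  shows "finite_length_between R {\<zero>} \<pp>"
proof -
  have "A \<subseteq> \<pp> \<longrightarrow> finite_length_between R A \<pp>" if "ideal A R" for A
    using that
  proof (induction rule: noetherian_induct)
    case (step A)
    show ?case
    proof (cases "\<pp> \<subseteq> A")
      case True
      then show ?thesis using finite_length_between_refl by (metis subset_antisym)
    next
      case False
      show ?thesis
      proof
        assume sub: "A \<subseteq> \<pp>"
        obtain x where x: "x \<in> \<pp>" "x \<notin> A" using False by blast
        then have xc: "x \<in> carrier R" using p_closed by blast
        note Ax = adjoin_ideal[OF step.hyps xc] adjoin_supset[OF step.hyps xc] adjoin_least[OF p_ideal sub x(1)]
        let ?C = "{r \<in> carrier R. x \<otimes> r \<in> A}"
        have C: "ideal ?C R" using colon_ideal[OF step.hyps xc] .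
        have "x \<otimes> s = \<zero>" using s(2)[OF x(1)] m_comm[OF xc, of s] s(1) by simp
        then have "s \<in> ?C" using s(1) ideal_zero[OF step.hyps] by simp
        then have lower: "finite_length_between R A (A <+>\<^bsub>R\<^esub> PIdl x)"
          by (intro finite_length_between_adjoin[OF step.hyps xc] finite_length_between_above_p[OF C _ s(1)])
        have "A \<subset> A <+>\<^bsub>R\<^esub> PIdl x" using Ax(2,3) x(2) by auto
        then have upper: "finite_length_between R (A <+>\<^bsub>R\<^esub> PIdl x) \<pp>"
          using step.IH[OF Ax(1)] Ax(4) by simp
        show "finite_length_between R A \<pp>"
          using finite_length_between_trans[OF Ax(1) lower upper Ax(2,4) p_ideal] .
      qed
    qed
  qed
  then show ?thesis using zeroideal p_closed(2) by blast
qed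

text \<open>If \<open>u\<close> does not yet move \<open>x \<in> \<pp>\<close> into \<open>B\<close> but \<open>v\<close> does, then \<open>uv\<close> works for strictly more elements
  than \<open>u\<close>; the ascending chain condition ends this process.\<close>
lemma uniform_annihilator:
  assumes B: "ideal B R" and tors: "\<And>x. x \<in> \<pp> \<Longrightarrow> \<exists>u\<in>carrier R - \<pp>. u \<otimes> x \<in> B"
  shows "\<exists>u\<in>carrier R - \<pp>. \<forall>x\<in>\<pp>. u \<otimes> x \<in> B"
proof -
  define C where "C u = {x \<in> carrier R. u \<otimes> x \<in> B}" for u
  have C: "ideal (C u) R" if "u \<in> carrier R" for u unfolding C_def using colon_ideal[OF B that] .
  have "\<forall>u\<in>carrier R - \<pp>. A = C u \<longrightarrow> (\<exists>u\<in>carrier R - \<pp>. \<forall>x\<in>\<pp>. u \<otimes> x \<in> B)" if "ideal A R" for A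
    using that
  proof (induction rule: noetherian_induct)
    case (step A)
    show ?case
    proof (intro ballI impI)
      fix u assume u: "u \<in> carrier R - \<pp>" and A: "A = C u"
      show "\<exists>u\<in>carrier R - \<pp>. \<forall>x\<in>\<pp>. u \<otimes> x \<in> B"
      proof (cases "\<pp> \<subseteq> A")
        case True
        then show ?thesis using A u unfolding C_def by blast
      next
        case False
        then obtain x where x: "x \<in> \<pp>" "x \<notin> A" by blast
        obtain v where v: "v \<in> carrier R - \<pp>" "v \<otimes> x \<in> B" using tors x by blast
        have xc: "x \<in> carrier R" using x p_closed by blast
        have uv: "u \<otimes> v \<in> carrier R - \<pp>" using p_compl_mult u v by blast
        have "x \<in> C (u \<otimes> v)"
          using ideal_lmult[OF B _ v(2), of u] u v xc m_assoc unfolding C_def by auto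
        moreover have "A \<subseteq> C (u \<otimes> v)"
        proof
          fix y assume "y \<in> A"
          then have y: "y \<in> carrier R" "u \<otimes> y \<in> B" using A C_def by auto
          have "u \<otimes> v \<otimes> y = v \<otimes> (u \<otimes> y)" using u v y by (simp add: m_ac)
          then show "y \<in> C (u \<otimes> v)" using ideal_lmult[OF B _ y(2), of v] v y C_def by auto
        qed
        ultimately have "A \<subset> C (u \<otimes> v)" using x by blast
        then show ?thesis using step.IH[OF C] uv by blast
      qed
    qed
  qed
  then show ?thesis using C one_notin_p by blast
qed

text \<open>By Noetherian induction every ideal \<open>A\<close> contains some \<open>s\<^sup>n\<pp>\<close>; the claim is the case \<open>A = 0\<close>. A prime
  \<open>A\<close> already contains \<open>\<pp>\<close>. Otherwise \<open>ab \<in> A\<close>, and \<open>s\<^sup>n\<pp> \<subseteq> A + aR\<close>, \<open>s\<^sup>m\<pp> \<subseteq> A + bR\<close> give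
  \<open>s\<^sup>n\<^sup>+\<^sup>m\<^sup>+\<^sup>1\<pp> \<subseteq> s\<^sup>n\<pp> \<cdot> s\<^sup>m\<pp> \<subseteq> A\<close>; the additional factor \<open>s\<close> moves \<open>\<pp>\<close> into \<open>\<pp>\<^sup>2\<close>.\<close>
lemma annihilator_of_conormal_torsion:
  assumes s: "s \<in> carrier R - \<pp>" "\<And>x. x \<in> \<pp> \<Longrightarrow> s \<otimes> x \<in> \<pp> \<cdot> \<pp>"
  shows "\<exists>u\<in>carrier R - \<pp>. \<forall>x\<in>\<pp>. u \<otimes> x = \<zero>"
proof -
  have sc: "s \<in> carrier R" using s by blast
  have "\<exists>n::nat. \<forall>x\<in>\<pp>. s [^] n \<otimes> x \<in> A" if "ideal A R" for A
    using that
  proof (induction rule: noetherian_induct)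
    case (step A)
    consider "A = carrier R" | "primeideal A R" | "A \<noteq> carrier R" "\<not> primeideal A R" by blast
    then show ?case
    proof cases
      case 1
      then show ?thesis using sc p_closed(1) by auto
    next
      case 2
      then have "\<forall>x\<in>\<pp>. s [^] (0::nat) \<otimes> x \<in> A" using least p_closed(1) by auto
      then show ?thesis by blast
    next
      case 3
      obtain a b where ab: "a \<in> carrier R" "b \<in> carrier R" "a \<otimes> b \<in> A" "a \<notin> A" "b \<notin> A"
        using not_primeE[OF step.hyps 3(2,1)] .
      note Aa = adjoin_ideal[OF step.hyps ab(1)] adjoin_supset[OF step.hyps ab(1)]
      note Ab = adjoin_ideal[OF step.hyps ab(2)] adjoin_supset[OF step.hyps ab(2)]
      obtain n :: nat where n: "\<And>x. x \<in> \<pp> \<Longrightarrow> s [^] n \<otimes> x \<in> A <+>\<^bsub>R\<^esub> PIdl a"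
        using step.IH[OF Aa(1)] Aa ab by blast
      obtain m :: nat where m: "\<And>x. x \<in> \<pp> \<Longrightarrow> s [^] m \<otimes> x \<in> A <+>\<^bsub>R\<^esub> PIdl b"
        using step.IH[OF Ab(1)] Ab ab by blast
      have prod: "s [^] n \<otimes> s [^] m \<otimes> z \<in> A \<and> z \<in> carrier R" if "z \<in> \<pp> \<cdot> \<pp>" for z
        using that
      proof (induction rule: ideal_prod.induct)
        case (prod x y)
        obtain c r where cr: "c \<in> A" "r \<in> carrier R" "s [^] n \<otimes> x = c \<oplus> r \<otimes> a"
          using n[OF prod(1)] adjoin_iff by blast
        obtain d t where dt: "d \<in> A" "t \<in> carrier R" "s [^] m \<otimes> y = d \<oplus> t \<otimes> b"
          using m[OF prod(2)] adjoin_iff by blast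
        have carr: "x \<in> carrier R" "y \<in> carrier R" "c \<in> carrier R" "d \<in> carrier R"
          "s [^] n \<in> carrier R" "s [^] m \<in> carrier R"
          using prod p_closed ideal_carr[OF step.hyps] cr dt sc by auto
        have "s [^] n \<otimes> s [^] m \<otimes> (x \<otimes> y) = (s [^] n \<otimes> x) \<otimes> (s [^] m \<otimes> y)"
          using carr by algebra
        also have "\<dots> = (c \<oplus> r \<otimes> a) \<otimes> (d \<oplus> t \<otimes> b)" using cr dt by simp
        also have "\<dots> = (d \<oplus> t \<otimes> b) \<otimes> c \<oplus> ((r \<otimes> a) \<otimes> d \<oplus> (r \<otimes> t) \<otimes> (a \<otimes> b))"
          using carr cr(2) dt(2) ab(1,2) by algebra
        also have "\<dots> \<in> A"
          using ideal_lmult[OF step.hyps _ cr(1)] ideal_lmult[OF step.hyps _ dt(1)]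
            ideal_lmult[OF step.hyps _ ab(3)] ideal_add[OF step.hyps] carr cr(2) dt(2) ab(1,2) by simp
        finally show ?case using carr by simp
      next
        case (sum x y)
        have "s [^] n \<otimes> s [^] m \<otimes> (x \<oplus> y) = s [^] n \<otimes> s [^] m \<otimes> x \<oplus> s [^] n \<otimes> s [^] m \<otimes> y"
          using sum sc by (simp add: r_distr)
        then show ?case using sum ideal_add[OF step.hyps] by simp
      qed
      have "s [^] (Suc (n + m)) \<otimes> x \<in> A" if "x \<in> \<pp>" for x
      proof -
        have "s [^] (Suc (n + m)) \<otimes> x = s [^] n \<otimes> s [^] m \<otimes> (s \<otimes> x)"
          using sc p_closed(1)[OF that] by (simp add: nat_pow_mult[symmetric] m_assoc)
        then show ?thesis using prod s(2)[OF that] by metis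
      qed
      then show ?thesis by blast
    qed
  qed
  then obtain n :: nat where "\<forall>x\<in>\<pp>. s [^] n \<otimes> x \<in> {\<zero>}" using zeroideal by blast
  then show ?thesis using p_compl_pow[OF s(1), of n] by blast
qed

text \<open>Any \<open>s\<close> in a prime \<open>Q \<supset> \<pp>\<close> but not in \<open>\<pp>\<close>: then \<open>1 - sr\<close> lies outside \<open>Q\<close>. Such elements are the
  denominators that Nakayama-type arguments produce, and they stay outside \<open>\<pp>\<close>.\<close>
lemma element_of_larger_prime:
  obtains s where "s \<in> carrier R - \<pp>"
    and "\<And>r. r \<in> carrier R \<Longrightarrow> \<one> \<ominus> s \<otimes> r \<in> carrier R - \<pp>"
proof -
  obtain Q where Q: "primeideal Q R" "\<pp> \<subset> Q" using not_maximal by blast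
  have Qi: "ideal Q R" using Q primeideal.axioms(1) by blast
  obtain s where s: "s \<in> Q" "s \<notin> \<pp>" using Q by blast
  have sc: "s \<in> carrier R" using ideal_carr[OF Qi s(1)] .
  have "\<one> \<ominus> s \<otimes> r \<in> carrier R - \<pp>" if r: "r \<in> carrier R" for r
  proof -
    have "\<one> \<ominus> s \<otimes> r \<notin> \<pp>"
    proof
      assume "\<one> \<ominus> s \<otimes> r \<in> \<pp>"
      then have "\<one> \<ominus> s \<otimes> r \<in> Q" using Q by blast
      then have "(\<one> \<ominus> s \<otimes> r) \<oplus> s \<otimes> r \<in> Q" using ideal_add[OF Qi] ideal_rmult[OF Qi r s(1)] by blast
      moreover have "(\<one> \<ominus> s \<otimes> r) \<oplus> s \<otimes> r = \<one>" using sc r by algebra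
      ultimately show False
        using ideal.one_imp_carrier[OF Qi] primeideal.I_notcarr[OF Q(1)] by simp
    qed
    then show ?thesis using sc r by simp
  qed
  then show ?thesis using that s sc by blast
qed

text \<open>For \<open>x \<in> \<pp>\<close> the chain \<open>s\<^sup>nxR\<close> stops, so \<open>s\<^sup>nx = rs\<^sup>n\<^sup>+\<^sup>1x\<close> and \<open>s\<^sup>n(1 - sr)\<close> annihilates \<open>x\<close>.\<close>
lemma annihilator_of_dcc:
  assumes dcc: "\<And>I. (\<And>n::nat. ideal (I n) R) \<Longrightarrow> (\<And>n. I n \<subseteq> \<pp>) \<Longrightarrow> (\<And>n. I (Suc n) \<subseteq> I n)
      \<Longrightarrow> \<exists>n. I n \<subseteq> I (Suc n)"
  shows "\<exists>u\<in>carrier R - \<pp>. \<forall>x\<in>\<pp>. u \<otimes> x = \<zero>"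
proof -
  obtain s where s: "s \<in> carrier R - \<pp>" "\<And>r. r \<in> carrier R \<Longrightarrow> \<one> \<ominus> s \<otimes> r \<in> carrier R - \<pp>"
    using element_of_larger_prime by blast
  then have sc: "s \<in> carrier R" by blast
  have "\<exists>u\<in>carrier R - \<pp>. u \<otimes> x \<in> {\<zero>}" if x: "x \<in> \<pp>" for x
  proof -
    have xc: "x \<in> carrier R" using x p_closed by blast
    define I where "I n = PIdl (s [^] (n::nat) \<otimes> x)" for n
    have 1: "ideal (I n) R" for n unfolding I_def using sc xc cgenideal_ideal by auto
    have 2: "I n \<subseteq> \<pp>" for n
      unfolding I_def using cgenideal_minimal[OF p_ideal] p_closed(6) sc x by simp
    have "s [^] Suc n \<otimes> x = s \<otimes> (s [^] n \<otimes> x)" for n using sc xc by (simp add: m_ac)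
    then have "s [^] Suc n \<otimes> x \<in> I n" for n
      using ideal_lmult[OF 1 sc, of "s [^] n \<otimes> x" n] cgenideal_self sc xc unfolding I_def by simp
    then have 3: "I (Suc n) \<subseteq> I n" for n using cgenideal_minimal[OF 1] unfolding I_def by metis
    obtain n where "I n \<subseteq> I (Suc n)" using dcc[of I] 1 2 3 by blast
    then have "s [^] n \<otimes> x \<in> I (Suc n)" using cgenideal_self sc xc unfolding I_def by auto
    then obtain r where r: "r \<in> carrier R" "s [^] n \<otimes> x = r \<otimes> (s [^] Suc n \<otimes> x)"
      unfolding I_def cgenideal_def by blast
    define t where "t = s [^] n"
    have tc: "t \<in> carrier R - \<pp>" using p_compl_pow[OF s(1)] t_def by simp
    have eq: "t \<otimes> x = r \<otimes> (t \<otimes> s \<otimes> x)" using r(2) t_def by simp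
    have "t \<otimes> (\<one> \<ominus> s \<otimes> r) \<otimes> x = t \<otimes> x \<ominus> r \<otimes> (t \<otimes> s \<otimes> x)"
      using DiffD1[OF tc] sc r(1) xc by algebra
    also have "\<dots> = \<zero>" unfolding eq using r(1) DiffD1[OF tc] sc xc by algebra
    finally show ?thesis using p_compl_mult[OF tc s(2)[OF r(1)]] by blast
  qed
  then show ?thesis using uniform_annihilator[OF zeroideal] by blast
qed

lemma one_minus_mult:
  assumes "s \<in> carrier R" "a \<in> carrier R" "b \<in> carrier R"
  shows "\<exists>c\<in>carrier R. (\<one> \<ominus> s \<otimes> a) \<otimes> (\<one> \<ominus> s \<otimes> b) = \<one> \<ominus> s \<otimes> c"
proof
  show "(\<one> \<ominus> s \<otimes> a) \<otimes> (\<one> \<ominus> s \<otimes> b) = \<one> \<ominus> s \<otimes> (a \<oplus> b \<ominus> s \<otimes> (a \<otimes> b))"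
    using assms by (simp add: a_minus_def l_distr r_distr l_minus r_minus minus_add m_ac a_ac)
qed (use assms in simp)

text \<open>Nakayama's lemma for \<open>N \<subseteq> sN + B\<close>. If \<open>x \<in> N - B\<close>, induction yields \<open>t = 1 - sr\<close> with
  \<open>tN \<subseteq> B + xR\<close>. Then \<open>tx \<in> s(tN) + B \<subseteq> B + sxR\<close>, so \<open>(t - sq)x \<in> B\<close> for some \<open>q\<close>, and \<open>(t - sq)t\<close>
  moves \<open>N\<close> into \<open>B\<close>.\<close>
lemma nakayama:
  assumes N: "ideal N R" and s: "s \<in> carrier R" and B: "ideal B R"
    and "\<And>x. x \<in> N \<Longrightarrow> \<exists>y\<in>N. \<exists>b\<in>B. x = s \<otimes> y \<oplus> b"
  shows "\<exists>r\<in>carrier R. \<forall>x\<in>N. (\<one> \<ominus> s \<otimes> r) \<otimes> x \<in> B"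
  using B assms(4)
proof (induction rule: noetherian_induct)
  case (step B)
  show ?case
  proof (cases "N \<subseteq> B")
    case True
    have "(\<one> \<ominus> s \<otimes> \<zero>) \<otimes> x = x" if "x \<in> N" for x using s ideal_carr[OF N that] by algebra
    then show ?thesis using True by (intro bexI[of _ \<zero>]) auto
  next
    case False
    then obtain x where x: "x \<in> N" "x \<notin> B" by blast
    have xc: "x \<in> carrier R" using ideal_carr[OF N x(1)] .
    note Bx = adjoin_ideal[OF step.hyps xc] adjoin_supset[OF step.hyps xc]
    have "\<exists>y\<in>N. \<exists>b\<in>B <+>\<^bsub>R\<^esub> PIdl x. z = s \<otimes> y \<oplus> b" if "z \<in> N" for z
      using step.prems[OF that] Bx(2) by blast
    then obtain r where r: "r \<in> carrier R" "\<And>z. z \<in> N \<Longrightarrow> (\<one> \<ominus> s \<otimes> r) \<otimes> z \<in> B <+>\<^bsub>R\<^esub> PIdl x"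
      using step.IH[OF Bx(1)] Bx x by blast
    define t where "t = \<one> \<ominus> s \<otimes> r"
    have tc: "t \<in> carrier R" using s r t_def by simp
    obtain y b where yb: "y \<in> N" "b \<in> B" "x = s \<otimes> y \<oplus> b" using step.prems[OF x(1)] by blast
    obtain c q where cq: "c \<in> B" "q \<in> carrier R" "t \<otimes> y = c \<oplus> q \<otimes> x"
      using r(2)[OF yb(1)] adjoin_iff unfolding t_def by blast
    have carr: "y \<in> carrier R" "b \<in> carrier R" "c \<in> carrier R"
      using yb cq ideal_carr[OF step.hyps] ideal_carr[OF N] by auto
    have "(t \<ominus> s \<otimes> q) \<otimes> x = t \<otimes> x \<ominus> s \<otimes> q \<otimes> x" using tc s cq xc by algebra
    also have "\<dots> = t \<otimes> (s \<otimes> y \<oplus> b) \<ominus> s \<otimes> q \<otimes> x" using yb by simp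
    also have "\<dots> = s \<otimes> (t \<otimes> y) \<oplus> t \<otimes> b \<ominus> s \<otimes> q \<otimes> x" using tc s cq(2) carr xc by algebra
    also have "\<dots> = s \<otimes> c \<oplus> t \<otimes> b" unfolding cq(3) using tc s cq(2) carr xc by algebra
    also have "\<dots> \<in> B" using ideal_add[OF step.hyps] ideal_lmult[OF step.hyps] s tc cq yb by blast
    finally have killx: "(t \<ominus> s \<otimes> q) \<otimes> x \<in> B" .
    have eq0: "t \<ominus> s \<otimes> q = \<one> \<ominus> s \<otimes> (r \<oplus> q)" unfolding t_def using s r(1) cq(2) by algebra
    obtain r' where r'c: "r' \<in> carrier R" and eq: "\<one> \<ominus> s \<otimes> r' = (t \<ominus> s \<otimes> q) \<otimes> t"
      using one_minus_mult[OF s, of "r \<oplus> q" r] r(1) cq(2) unfolding eq0 unfolding t_def by force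
    have "(\<one> \<ominus> s \<otimes> r') \<otimes> z \<in> B" if z: "z \<in> N" for z
    proof -
      obtain d p where dp: "d \<in> B" "p \<in> carrier R" "t \<otimes> z = d \<oplus> p \<otimes> x"
        using r(2)[OF z] adjoin_iff unfolding t_def by blast
      have carr: "z \<in> carrier R" "d \<in> carrier R" using z dp ideal_carr[OF step.hyps] ideal_carr[OF N] by auto
      have "(\<one> \<ominus> s \<otimes> r') \<otimes> z = (t \<ominus> s \<otimes> q) \<otimes> (t \<otimes> z)" unfolding eq using tc s cq(2) carr by algebra
      also have "\<dots> = (t \<ominus> s \<otimes> q) \<otimes> d \<oplus> p \<otimes> ((t \<ominus> s \<otimes> q) \<otimes> x)"
        unfolding dp(3) using tc s cq(2) carr dp(2) xc by algebra
      also have "\<dots> \<in> B"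
        using ideal_add[OF step.hyps] ideal_lmult[OF step.hyps] killx dp tc s cq(2) by simp
      finally show ?thesis .
    qed
    then show ?thesis using r'c by blast
  qed
qed

end


section \<open>Isomorphisms between the terms of a descending chain\<close>

lemmas (in cring) ring_norm = a_minus_def l_distr r_distr l_minus r_minus minus_add m_ac a_ac

context unique_minimal_prime begin

text \<open>Let \<open>I\<^sub>n = \<pp> + s\<^sup>nR\<close> and \<open>\<phi> : I\<^sub>m \<cong> I\<^sub>n\<close> with \<open>m = n + 1\<close>. Linearity lets an element of \<open>\<pp>\<close> and a
  power of \<open>s\<close> trade places as scalar and vector, \<open>s\<^sup>m\<phi>(z) = \<phi>(s\<^sup>mz) = z\<phi>(s\<^sup>m)\<close>. This shows that \<open>\<phi>\<close>
  maps \<open>\<pp>\<close> into \<open>\<pp>\<close>, and the same trick for the preimage \<open>b\<close> of \<open>s\<^sup>n\<close> gives \<open>s\<^sup>nz = \<phi>(z)b\<close>, which lies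
  in \<open>s\<^sup>n\<^sup>+\<^sup>1\<pp> + \<pp>\<^sup>2\<close> because \<open>b \<in> \<pp> + s\<^sup>n\<^sup>+\<^sup>1R\<close>.\<close>
lemma annihilator_of_iso_artinian:
  assumes "iso_artinian R"
  shows "\<exists>u\<in>carrier R - \<pp>. \<forall>x\<in>\<pp>. u \<otimes> x = \<zero>"
proof -
  obtain s where s: "s \<in> carrier R - \<pp>" "\<And>r. r \<in> carrier R \<Longrightarrow> \<one> \<ominus> s \<otimes> r \<in> carrier R - \<pp>"
    using element_of_larger_prime by blast
  then have sc: "s \<in> carrier R" by blast
  define I where "I n = \<pp> <+>\<^bsub>R\<^esub> PIdl (s [^] (n::nat))" for n
  have spow: "s [^] n \<in> carrier R" for n :: nat using sc by simp
  note I = adjoin_ideal[OF p_ideal spow, folded I_def] adjoin_supset[OF p_ideal spow, folded I_def]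
  have "s [^] Suc n \<in> I n" for n
    using ideal_lmult[OF I(1) sc I(3), of n] sc spow by (simp add: m_comm)
  then have "I (Suc n) \<subseteq> I n" for n
    using adjoin_least[OF I(1) I(2)] unfolding I_def by blast
  then obtain n where n: "\<And>m. m \<ge> n \<Longrightarrow> module_isomorphic R (ideal_module R (I m)) (ideal_module R (I n))"
    using assms I(1) unfolding iso_artinian_def by metis
  let ?m = "Suc n"
  obtain \<phi> where \<phi>: "\<phi> \<in> LinearCombinations.module_hom R (ideal_module R (I ?m)) (ideal_module R (I n))"
      and bij: "bij_betw \<phi> (I ?m) (I n)"
    using n[of ?m] unfolding module_isomorphic_def ideal_module_def by auto
  have smult: "\<phi> (r \<otimes> x) = r \<otimes> \<phi> x" if "r \<in> carrier R" "x \<in> I ?m" for r x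
    using \<phi> that unfolding LinearCombinations.module_hom_def ideal_module_def by simp
  have \<phi>I: "\<phi> x \<in> I n" if "x \<in> I ?m" for x using bij_betwE[OF bij] that by simp
  have \<phi>c: "\<phi> x \<in> carrier R" if "x \<in> I ?m" for x using ideal_carr[OF I(1) \<phi>I[OF that]] .
  have "s [^] n \<in> \<phi> ` I ?m" using I(3)[of n] bij_betw_imp_surj_on[OF bij] by simp
  then obtain b where b: "b \<in> I ?m" "\<phi> b = s [^] n" by auto
  have bc: "b \<in> carrier R" using ideal_carr[OF I(1) b(1)] .
  obtain q r where qr: "q \<in> \<pp>" "r \<in> carrier R" "b = q \<oplus> r \<otimes> s [^] ?m"
    using b(1) adjoin_iff unfolding I_def by blast
  have qc: "q \<in> carrier R" using p_closed(1)[OF qr(1)] .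
  have key: "\<exists>w\<in>\<pp>. s [^] n \<otimes> z = s \<otimes> (s [^] n \<otimes> (r \<otimes> w)) \<oplus> w \<otimes> q" if z: "z \<in> \<pp>" for z
  proof
    have zc: "z \<in> carrier R" and zI: "z \<in> I ?m" using p_closed(1)[OF z] I(2) z by auto
    define w where "w = \<phi> z"
    have wc: "w \<in> carrier R" using \<phi>c[OF zI] w_def by simp
    have "s [^] ?m \<otimes> w = \<phi> (s [^] ?m \<otimes> z)" unfolding w_def using smult[OF spow zI] by metis
    also have "\<dots> = \<phi> (z \<otimes> s [^] ?m)" using m_comm[OF spow zc] by metis
    also have "\<dots> = z \<otimes> \<phi> (s [^] ?m)" using smult[OF zc I(3)] .
    also have "\<dots> \<in> \<pp>" using p_closed(7)[OF \<phi>c[OF I(3)] z] .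
    finally show w: "w \<in> \<pp>" using p_prime[OF spow wc] p_compl_pow[OF s(1), of ?m] by blast
    have "\<phi> (s [^] n \<otimes> z) = s [^] n \<otimes> w" using smult[OF spow zI] w_def by simp
    also have "\<dots> = w \<otimes> \<phi> b" using b(2) m_comm[OF spow wc] by simp
    also have "\<dots> = \<phi> (w \<otimes> b)" using smult[OF wc b(1)] by simp
    finally have "s [^] n \<otimes> z = w \<otimes> b"
      by (rule inj_onD[OF bij_betw_imp_inj_on[OF bij] _
            ideal_lmult[OF I(1) spow zI] ideal_lmult[OF I(1) wc b(1)]])
    also have "\<dots> = s \<otimes> (s [^] n \<otimes> (r \<otimes> w)) \<oplus> w \<otimes> q"
      unfolding qr(3) using wc qc qr(2) spow sc by (simp add: r_distr m_ac a_comm)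
    finally show "s [^] n \<otimes> z = s \<otimes> (s [^] n \<otimes> (r \<otimes> w)) \<oplus> w \<otimes> q" .
  qed
  define N where "N = (\<lambda>x. s [^] n \<otimes> x) ` \<pp>"
  have N: "ideal N R"
  proof (rule idealI[OF ring_axioms])
    show "subgroup N (add_monoid R)"
    proof (rule add.subgroupI)
      show "N \<subseteq> carrier R" unfolding N_def using spow p_closed(1) by auto
      show "N \<noteq> {}" unfolding N_def using p_closed(2) by auto
      fix a b assume "a \<in> N" "b \<in> N"
      then obtain x y where xy: "x \<in> \<pp>" "y \<in> \<pp>" "a = s [^] n \<otimes> x" "b = s [^] n \<otimes> y" unfolding N_def by blast
      have "\<ominus> a = s [^] n \<otimes> \<ominus> x" using xy spow p_closed(1) by (simp add: r_minus)
      then show "\<ominus> a \<in> N" unfolding N_def using p_closed(4)[OF xy(1)] by blast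
      have "a \<oplus> b = s [^] n \<otimes> (x \<oplus> y)" using xy spow p_closed(1) by (simp add: r_distr)
      then show "a \<oplus> b \<in> N" unfolding N_def using p_closed(3)[OF xy(1,2)] by blast
    qed
    fix a r assume "a \<in> N" and r: "r \<in> carrier R"
    then obtain x where x: "x \<in> \<pp>" "a = s [^] n \<otimes> x" unfolding N_def by blast
    have "r \<otimes> a = s [^] n \<otimes> (r \<otimes> x)" "a \<otimes> r = s [^] n \<otimes> (r \<otimes> x)"
      using x r spow p_closed(1) by (simp_all add: m_ac)
    then show "r \<otimes> a \<in> N" "a \<otimes> r \<in> N" unfolding N_def using p_closed(6)[OF r x(1)] by blast+
  qed
  have "\<exists>y\<in>N. \<exists>d\<in>\<pp> \<cdot> \<pp>. x = s \<otimes> y \<oplus> d" if "x \<in> N" for x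
  proof -
    obtain z where z: "z \<in> \<pp>" "x = s [^] n \<otimes> z" using \<open>x \<in> N\<close> unfolding N_def by blast
    obtain w where w: "w \<in> \<pp>" "s [^] n \<otimes> z = s \<otimes> (s [^] n \<otimes> (r \<otimes> w)) \<oplus> w \<otimes> q" using key[OF z(1)] by blast
    have "s [^] n \<otimes> (r \<otimes> w) \<in> N" using p_closed(6)[OF qr(2) w(1)] N_def by blast
    then show ?thesis using w(2) z(2) ideal_prod.prod[OF w(1) qr(1)] by blast
  qed
  then obtain r' where r': "r' \<in> carrier R" "\<And>x. x \<in> N \<Longrightarrow> (\<one> \<ominus> s \<otimes> r') \<otimes> x \<in> \<pp> \<cdot> \<pp>"
    using nakayama[OF N sc ideal_prod_is_ideal[OF p_ideal p_ideal]] by blast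
  have u: "(\<one> \<ominus> s \<otimes> r') \<otimes> s [^] n \<in> carrier R - \<pp>"
    using p_compl_mult[OF s(2)[OF r'(1)] p_compl_pow[OF s(1)]] .
  have "(\<one> \<ominus> s \<otimes> r') \<otimes> s [^] n \<otimes> x \<in> \<pp> \<cdot> \<pp>" if x: "x \<in> \<pp>" for x
  proof -
    have "(\<one> \<ominus> s \<otimes> r') \<otimes> s [^] n \<otimes> x = (\<one> \<ominus> s \<otimes> r') \<otimes> (s [^] n \<otimes> x)"
      using sc r'(1) p_closed(1)[OF x] by (simp add: m_assoc)
    then show ?thesis using r'(2) x unfolding N_def by auto
  qed
  then show ?thesis using annihilator_of_conormal_torsion[OF u] by blast
qed

text \<open>The isomorphism is \<open>a + ry \<mapsto> fa + r(y' + t)\<close> for \<open>a \<in> T\<close>. The representation \<open>a + ry\<close> is unique up to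
  changing \<open>r\<close> by elements of \<open>\<pp>\<close>, since \<open>ry \<in> T \<subseteq> \<pp>\<close> forces \<open>r \<in> \<pp>\<close>. On such \<open>r\<close> the hypothesis
  on \<open>fy\<close> says \<open>r(y' + t) = fry\<close>, as \<open>s\<close> annihilates \<open>\<pp>\<close>; and \<open>f\<close> acts bijectively on \<open>\<pp>\<close> and on \<open>T\<close>,
  with inverse \<open>g\<close>.\<close>
lemma ideal_isomorphism:
  assumes T: "ideal T R" "T \<subseteq> \<pp>"
    and y: "y \<in> carrier R - \<pp>" and y': "y' \<in> carrier R - \<pp>"
    and s: "s \<in> carrier R" "\<And>x. x \<in> \<pp> \<Longrightarrow> s \<otimes> x = \<zero>"
    and carr: "f \<in> carrier R" "g \<in> carrier R" "h \<in> carrier R" "v \<in> carrier R" and t: "t \<in> T"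
    and unit: "f \<otimes> g = \<one> \<oplus> s \<otimes> h"
    and assoc: "f \<otimes> y = y' \<oplus> t \<oplus> s \<otimes> v"
  shows "module_isomorphic R (ideal_module R (T <+>\<^bsub>R\<^esub> PIdl y)) (ideal_module R (T <+>\<^bsub>R\<^esub> PIdl y'))"
proof -
  note Tc = ideal_carr[OF T(1)]
  have yc: "y \<in> carrier R" "y' \<in> carrier R" using y y' by auto
  have tc: "t \<in> carrier R" using Tc[OF t] .
  define z where "z = y' \<oplus> t"
  have zc: "z \<in> carrier R" using yc tc z_def by simp
  have z: "z \<notin> \<pp>" using ideal_add_cancel(1)[OF p_ideal yc(2), of t] t T(2) y' z_def by blast
  have fy: "r \<otimes> z = f \<otimes> (r \<otimes> y)" if r: "r \<in> \<pp>" for r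
  proof -
    have rc: "r \<in> carrier R" using p_closed(1)[OF r] .
    have "f \<otimes> (r \<otimes> y) = r \<otimes> (f \<otimes> y)" using rc carr yc by (simp add: m_ac)
    also have "\<dots> = r \<otimes> z \<oplus> (s \<otimes> r) \<otimes> v" unfolding assoc z_def using rc carr yc tc s(1) by (simp add: r_distr m_ac)
    also have "\<dots> = r \<otimes> z" using s(2)[OF r] carr rc zc by simp
    finally show ?thesis by simp
  qed
  have finj: "x = \<zero>" if x: "x \<in> \<pp>" and "f \<otimes> x = \<zero>" for x
  proof -
    have xc: "x \<in> carrier R" using p_closed(1)[OF x] .
    have "\<zero> = g \<otimes> (f \<otimes> x)" using that carr by simp
    also have "\<dots> = (f \<otimes> g) \<otimes> x" using carr xc by (simp add: m_ac)
    also have "\<dots> = x \<oplus> h \<otimes> (s \<otimes> x)" unfolding unit using carr xc s(1) by (simp add: l_distr r_distr m_ac)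
    also have "\<dots> = x" using s(2)[OF x] carr xc by simp
    finally show ?thesis by simp
  qed
  have fg: "f \<otimes> (g \<otimes> x) = x" if x: "x \<in> \<pp>" for x
  proof -
    have xc: "x \<in> carrier R" using p_closed(1)[OF x] .
    have "f \<otimes> (g \<otimes> x) = (f \<otimes> g) \<otimes> x" using carr xc by (simp add: m_ac)
    also have "\<dots> = x \<oplus> h \<otimes> (s \<otimes> x)" unfolding unit using carr xc s(1) by (simp add: l_distr r_distr m_ac)
    also have "\<dots> = x" using s(2)[OF x] carr xc by simp
    finally show ?thesis .
  qed
  have move: "a \<oplus> r = b \<oplus> q \<longleftrightarrow> r \<ominus> q = b \<ominus> a"
    if "a \<in> carrier R" "b \<in> carrier R" "r \<in> carrier R" "q \<in> carrier R" for a b r q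
  proof -
    have "a \<oplus> r \<ominus> (a \<oplus> q) = r \<ominus> q" "b \<oplus> q \<ominus> (a \<oplus> q) = b \<ominus> a" using that by algebra+
    then show ?thesis using that by (metis add.right_cancel a_minus_def a_closed a_inv_closed)
  qed
  \<comment> \<open>One equivalence shows both that the map is well defined and that it is injective.\<close>
  have graph: "a \<oplus> r \<otimes> y = b \<oplus> q \<otimes> y \<longleftrightarrow> f \<otimes> a \<oplus> r \<otimes> z = f \<otimes> b \<oplus> q \<otimes> z"
    if ab: "a \<in> T" "b \<in> T" and rq: "r \<in> carrier R" "q \<in> carrier R" for a b r q
  proof -
    have ac: "a \<in> carrier R" "b \<in> carrier R" using Tc ab by auto
    have d: "b \<ominus> a \<in> \<pp>" using ideal_diff[OF T(1) ab(2,1)] T(2) by blast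
    have L: "a \<oplus> r \<otimes> y = b \<oplus> q \<otimes> y \<longleftrightarrow> (r \<ominus> q) \<otimes> y = b \<ominus> a"
      using move[of a b "r \<otimes> y" "q \<otimes> y"] ac rq yc by (simp add: a_minus_def l_distr l_minus)
    have R: "f \<otimes> a \<oplus> r \<otimes> z = f \<otimes> b \<oplus> q \<otimes> z \<longleftrightarrow> (r \<ominus> q) \<otimes> z = f \<otimes> (b \<ominus> a)"
      using move[of "f \<otimes> a" "f \<otimes> b" "r \<otimes> z" "q \<otimes> z"] ac rq zc carr
      by (simp add: a_minus_def l_distr l_minus r_distr r_minus)
    show ?thesis unfolding L R
    proof
      assume eq: "(r \<ominus> q) \<otimes> y = b \<ominus> a"
      then have "r \<ominus> q \<in> \<pp>" using p_prime[of "r \<ominus> q" y] d y rq by auto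
      then show "(r \<ominus> q) \<otimes> z = f \<otimes> (b \<ominus> a)" using fy eq by metis
    next
      assume eq: "(r \<ominus> q) \<otimes> z = f \<otimes> (b \<ominus> a)"
      then have "(r \<ominus> q) \<otimes> z \<in> \<pp>" using p_closed(6)[OF carr(1) d] by simp
      then have rqp: "r \<ominus> q \<in> \<pp>" using p_prime[of "r \<ominus> q" z] z zc rq by auto
      have "f \<otimes> ((r \<ominus> q) \<otimes> y \<ominus> (b \<ominus> a)) = f \<otimes> ((r \<ominus> q) \<otimes> y) \<ominus> f \<otimes> (b \<ominus> a)"
        using carr rq yc ac by (simp add: a_minus_def r_distr r_minus)
      also have "\<dots> = \<zero>" using fy[OF rqp] eq carr ac by (simp add: a_minus_def r_neg)
      finally have "(r \<ominus> q) \<otimes> y \<ominus> (b \<ominus> a) = \<zero>"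
        using finj p_closed(5)[OF p_closed(7)[OF yc(1) rqp] d] by blast
      then show "(r \<ominus> q) \<otimes> y = b \<ominus> a" using rq yc ac by (simp add: r_right_minus_eq)
    qed
  qed
  let ?I = "T <+>\<^bsub>R\<^esub> PIdl y" and ?J = "T <+>\<^bsub>R\<^esub> PIdl y'"
  define \<phi> where "\<phi> x = (THE w. \<exists>a\<in>T. \<exists>r\<in>carrier R. x = a \<oplus> r \<otimes> y \<and> w = f \<otimes> a \<oplus> r \<otimes> z)" for x
  have \<phi>: "\<phi> (a \<oplus> r \<otimes> y) = f \<otimes> a \<oplus> r \<otimes> z" if "a \<in> T" "r \<in> carrier R" for a r
    unfolding \<phi>_def
  proof (rule the_equality)
    fix w assume "\<exists>b\<in>T. \<exists>q\<in>carrier R. a \<oplus> r \<otimes> y = b \<oplus> q \<otimes> y \<and> w = f \<otimes> b \<oplus> q \<otimes> z"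
    then obtain b q where "b \<in> T" "q \<in> carrier R" "a \<oplus> r \<otimes> y = b \<oplus> q \<otimes> y" "w = f \<otimes> b \<oplus> q \<otimes> z" by auto
    then show "w = f \<otimes> a \<oplus> r \<otimes> z" using graph that by metis
  qed (use that in auto)
  have zJ: "a \<oplus> r \<otimes> z \<in> ?J" if "a \<in> T" "r \<in> carrier R" for a r
  proof -
    have "a \<oplus> r \<otimes> z = (a \<oplus> r \<otimes> t) \<oplus> r \<otimes> y'" unfolding z_def
      using Tc that tc yc by (simp add: r_distr a_ac)
    moreover have "a \<oplus> r \<otimes> t \<in> T" using ideal_add[OF T(1) that(1) ideal_lmult[OF T(1) that(2) t]] .
    ultimately show ?thesis unfolding adjoin_iff using that(2) by auto
  qed
  have \<phi>_img: "\<phi> ` ?I = ?J"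
  proof
    show "\<phi> ` ?I \<subseteq> ?J"
    proof (rule image_subsetI)
      fix x assume "x \<in> ?I"
      then obtain a r where "a \<in> T" "r \<in> carrier R" "x = a \<oplus> r \<otimes> y" using adjoin_iff by metis
      then show "\<phi> x \<in> ?J" using \<phi> zJ ideal_lmult[OF T(1) carr(1)] by simp
    qed
    show "?J \<subseteq> \<phi> ` ?I"
    proof
      fix w assume "w \<in> ?J"
      then obtain b r where br: "b \<in> T" "r \<in> carrier R" "w = b \<oplus> r \<otimes> y'" using adjoin_iff by blast
      define d where "d = b \<ominus> r \<otimes> t"
      have d: "d \<in> T" using ideal_diff[OF T(1) br(1) ideal_lmult[OF T(1) br(2) t]] d_def by simp
      have "b \<oplus> r \<otimes> y' = d \<oplus> r \<otimes> z" unfolding d_def z_def using Tc[OF br(1)] br(2) tc yc by algebra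
      then have "w = f \<otimes> (g \<otimes> d) \<oplus> r \<otimes> z" using fg d T(2) br(3) by auto
      also have "\<dots> = \<phi> (g \<otimes> d \<oplus> r \<otimes> y)" using \<phi> ideal_lmult[OF T(1) carr(2) d] br(2) by simp
      finally show "w \<in> \<phi> ` ?I" using ideal_lmult[OF T(1) carr(2) d] br(2) adjoin_iff[of _ T y] by auto
    qed
  qed
  have \<phi>_inj: "inj_on \<phi> ?I"
  proof (rule inj_onI)
    fix x w assume "x \<in> ?I" "w \<in> ?I" and eq: "\<phi> x = \<phi> w"
    then obtain a r b q where "a \<in> T" "r \<in> carrier R" "x = a \<oplus> r \<otimes> y"
        "b \<in> T" "q \<in> carrier R" "w = b \<oplus> q \<otimes> y"
      using adjoin_iff by metis
    then show "x = w" using eq \<phi> graph by simp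
  qed
  have \<phi>_add: "\<phi> (x \<oplus> w) = \<phi> x \<oplus> \<phi> w" if "x \<in> ?I" "w \<in> ?I" for x w
  proof -
    obtain a r where a: "a \<in> T" "r \<in> carrier R" "x = a \<oplus> r \<otimes> y"
      using \<open>x \<in> ?I\<close> adjoin_iff by metis
    obtain b q where b: "b \<in> T" "q \<in> carrier R" "w = b \<oplus> q \<otimes> y"
      using \<open>w \<in> ?I\<close> adjoin_iff by metis
    have "x \<oplus> w = (a \<oplus> b) \<oplus> (r \<oplus> q) \<otimes> y" using a b Tc yc by (simp add: l_distr a_ac)
    then have "\<phi> (x \<oplus> w) = f \<otimes> (a \<oplus> b) \<oplus> (r \<oplus> q) \<otimes> z" using \<phi> ideal_add[OF T(1) a(1) b(1)] a b by simp
    also have "\<dots> = \<phi> x \<oplus> \<phi> w" using \<phi> a b Tc carr zc by (simp add: l_distr r_distr a_ac)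
    finally show ?thesis .
  qed
  have \<phi>_smult: "\<phi> (k \<otimes> x) = k \<otimes> \<phi> x" if "k \<in> carrier R" "x \<in> ?I" for k x
  proof -
    obtain a r where a: "a \<in> T" "r \<in> carrier R" "x = a \<oplus> r \<otimes> y"
      using \<open>x \<in> ?I\<close> adjoin_iff by metis
    have "k \<otimes> x = k \<otimes> a \<oplus> (k \<otimes> r) \<otimes> y" using a that Tc yc by (simp add: r_distr m_ac)
    then have "\<phi> (k \<otimes> x) = f \<otimes> (k \<otimes> a) \<oplus> (k \<otimes> r) \<otimes> z" using \<phi> ideal_lmult[OF T(1) that(1) a(1)] a that by simp
    also have "\<dots> = k \<otimes> \<phi> x" using \<phi> a that Tc carr zc by (simp add: r_distr m_ac)
    finally show ?thesis .
  qed
  show ?thesis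
    unfolding module_isomorphic_def
    by (rule bexI[of _ \<phi>])
      (use \<phi>_img \<phi>_inj \<phi>_add \<phi>_smult in
        \<open>auto simp: LinearCombinations.module_hom_def ideal_module_def bij_betw_def\<close>)
qed

text \<open>Fitting's lemma for multiplication by \<open>c\<close> on \<open>R/sR\<close>, which has finite length: there is an idempotent
  \<open>e\<close> modulo \<open>s\<close> such that \<open>c\<close> is invertible on \<open>eR\<close> and nilpotent on \<open>(1 - e)R\<close>. Keeping \<open>c\<close> on the first part
  and replacing it by \<open>1\<close> on the second gives \<open>f = ce + (1 - e)\<close>, a unit modulo \<open>s\<close>; it is written here so
  that it visibly differs from \<open>c\<close> by a multiple of \<open>1 - e\<close>.\<close>
lemma fitting_element:
  assumes s: "s \<in> carrier R - \<pp>" and c: "c \<in> carrier R"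
  obtains n :: nat and e f g h k where "e \<in> carrier R" "f \<in> carrier R" "g \<in> carrier R" "h \<in> carrier R" "k \<in> carrier R"
    "c [^] n \<otimes> (\<one> \<ominus> e) = s \<otimes> k" "f = c \<oplus> (\<one> \<ominus> c) \<otimes> (\<one> \<ominus> e)" "f \<otimes> g = \<one> \<oplus> s \<otimes> h"
proof -
  have sc: "s \<in> carrier R" using s by blast
  have S: "ideal (PIdl s) R" using cgenideal_ideal sc by blast
  have cp: "c [^] n \<in> carrier R" for n :: nat using c by simp
  define J where "J n = PIdl s <+>\<^bsub>R\<^esub> PIdl (c [^] (n::nat))" for n
  note J = adjoin_ideal[OF S cp, folded J_def] adjoin_supset[OF S cp, folded J_def]
  have "c [^] Suc n \<in> J n" for n
    using ideal_lmult[OF J(1) c J(3), of n] c cp by (simp add: m_comm)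
  then have desc: "J (Suc n) \<subseteq> J n" for n
    using adjoin_least[OF J(1) J(2)] unfolding J_def by blast
  have "J n \<subseteq> carrier R" for n using ideal_carr[OF J(1)] by auto
  then obtain n where n: "\<And>m. m \<ge> n \<Longrightarrow> J m = J n"
    using finite_length_between_dcc[of R "PIdl s" "carrier R" J] J desc
      finite_length_between_above_p[OF S cgenideal_self[OF sc] s] by metis
  \<comment> \<open>With \<open>N = n + 1\<close>, so that \<open>c\<^sup>N\<close> has a factor \<open>c\<close> to split off, \<open>c\<^sup>N \<equiv> \<rho>c\<^sup>2\<^sup>N\<close> modulo \<open>s\<close>, and
    \<open>\<rho>c\<^sup>N\<close> is idempotent.\<close>
  have "J (Suc n) = J (Suc n + Suc n)" using n[of "Suc n"] n[of "Suc n + Suc n"] by simp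
  then have "c [^] Suc n \<in> J (Suc n + Suc n)" using J(3) by metis
  then obtain k \<rho> where k: "k \<in> carrier R" "\<rho> \<in> carrier R"
      "c [^] Suc n = k \<otimes> s \<oplus> \<rho> \<otimes> c [^] (Suc n + Suc n)"
    unfolding J_def adjoin_iff by (auto simp: cgenideal_def)
  define d where "d = c [^] n"
  have dc: "d \<in> carrier R" using cp d_def by simp
  have pow1: "c [^] Suc n = d \<otimes> c" using d_def by simp
  have pow2: "c [^] (Suc n + Suc n) = (d \<otimes> c) \<otimes> (d \<otimes> c)"
    using nat_pow_mult[OF c, of "Suc n" "Suc n"] unfolding pow1 by simp
  define e where "e = \<rho> \<otimes> (d \<otimes> c)"
  have ec: "e \<in> carrier R" using e_def dc c k by simp
  define u where "u = \<one> \<ominus> e"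
  have uc: "u \<in> carrier R" using ec u_def by simp
  have eu: "e \<oplus> u = \<one>" using ec unfolding u_def by algebra
  have "(d \<otimes> c) \<otimes> u = (d \<otimes> c) \<ominus> \<rho> \<otimes> ((d \<otimes> c) \<otimes> (d \<otimes> c))"
    unfolding u_def e_def using dc c k by (simp add: a_minus_def r_distr r_minus m_ac)
  also have "\<dots> = k \<otimes> s"
  proof -
    have "(d \<otimes> c) = k \<otimes> s \<oplus> \<rho> \<otimes> ((d \<otimes> c) \<otimes> (d \<otimes> c))" using k(3) unfolding pow1 pow2 .
    moreover have "A \<ominus> B = K" if "A = K \<oplus> B" "K \<in> carrier R" "B \<in> carrier R" for A B K
      using that by (simp add: a_minus_def a_assoc r_neg)
    ultimately show ?thesis using k dc c sc by blast
  qed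
  finally have cu: "(d \<otimes> c) \<otimes> u = k \<otimes> s" .
  define f where "f = c \<otimes> e \<oplus> u"
  define g where "g = (d \<otimes> \<rho>) \<otimes> e \<oplus> u"
  have fc: "f \<in> carrier R" "g \<in> carrier R" using f_def g_def c ec uc dc k by auto
  define X where "X = c \<oplus> d \<otimes> \<rho> \<ominus> e \<ominus> \<one> \<ominus> \<one>"
  have Xc: "X \<in> carrier R" using X_def c dc k ec by simp
  have "f \<otimes> g = (\<rho> \<otimes> (d \<otimes> c)) \<otimes> (e \<otimes> e) \<oplus> (c \<oplus> d \<otimes> \<rho>) \<otimes> (e \<otimes> u) \<oplus> u \<otimes> u"
    unfolding f_def g_def using c ec uc dc k by (simp add: l_distr r_distr m_ac a_ac)
  also have "\<dots> = e \<otimes> (e \<otimes> e) \<oplus> (c \<oplus> d \<otimes> \<rho>) \<otimes> (e \<otimes> u) \<oplus> u \<otimes> u" using e_def by simp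
  also have "\<dots> = (e \<oplus> u) \<oplus> X \<otimes> (e \<otimes> u)"
  proof -
    have ee: "e \<otimes> e = e \<ominus> e \<otimes> u" and uu: "u \<otimes> u = u \<ominus> e \<otimes> u"
      unfolding u_def using ec by algebra+
    have eee: "e \<otimes> (e \<otimes> e) = e \<ominus> e \<otimes> u \<ominus> e \<otimes> (e \<otimes> u)"
      unfolding ee using ec uc ee by (simp add: a_minus_def r_distr r_minus)
    show ?thesis unfolding eee uu X_def
      using ec uc c dc k(1,2) by (simp add: ring_norm)
  qed
  also have "\<dots> = \<one> \<oplus> X \<otimes> (e \<otimes> u)" unfolding eu ..
  also have "e \<otimes> u = \<rho> \<otimes> (k \<otimes> s)" unfolding cu[symmetric] e_def using dc c k uc by (simp add: m_ac)
  also have "\<one> \<oplus> X \<otimes> (\<rho> \<otimes> (k \<otimes> s)) = \<one> \<oplus> s \<otimes> (X \<otimes> (\<rho> \<otimes> k))"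
    using Xc k sc by (simp add: m_ac)
  finally have fg: "f \<otimes> g = \<one> \<oplus> s \<otimes> (X \<otimes> (\<rho> \<otimes> k))" .
  have "f = c \<oplus> (\<one> \<ominus> c) \<otimes> u" 
  proof -
    have "c \<otimes> e \<oplus> u = c \<otimes> (e \<oplus> u) \<oplus> (\<one> \<ominus> c) \<otimes> u" using c ec uc by algebra
    then show ?thesis unfolding f_def eu using c by simp
  qed
  moreover have "c [^] Suc n \<otimes> u = s \<otimes> k" unfolding pow1 cu using k sc by (simp add: m_comm)
  ultimately show ?thesis
    using that[of e f g "X \<otimes> (\<rho> \<otimes> k)" k "Suc n"] ec fc Xc k fg unfolding u_def by simp
qed

lemma module_isomorphic_refl: "module_isomorphic R M M"
  unfolding module_isomorphic_def
  by (rule bexI[of _ "\<lambda>x. x"]) (auto simp: LinearCombinations.module_hom_def bij_betw_def)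

text \<open>Far out in the chain \<open>I\<^sub>n \<inter> \<pp> = T\<close> and \<open>I\<^sub>n + sR\<close> are constant. In the main case \<open>I\<^sub>m = T + yR\<close> and
  \<open>I\<^sub>n = T + zR\<close>, where \<open>z \<equiv> cy\<close> and \<open>y \<equiv> dz\<close> modulo \<open>L = T + sR\<close>. So \<open>y \<equiv> (dc)\<^sup>ky\<close>, which means that the part
  of \<open>y\<close> on which \<open>c\<close> is nilpotent is zero modulo \<open>L\<close>. The factor \<open>c\<close> can therefore be replaced by a
  unit \<open>f\<close> modulo \<open>s\<close>.\<close>
lemma iso_artinian_of_annihilator:
  assumes s: "s \<in> carrier R - \<pp>" "\<And>x. x \<in> \<pp> \<Longrightarrow> s \<otimes> x = \<zero>"
  shows "iso_artinian R"
  unfolding iso_artinian_def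
proof (intro allI impI, elim conjE)
  fix I :: "nat \<Rightarrow> 'a set"
  assume "\<forall>n. ideal (I n) R" and "\<forall>n. I (Suc n) \<subseteq> I n"
  then have I: "ideal (I n) R" and desc: "I (Suc n) \<subseteq> I n" for n by auto
  have anti: "I n \<subseteq> I m" if "m \<le> n" for m n
    using that by (rule lift_Suc_antimono_le[of I, rotated]) (rule desc)
  have sc: "s \<in> carrier R" using s(1) by blast
  have S: "ideal (PIdl s) R" using cgenideal_ideal sc by blast
  define J where "J n = I n <+>\<^bsub>R\<^esub> PIdl s" for n
  note J = adjoin_ideal[OF I sc, folded J_def] adjoin_supset[OF I sc, folded J_def]
  have Jdesc: "J (Suc n) \<subseteq> J n" for n
    using adjoin_least[OF J(1) order_trans[OF desc J(2)] J(3)] unfolding J_def by simp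
  have SJ: "PIdl s \<subseteq> J n" for n using cgenideal_minimal[OF J(1) J(3)] .
  have Jc: "J n \<subseteq> carrier R" for n using ideal_carr[OF J(1)] by auto
  obtain n2 where n2: "\<And>n. n \<ge> n2 \<Longrightarrow> J n = J n2"
    using finite_length_between_dcc[of R "PIdl s" "carrier R" J,
        OF finite_length_between_above_p[OF S cgenideal_self[OF sc] s(1)] J(1) SJ Jc Jdesc] by metis
  have T: "ideal (I n \<inter> \<pp>) R" "{\<zero>} \<subseteq> I n \<inter> \<pp>" "I n \<inter> \<pp> \<subseteq> \<pp>" "I (Suc n) \<inter> \<pp> \<subseteq> I n \<inter> \<pp>" for n
    using i_intersect[OF I p_ideal] ideal_zero[OF I] p_closed(2) desc by auto
  obtain n1 where n1: "\<And>n. n \<ge> n1 \<Longrightarrow> I n \<inter> \<pp> = I n1 \<inter> \<pp>"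
    using finite_length_between_dcc[of R "{\<zero>}" \<pp> "\<lambda>n. I n \<inter> \<pp>",
          OF finite_length_p[OF s] T] by metis
  define m where "m = max n1 n2"
  have stab: "I n \<inter> \<pp> = I m \<inter> \<pp>" "J n = J m" if "n \<ge> m" for n
    using n1[of n] n1[of m] n2[of n] n2[of m] that unfolding m_def by auto
  show "\<exists>n\<^sub>0. \<forall>n\<ge>n\<^sub>0. module_isomorphic R (ideal_module R (I n)) (ideal_module R (I n\<^sub>0))"
  proof (cases "\<exists>n\<ge>m. I n \<subseteq> \<pp>")
    case True
    then obtain k where k: "k \<ge> m" "I k \<subseteq> \<pp>" by blast
    have "I n = I k" if "n \<ge> k" for n
      using stab(1)[of n] stab(1)[of k] k that anti[OF that] by auto
    then show ?thesis using module_isomorphic_refl by metis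
  next
    case False
    define T where "T = I m \<inter> \<pp>"
    have T: "ideal T R" "T \<subseteq> \<pp>" using i_intersect[OF I p_ideal] T_def by auto
    have TI: "T \<subseteq> I n" if "n \<ge> m" for n using stab(1)[OF that] T_def by auto
    have gen: "\<exists>y\<in>carrier R - \<pp>. I n = T <+>\<^bsub>R\<^esub> PIdl y" if n: "n \<ge> m" for n
    proof -
      obtain y where y: "y \<in> I n" "\<And>x. x \<in> I n \<Longrightarrow> \<exists>r\<in>carrier R. x \<ominus> r \<otimes> y \<in> \<pp>"
        using principal[OF I, of n] by auto
      have yc: "y \<in> carrier R" using ideal_carr[OF I y(1)] .
      have sub: "I n \<subseteq> T <+>\<^bsub>R\<^esub> PIdl y"
      proof
        fix x assume x: "x \<in> I n"
        then obtain r where r: "r \<in> carrier R" "x \<ominus> r \<otimes> y \<in> \<pp>" using y(2) by metis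
        have "x \<ominus> r \<otimes> y \<in> T"
          using r(2) ideal_diff[OF I x ideal_lmult[OF I r(1) y(1)]] stab(1)[OF n] T_def by auto
        moreover have "x = (x \<ominus> r \<otimes> y) \<oplus> r \<otimes> y" using ideal_carr[OF I x] r(1) yc by algebra
        ultimately show "x \<in> T <+>\<^bsub>R\<^esub> PIdl y" using r(1) adjoin_iff by metis
      qed
      have "y \<notin> \<pp>"
        using adjoin_least[OF p_ideal T(2), of y] order_trans[OF sub] False n by blast
      moreover have "I n = T <+>\<^bsub>R\<^esub> PIdl y" using sub adjoin_least[OF I TI[OF n] y(1)] by simp
      ultimately show ?thesis using yc by auto
    qed
    obtain y where y: "y \<in> carrier R - \<pp>" "I m = T <+>\<^bsub>R\<^esub> PIdl y" using gen by auto
    have yc: "y \<in> carrier R" using y by simp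
    note Tc = ideal_carr[OF T(1)]
    have "module_isomorphic R (ideal_module R (I n)) (ideal_module R (I m))" if n: "n \<ge> m" for n
    proof -
      obtain z where z: "z \<in> carrier R - \<pp>" "I n = T <+>\<^bsub>R\<^esub> PIdl z" using gen[OF n] by auto
      have zc: "z \<in> carrier R" using z by simp
      have "z \<in> I m" using anti[OF n] adjoin_supset(2)[OF T(1) zc] z(2) by auto
      then obtain a c where ac: "a \<in> T" "c \<in> carrier R" "z = a \<oplus> c \<otimes> y" unfolding y(2) adjoin_iff by auto
      have "y \<in> J m" using adjoin_supset(2)[OF T(1) yc] y(2) J(2) by auto
      then have "y \<in> J n" using stab(2)[OF n] by simp
      then obtain x v where xv: "x \<in> I n" "v \<in> carrier R" "y = x \<oplus> v \<otimes> s" unfolding J_def adjoin_iff by auto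
      then obtain b d where bd: "b \<in> T" "d \<in> carrier R" "x = b \<oplus> d \<otimes> z" unfolding z(2) adjoin_iff by auto
      note carr = Tc[OF ac(1)] Tc[OF bd(1)] ac(2) bd(2) xv(2) yc zc sc
      define L where "L = T <+>\<^bsub>R\<^esub> PIdl s"
      note L = adjoin_ideal[OF T(1) sc, folded L_def] adjoin_supset[OF T(1) sc, folded L_def]
      have L1: "(\<one> \<ominus> d \<otimes> c) \<otimes> y \<in> L"
      proof -
        have "y = b \<oplus> d \<otimes> (a \<oplus> c \<otimes> y) \<oplus> v \<otimes> s" using xv(3) bd(3) ac(3) by simp
        also have "\<dots> = (b \<oplus> d \<otimes> a \<oplus> v \<otimes> s) \<oplus> (d \<otimes> c) \<otimes> y" using carr by algebra
        finally have eq: "y = (b \<oplus> d \<otimes> a \<oplus> v \<otimes> s) \<oplus> (d \<otimes> c) \<otimes> y" .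
        have "A \<ominus> B = K" if "A = K \<oplus> B" "K \<in> carrier R" "B \<in> carrier R" for A B K
          using that by (simp add: a_minus_def a_assoc r_neg)
        from this[OF eq] have "y \<ominus> (d \<otimes> c) \<otimes> y = b \<oplus> d \<otimes> a \<oplus> v \<otimes> s" using carr by simp
        moreover have "(\<one> \<ominus> d \<otimes> c) \<otimes> y = y \<ominus> (d \<otimes> c) \<otimes> y" using carr by algebra
        moreover have "b \<oplus> d \<otimes> a \<oplus> v \<otimes> s \<in> L"
          by (intro ideal_add[OF L(1)] ideal_lmult[OF L(1)] subsetD[OF L(2)] L(3) ac(1) bd(1,2) xv(2))
        ultimately show ?thesis by simp
      qed
      have Lk: "(\<one> \<ominus> d [^] k \<otimes> c [^] k) \<otimes> y \<in> L" for k :: nat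
      proof (induction k)
        case 0
        have "(\<one> \<ominus> \<one> \<otimes> \<one>) \<otimes> y = \<zero>" using yc by algebra
        then show ?case using ideal_zero[OF L(1)] by simp
      next
        case (Suc k)
        define p q where "p = d [^] k" and "q = c [^] k"
        have pq: "p \<in> carrier R" "q \<in> carrier R" using p_def q_def carr by auto
        have "(\<one> \<ominus> (p \<otimes> d) \<otimes> (q \<otimes> c)) \<otimes> y = (\<one> \<ominus> p \<otimes> q) \<otimes> y \<oplus> (p \<otimes> q) \<otimes> ((\<one> \<ominus> d \<otimes> c) \<otimes> y)"
          using carr pq by algebra
        moreover have "(\<one> \<ominus> p \<otimes> q) \<otimes> y \<in> L" using Suc p_def q_def by simp
        moreover have "(p \<otimes> q) \<otimes> ((\<one> \<ominus> d \<otimes> c) \<otimes> y) \<in> L" using ideal_lmult[OF L(1) _ L1] pq by simp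
        ultimately show ?case unfolding p_def[symmetric] q_def[symmetric] using ideal_add[OF L(1)] p_def q_def by simp
      qed
      obtain k :: nat and e f g h q where e: "e \<in> carrier R" "f \<in> carrier R" "g \<in> carrier R" "h \<in> carrier R"
          "q \<in> carrier R" "c [^] k \<otimes> (\<one> \<ominus> e) = s \<otimes> q" "f = c \<oplus> (\<one> \<ominus> c) \<otimes> (\<one> \<ominus> e)" "f \<otimes> g = \<one> \<oplus> s \<otimes> h"
        using fitting_element[OF s(1) ac(2)] .
      have Le: "(\<one> \<ominus> e) \<otimes> y \<in> L"
      proof -
        define p r u where "p = d [^] k" and "r = c [^] k" and "u = \<one> \<ominus> e"
        have pr: "p \<in> carrier R" "r \<in> carrier R" "u \<in> carrier R" using p_def r_def u_def carr e(1) by auto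
        have "u \<otimes> y = u \<otimes> ((\<one> \<ominus> p \<otimes> r) \<otimes> y) \<oplus> (p \<otimes> y) \<otimes> (r \<otimes> u)" using pr yc by algebra
        also have "r \<otimes> u = q \<otimes> s" using e(6) m_comm[OF e(5) sc] r_def u_def by simp
        also have "u \<otimes> ((\<one> \<ominus> p \<otimes> r) \<otimes> y) \<oplus> (p \<otimes> y) \<otimes> (q \<otimes> s) \<in> L"
          using ideal_add[OF L(1)] ideal_lmult[OF L(1)] L(3) Lk[of k] pr yc e(5) p_def r_def by simp
        finally show ?thesis unfolding u_def .
      qed
      have "(\<one> \<ominus> c) \<otimes> ((\<one> \<ominus> e) \<otimes> y) \<in> L" using ideal_lmult[OF L(1) _ Le] ac(2) by simp
      then obtain t w where tw: "t \<in> T" "w \<in> carrier R" "(\<one> \<ominus> c) \<otimes> ((\<one> \<ominus> e) \<otimes> y) = t \<oplus> w \<otimes> s"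
        unfolding L_def adjoin_iff by auto
      have tc: "t \<in> carrier R" using Tc[OF tw(1)] .
      have fy: "f \<otimes> y = z \<oplus> (t \<ominus> a) \<oplus> s \<otimes> w"
      proof -
        have "f \<otimes> y = c \<otimes> y \<oplus> (\<one> \<ominus> c) \<otimes> ((\<one> \<ominus> e) \<otimes> y)"
          unfolding e(7) using carr e(1) by (simp add: l_distr m_assoc)
        also have "\<dots> = c \<otimes> y \<oplus> (t \<oplus> w \<otimes> s)" unfolding tw(3) ..
        also have "\<dots> = (a \<oplus> c \<otimes> y) \<oplus> (t \<ominus> a) \<oplus> s \<otimes> w" using carr tc tw(2) by algebra
        finally show ?thesis using ac(3) by simp
      qed
      \<comment> \<open>Multiplying \<open>fy = z + l + sw\<close> by the inverse \<open>g\<close> of \<open>f\<close> modulo \<open>s\<close> reverses the direction.\<close>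
      define l where "l = t \<ominus> a"
      have l: "l \<in> T" "l \<in> carrier R" using ideal_diff[OF T(1) tw(1) ac(1)] Tc l_def by auto
      have "g \<otimes> z = y \<oplus> (\<ominus> (g \<otimes> l)) \<oplus> s \<otimes> (h \<otimes> y \<ominus> g \<otimes> w)"
      proof -
        have "g \<otimes> (f \<otimes> y) = g \<otimes> z \<oplus> g \<otimes> l \<oplus> s \<otimes> (g \<otimes> w)"
          unfolding fy l_def[symmetric] using carr e(3) l tw(2) by (simp add: r_distr m_ac)
        moreover have "g \<otimes> (f \<otimes> y) = y \<oplus> s \<otimes> (h \<otimes> y)"
        proof -
          have "g \<otimes> (f \<otimes> y) = (f \<otimes> g) \<otimes> y" using carr e(2,3) by (simp add: m_ac)
          also have "\<dots> = y \<oplus> s \<otimes> (h \<otimes> y)" unfolding e(8) using carr e(4) by (simp add: l_distr m_assoc)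
          finally show ?thesis .
        qed
        ultimately have eq: "y \<oplus> s \<otimes> (h \<otimes> y) = g \<otimes> z \<oplus> g \<otimes> l \<oplus> s \<otimes> (g \<otimes> w)" by simp
        have "g \<otimes> z = (g \<otimes> z \<oplus> g \<otimes> l \<oplus> s \<otimes> (g \<otimes> w)) \<ominus> g \<otimes> l \<ominus> s \<otimes> (g \<otimes> w)"
          using carr e(3) l(2) tw(2) by algebra
        also have "\<dots> = y \<oplus> (\<ominus> (g \<otimes> l)) \<oplus> s \<otimes> (h \<otimes> y \<ominus> g \<otimes> w)"
          unfolding eq[symmetric] using carr e(3,4) l(2) tw(2) by algebra
        finally show ?thesis .
      qed
      moreover have "g \<otimes> f = \<one> \<oplus> s \<otimes> h" using e(8) m_comm[OF e(2,3)] by simp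
      moreover have "\<ominus> (g \<otimes> l) \<in> T" using ideal_neg[OF T(1)] ideal_lmult[OF T(1) e(3) l(1)] by simp
      moreover have "h \<otimes> y \<ominus> g \<otimes> w \<in> carrier R" using carr e(3,4) tw(2) by simp
      ultimately show ?thesis
        unfolding y(2) z(2) using ideal_isomorphism[OF T z(1) y(1) sc s(2) e(3,2,4)] by simp
    qed
    then show ?thesis by blast
  qed
qed

end


section \<open>Localization of modules and rings\<close>

text \<open>The localization of a module, as an additive group. It serves twice: for \<open>M = D\<close> it is the additive
  group of the localized ring, and for general \<open>M\<close> it detects torsion.\<close>
locale module_localization = Module.module D M + submonoid S D for D (structure) and M and S
begin

text \<open>The fraction \<open>m/s\<close>. Arguments outside \<open>M \<times> S\<close> yield the empty set, exactly as for
  \<^const>\<open>loc_frac\<close>, so that the two agree without side conditions when \<open>M\<close> is the ring.\<close>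
definition mfrac :: "'c \<Rightarrow> 'a \<Rightarrow> ('c \<times> 'a) set" where
  "mfrac m s = {(n, t). m \<in> carrier M \<and> s \<in> S \<and> n \<in> carrier M \<and> t \<in> S \<and> (\<exists>u\<in>S. u \<odot>\<^bsub>M\<^esub> (t \<odot>\<^bsub>M\<^esub> m) = u \<odot>\<^bsub>M\<^esub> (s \<odot>\<^bsub>M\<^esub> n))}"

definition frac_group :: "('c \<times> 'a) set monoid" where
  "frac_group =
     \<lparr>carrier = {mfrac m s | m s. m \<in> carrier M \<and> s \<in> S},
      monoid.mult = (\<lambda>X Y. \<Union>x\<in>X. \<Union>y\<in>Y. case (x, y) of ((m, s), (n, t)) \<Rightarrow>
                       mfrac (t \<odot>\<^bsub>M\<^esub> m \<oplus>\<^bsub>M\<^esub> s \<odot>\<^bsub>M\<^esub> n) (s \<otimes> t)),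
      one = mfrac \<zero>\<^bsub>M\<^esub> \<one>\<rparr>"

lemma S_carr [simp]: "s \<in> S \<Longrightarrow> s \<in> carrier D"
  using subset by auto

lemma smult_assoc: "a \<in> carrier D \<Longrightarrow> b \<in> carrier D \<Longrightarrow> m \<in> carrier M \<Longrightarrow> (a \<otimes> b) \<odot>\<^bsub>M\<^esub> m = a \<odot>\<^bsub>M\<^esub> (b \<odot>\<^bsub>M\<^esub> m)"
  using smult_assoc1 .

lemma smult_lcomm: "a \<in> carrier D \<Longrightarrow> b \<in> carrier D \<Longrightarrow> m \<in> carrier M \<Longrightarrow> a \<odot>\<^bsub>M\<^esub> (b \<odot>\<^bsub>M\<^esub> m) = b \<odot>\<^bsub>M\<^esub> (a \<odot>\<^bsub>M\<^esub> m)"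
  using smult_assoc m_comm by metis

lemmas smult_ac = smult_assoc smult_lcomm

lemma mfrac_memE:
  assumes "x \<in> mfrac m s"
  obtains n t u where "x = (n, t)" "n \<in> carrier M" "t \<in> S" "u \<in> S"
    "u \<odot>\<^bsub>M\<^esub> (t \<odot>\<^bsub>M\<^esub> m) = u \<odot>\<^bsub>M\<^esub> (s \<odot>\<^bsub>M\<^esub> n)"
  using assms unfolding mfrac_def by auto

lemma mfrac_self: "m \<in> carrier M \<Longrightarrow> s \<in> S \<Longrightarrow> (m, s) \<in> mfrac m s"
  unfolding mfrac_def using one_closed by auto

lemma mfrac_subset:
  assumes "m \<in> carrier M" "n \<in> carrier M" "s \<in> S" "t \<in> S" "u \<in> S"
    and eq: "u \<odot>\<^bsub>M\<^esub> (t \<odot>\<^bsub>M\<^esub> m) = u \<odot>\<^bsub>M\<^esub> (s \<odot>\<^bsub>M\<^esub> n)"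
  shows "mfrac n t \<subseteq> mfrac m s"
proof
  fix x assume "x \<in> mfrac n t"
  then obtain p r v where x: "x = (p, r)" "p \<in> carrier M" "r \<in> S" "v \<in> S"
    and eq': "v \<odot>\<^bsub>M\<^esub> (r \<odot>\<^bsub>M\<^esub> n) = v \<odot>\<^bsub>M\<^esub> (t \<odot>\<^bsub>M\<^esub> p)" by (rule mfrac_memE)
  have "(u \<otimes> v \<otimes> t) \<odot>\<^bsub>M\<^esub> (r \<odot>\<^bsub>M\<^esub> m) = v \<odot>\<^bsub>M\<^esub> (r \<odot>\<^bsub>M\<^esub> (u \<odot>\<^bsub>M\<^esub> (t \<odot>\<^bsub>M\<^esub> m)))"
    using assms(1-5) x by (simp add: smult_ac)
  also have "\<dots> = u \<odot>\<^bsub>M\<^esub> (s \<odot>\<^bsub>M\<^esub> (v \<odot>\<^bsub>M\<^esub> (r \<odot>\<^bsub>M\<^esub> n)))"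
    unfolding eq using assms(1-5) x by (simp add: smult_ac)
  also have "\<dots> = (u \<otimes> v \<otimes> t) \<odot>\<^bsub>M\<^esub> (s \<odot>\<^bsub>M\<^esub> p)"
    unfolding eq' using assms(1-5) x by (simp add: smult_ac)
  finally have "\<exists>w\<in>S. w \<odot>\<^bsub>M\<^esub> (r \<odot>\<^bsub>M\<^esub> m) = w \<odot>\<^bsub>M\<^esub> (s \<odot>\<^bsub>M\<^esub> p)"
    using assms(4,5) x(4) m_closed by (intro bexI[of _ "u \<otimes> v \<otimes> t"]) auto
  then show "x \<in> mfrac m s" unfolding mfrac_def using x(1-3) assms(1,3) by simp
qed

lemma mfrac_eqI:
  assumes "m \<in> carrier M" "n \<in> carrier M" "s \<in> S" "t \<in> S" "u \<in> S"
    and "u \<odot>\<^bsub>M\<^esub> (t \<odot>\<^bsub>M\<^esub> m) = u \<odot>\<^bsub>M\<^esub> (s \<odot>\<^bsub>M\<^esub> n)"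
  shows "mfrac m s = mfrac n t"
  using mfrac_subset[OF assms] mfrac_subset[OF assms(2,1,4,3,5) assms(6)[symmetric]] by blast

lemma mfrac_eq_iff:
  assumes "m \<in> carrier M" "n \<in> carrier M" "s \<in> S" "t \<in> S"
  shows "mfrac m s = mfrac n t \<longleftrightarrow> (\<exists>u\<in>S. u \<odot>\<^bsub>M\<^esub> (t \<odot>\<^bsub>M\<^esub> m) = u \<odot>\<^bsub>M\<^esub> (s \<odot>\<^bsub>M\<^esub> n))"
proof
  assume "mfrac m s = mfrac n t"
  then have "(n, t) \<in> mfrac m s" using mfrac_self[OF assms(2,4)] by simp
  then show "\<exists>u\<in>S. u \<odot>\<^bsub>M\<^esub> (t \<odot>\<^bsub>M\<^esub> m) = u \<odot>\<^bsub>M\<^esub> (s \<odot>\<^bsub>M\<^esub> n)" unfolding mfrac_def by simp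
next
  assume "\<exists>u\<in>S. u \<odot>\<^bsub>M\<^esub> (t \<odot>\<^bsub>M\<^esub> m) = u \<odot>\<^bsub>M\<^esub> (s \<odot>\<^bsub>M\<^esub> n)"
  then show "mfrac m s = mfrac n t" using mfrac_eqI[OF assms] by auto
qed

lemma mfrac_cancel:
  assumes "m \<in> carrier M" "s \<in> S" "u \<in> S"
  shows "mfrac (u \<odot>\<^bsub>M\<^esub> m) (u \<otimes> s) = mfrac m s"
  using assms by (intro mfrac_eqI[of _ _ _ _ \<one>]) (auto simp: smult_ac)

lemma mfrac_eq_zero_iff:
  assumes "m \<in> carrier M" "s \<in> S"
  shows "mfrac m s = mfrac \<zero>\<^bsub>M\<^esub> \<one> \<longleftrightarrow> (\<exists>u\<in>S. u \<odot>\<^bsub>M\<^esub> m = \<zero>\<^bsub>M\<^esub>)"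
  using assms mfrac_eq_iff[of m "\<zero>\<^bsub>M\<^esub>" s \<one>] by auto

lemma mfrac_add:
  assumes m: "m \<in> carrier M" "s \<in> S" and n: "n \<in> carrier M" "t \<in> S"
  shows "mfrac m s \<otimes>\<^bsub>frac_group\<^esub> mfrac n t = mfrac (t \<odot>\<^bsub>M\<^esub> m \<oplus>\<^bsub>M\<^esub> s \<odot>\<^bsub>M\<^esub> n) (s \<otimes> t)"
proof -
  have *: "mfrac (t' \<odot>\<^bsub>M\<^esub> m' \<oplus>\<^bsub>M\<^esub> s' \<odot>\<^bsub>M\<^esub> n') (s' \<otimes> t') = mfrac (t \<odot>\<^bsub>M\<^esub> m \<oplus>\<^bsub>M\<^esub> s \<odot>\<^bsub>M\<^esub> n) (s \<otimes> t)"
    if x: "(m', s') \<in> mfrac m s" and y: "(n', t') \<in> mfrac n t" for m' s' n' t'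
  proof -
    obtain u where m': "m' \<in> carrier M" "s' \<in> S" "u \<in> S"
      and u: "u \<odot>\<^bsub>M\<^esub> (s' \<odot>\<^bsub>M\<^esub> m) = u \<odot>\<^bsub>M\<^esub> (s \<odot>\<^bsub>M\<^esub> m')" using x by (auto elim: mfrac_memE)
    obtain v where n': "n' \<in> carrier M" "t' \<in> S" "v \<in> S"
      and v: "v \<odot>\<^bsub>M\<^esub> (t' \<odot>\<^bsub>M\<^esub> n) = v \<odot>\<^bsub>M\<^esub> (t \<odot>\<^bsub>M\<^esub> n')" using y by (auto elim: mfrac_memE)
    note c = m n m' n'
    have "(u \<otimes> v) \<odot>\<^bsub>M\<^esub> ((s \<otimes> t) \<odot>\<^bsub>M\<^esub> (t' \<odot>\<^bsub>M\<^esub> m' \<oplus>\<^bsub>M\<^esub> s' \<odot>\<^bsub>M\<^esub> n'))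
        = v \<odot>\<^bsub>M\<^esub> (t \<odot>\<^bsub>M\<^esub> (t' \<odot>\<^bsub>M\<^esub> (u \<odot>\<^bsub>M\<^esub> (s \<odot>\<^bsub>M\<^esub> m')))) \<oplus>\<^bsub>M\<^esub> u \<odot>\<^bsub>M\<^esub> (s \<odot>\<^bsub>M\<^esub> (s' \<odot>\<^bsub>M\<^esub> (v \<odot>\<^bsub>M\<^esub> (t \<odot>\<^bsub>M\<^esub> n'))))"
      using c by (simp add: smult_ac smult_r_distr)
    also have "\<dots> = (u \<otimes> v) \<odot>\<^bsub>M\<^esub> ((s' \<otimes> t') \<odot>\<^bsub>M\<^esub> (t \<odot>\<^bsub>M\<^esub> m \<oplus>\<^bsub>M\<^esub> s \<odot>\<^bsub>M\<^esub> n))"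
      unfolding u[symmetric] v[symmetric] using c by (simp add: smult_ac smult_r_distr)
    finally show ?thesis using c by (intro mfrac_eqI[of _ _ _ _ "u \<otimes> v"]) auto
  qed
  have "mfrac m s \<otimes>\<^bsub>frac_group\<^esub> mfrac n t
      = (\<Union>x\<in>mfrac m s. \<Union>y\<in>mfrac n t. mfrac (t \<odot>\<^bsub>M\<^esub> m \<oplus>\<^bsub>M\<^esub> s \<odot>\<^bsub>M\<^esub> n) (s \<otimes> t))"
    unfolding frac_group_def monoid.simps
    by (intro SUP_cong refl) (use * in auto)
  then show ?thesis using mfrac_self[OF m] mfrac_self[OF n] by auto
qed

lemma mfrac_closed: "m \<in> carrier M \<Longrightarrow> s \<in> S \<Longrightarrow> mfrac m s \<in> carrier frac_group"
  unfolding frac_group_def by auto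

lemma mfrac_carrE:
  assumes "X \<in> carrier frac_group"
  obtains m s where "m \<in> carrier M" "s \<in> S" "X = mfrac m s"
  using assms unfolding frac_group_def by auto

lemma frac_group_one: "\<one>\<^bsub>frac_group\<^esub> = mfrac \<zero>\<^bsub>M\<^esub> \<one>"
  unfolding frac_group_def by simp

lemma frac_group_comm_group: "comm_group frac_group"
proof (rule comm_groupI)
  fix X Y assume "X \<in> carrier frac_group" "Y \<in> carrier frac_group"
  then obtain m s n t where c: "m \<in> carrier M" "s \<in> S" "n \<in> carrier M" "t \<in> S"
    and XY: "X = mfrac m s" "Y = mfrac n t" by (metis mfrac_carrE)
  show "X \<otimes>\<^bsub>frac_group\<^esub> Y \<in> carrier frac_group"
    unfolding XY using c by (simp add: mfrac_add mfrac_closed)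
  show "X \<otimes>\<^bsub>frac_group\<^esub> Y = Y \<otimes>\<^bsub>frac_group\<^esub> X"
    unfolding XY using c by (simp add: mfrac_add M.a_comm m_comm)
  fix Z assume "Z \<in> carrier frac_group"
  then obtain p r where d: "p \<in> carrier M" "r \<in> S" and Z: "Z = mfrac p r" by (metis mfrac_carrE)
  show "X \<otimes>\<^bsub>frac_group\<^esub> Y \<otimes>\<^bsub>frac_group\<^esub> Z = X \<otimes>\<^bsub>frac_group\<^esub> (Y \<otimes>\<^bsub>frac_group\<^esub> Z)"
    unfolding XY Z using c d by (simp add: mfrac_add smult_r_distr smult_ac M.a_ac m_ac)
next
  show "\<one>\<^bsub>frac_group\<^esub> \<in> carrier frac_group" unfolding frac_group_one by (simp add: mfrac_closed)
  fix X assume "X \<in> carrier frac_group"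
  then obtain m s where c: "m \<in> carrier M" "s \<in> S" and X: "X = mfrac m s" by (metis mfrac_carrE)
  show "\<one>\<^bsub>frac_group\<^esub> \<otimes>\<^bsub>frac_group\<^esub> X = X"
    unfolding X frac_group_one using c by (simp add: mfrac_add)
  have "mfrac (\<ominus>\<^bsub>M\<^esub> m) s \<otimes>\<^bsub>frac_group\<^esub> X = mfrac (s \<odot>\<^bsub>M\<^esub> \<ominus>\<^bsub>M\<^esub> m \<oplus>\<^bsub>M\<^esub> s \<odot>\<^bsub>M\<^esub> m) (s \<otimes> s)"
    unfolding X using c by (simp add: mfrac_add)
  also have "s \<odot>\<^bsub>M\<^esub> \<ominus>\<^bsub>M\<^esub> m \<oplus>\<^bsub>M\<^esub> s \<odot>\<^bsub>M\<^esub> m = \<zero>\<^bsub>M\<^esub>"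
    using c by (simp add: smult_r_distr[symmetric] M.l_neg)
  also have "mfrac \<zero>\<^bsub>M\<^esub> (s \<otimes> s) = \<one>\<^bsub>frac_group\<^esub>"
    unfolding frac_group_one using c by (subst mfrac_eq_zero_iff) auto
  finally show "\<exists>Y\<in>carrier frac_group. Y \<otimes>\<^bsub>frac_group\<^esub> X = \<one>\<^bsub>frac_group\<^esub>"
    using c by (intro bexI[of _ "mfrac (\<ominus>\<^bsub>M\<^esub> m) s"]) (simp_all add: mfrac_closed)
qed

end

lemma ideal_module_module:
  assumes "cring R" "ideal I R"
  shows "Module.module R (ideal_module R I)"
proof -
  interpret cring R by fact
  interpret I: ideal I R by fact
  show ?thesis
  proof (rule moduleI)
    show "abelian_group (ideal_module R I)"
    proof (rule abelian_groupI)
      fix x assume "x \<in> carrier (ideal_module R I)"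
      then show "\<exists>y\<in>carrier (ideal_module R I). y \<oplus>\<^bsub>ideal_module R I\<^esub> x = \<zero>\<^bsub>ideal_module R I\<^esub>"
        by (intro bexI[of _ "\<ominus>\<^bsub>R\<^esub> x"]) (auto simp: ideal_module_def l_neg)
    qed (auto simp: ideal_module_def a_ac)
  qed (auto simp: ideal_module_def assms I.I_l_closed l_distr r_distr m_assoc)
qed

locale ring_localization = cring R + submonoid S R for R (structure) and S
begin

lemma self_module: "module_localization R (ideal_module R (carrier R)) S"
  unfolding module_localization_def
  using ideal_module_module[OF is_cring oneideal] submonoid_axioms by blast

sublocale self: module_localization R "ideal_module R (carrier R)" S
  by (rule self_module)

lemma self_simps [simp]:
  "carrier (ideal_module R (carrier R)) = carrier R"
  "a \<odot>\<^bsub>ideal_module R (carrier R)\<^esub> b = a \<otimes> b"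
  "a \<oplus>\<^bsub>ideal_module R (carrier R)\<^esub> b = a \<oplus> b"
  "\<zero>\<^bsub>ideal_module R (carrier R)\<^esub> = \<zero>"
  by (auto simp: ideal_module_def)

lemma loc_frac_eq_mfrac: "loc_frac R S a s = self.mfrac a s"
  unfolding loc_frac_def loc_rel_def self.mfrac_def by auto

lemma loc_frac_eq_iff:
  assumes "a \<in> carrier R" "b \<in> carrier R" "s \<in> S" "t \<in> S"
  shows "loc_frac R S a s = loc_frac R S b t \<longleftrightarrow> (\<exists>u\<in>S. u \<otimes> (t \<otimes> a) = u \<otimes> (s \<otimes> b))"
  using self.mfrac_eq_iff[of a b s t] assms by (simp add: loc_frac_eq_mfrac)

lemma localization_carrier: "carrier (localization R S) = {loc_frac R S a s | a s. a \<in> carrier R \<and> s \<in> S}"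
  unfolding localization_def quotient_def loc_frac_def by auto

lemma loc_frac_closed: "a \<in> carrier R \<Longrightarrow> s \<in> S \<Longrightarrow> loc_frac R S a s \<in> carrier (localization R S)"
  unfolding localization_carrier by auto

lemma localization_carrE:
  assumes "X \<in> carrier (localization R S)"
  obtains a s where "a \<in> carrier R" "s \<in> S" "X = loc_frac R S a s"
  using assms unfolding localization_carrier by auto

lemma loc_frac_memE:
  assumes "x \<in> loc_frac R S a s"
  obtains b t u where "x = (b, t)" "a \<in> carrier R" "s \<in> S" "b \<in> carrier R" "t \<in> S" "u \<in> S" "u \<otimes> (t \<otimes> a) = u \<otimes> (s \<otimes> b)"
  using assms unfolding loc_frac_def loc_rel_def by auto

lemma loc_frac_self: "a \<in> carrier R \<Longrightarrow> s \<in> S \<Longrightarrow> (a, s) \<in> loc_frac R S a s"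
  using self.mfrac_self loc_frac_eq_mfrac by simp

text \<open>This makes the additive axioms of the localized ring an instance of those for modules.\<close>
lemma localization_add_monoid: "add_monoid (localization R S) = self.frac_group"
proof -
  have "carrier (localization R S) = carrier self.frac_group"
    unfolding localization_carrier self.frac_group_def loc_frac_eq_mfrac by simp
  then show ?thesis
    unfolding self.frac_group_def localization_def loc_frac_eq_mfrac by simp
qed

lemma localization_zero: "\<zero>\<^bsub>localization R S\<^esub> = loc_frac R S \<zero> \<one>"
  and localization_one: "\<one>\<^bsub>localization R S\<^esub> = loc_frac R S \<one> \<one>"
  unfolding localization_def by simp_all

lemma loc_frac_add:
  assumes "a \<in> carrier R" "s \<in> S" "b \<in> carrier R" "t \<in> S"
  shows "loc_frac R S a s \<oplus>\<^bsub>localization R S\<^esub> loc_frac R S b t = loc_frac R S (t \<otimes> a \<oplus> s \<otimes> b) (s \<otimes> t)"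
proof -
  have "loc_frac R S a s \<oplus>\<^bsub>localization R S\<^esub> loc_frac R S b t
      = loc_frac R S a s \<otimes>\<^bsub>add_monoid (localization R S)\<^esub> loc_frac R S b t" by simp
  then show ?thesis
    unfolding localization_add_monoid loc_frac_eq_mfrac using self.mfrac_add assms by simp
qed

lemma loc_frac_mult:
  assumes a: "a \<in> carrier R" "s \<in> S" and b: "b \<in> carrier R" "t \<in> S"
  shows "loc_frac R S a s \<otimes>\<^bsub>localization R S\<^esub> loc_frac R S b t = loc_frac R S (a \<otimes> b) (s \<otimes> t)"
proof -
  have *: "loc_frac R S (a' \<otimes> b') (s' \<otimes> t') = loc_frac R S (a \<otimes> b) (s \<otimes> t)"
    if x: "(a', s') \<in> loc_frac R S a s" and y: "(b', t') \<in> loc_frac R S b t" for a' s' b' t'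
  proof -
    obtain u where a': "a' \<in> carrier R" "s' \<in> S" "u \<in> S"
      and u: "u \<otimes> (s' \<otimes> a) = u \<otimes> (s \<otimes> a')" using x by (auto elim: loc_frac_memE)
    obtain v where b': "b' \<in> carrier R" "t' \<in> S" "v \<in> S"
      and v: "v \<otimes> (t' \<otimes> b) = v \<otimes> (t \<otimes> b')" using y by (auto elim: loc_frac_memE)
    note c = a b a' b'
    have "(u \<otimes> v) \<otimes> ((s \<otimes> t) \<otimes> (a' \<otimes> b')) = (u \<otimes> (s \<otimes> a')) \<otimes> (v \<otimes> (t \<otimes> b'))"
      using c by (simp add: m_ac)
    also have "\<dots> = (u \<otimes> v) \<otimes> ((s' \<otimes> t') \<otimes> (a \<otimes> b))"
      unfolding u[symmetric] v[symmetric] using c by (simp add: m_ac)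
    finally show ?thesis using c by (subst loc_frac_eq_iff) (auto intro!: bexI[of _ "u \<otimes> v"])
  qed
  have "loc_frac R S a s \<otimes>\<^bsub>localization R S\<^esub> loc_frac R S b t
      = (\<Union>x\<in>loc_frac R S a s. \<Union>y\<in>loc_frac R S b t. loc_frac R S (a \<otimes> b) (s \<otimes> t))"
    unfolding localization_def ring.simps monoid.simps
    by (intro SUP_cong refl) (use * in auto)
  then show ?thesis using loc_frac_self[OF a] loc_frac_self[OF b] by auto
qed

lemma loc_frac_cancel:
  assumes "a \<in> carrier R" "s \<in> S" "u \<in> S"
  shows "loc_frac R S (u \<otimes> a) (u \<otimes> s) = loc_frac R S a s"
  using self.mfrac_cancel[of a s u] assms by (simp add: loc_frac_eq_mfrac)

lemma localization_cring: "cring (localization R S)"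
proof (rule cringI)
  show "abelian_group (localization R S)"
    using self.frac_group_comm_group unfolding localization_add_monoid[symmetric]
    by (auto intro!: abelian_group.intro abelian_monoid.intro abelian_group_axioms.intro
        dest: comm_group.axioms(1))
  show "comm_monoid (localization R S)"
  proof (rule comm_monoidI)
    fix X Y assume "X \<in> carrier (localization R S)" "Y \<in> carrier (localization R S)"
    then obtain a s b t where c: "a \<in> carrier R" "s \<in> S" "b \<in> carrier R" "t \<in> S"
      and XY: "X = loc_frac R S a s" "Y = loc_frac R S b t" by (metis localization_carrE)
    show "X \<otimes>\<^bsub>localization R S\<^esub> Y \<in> carrier (localization R S)"
      unfolding XY using c by (simp add: loc_frac_mult loc_frac_closed)
    show "X \<otimes>\<^bsub>localization R S\<^esub> Y = Y \<otimes>\<^bsub>localization R S\<^esub> X"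
      unfolding XY using c by (simp add: loc_frac_mult m_comm)
    fix Z assume "Z \<in> carrier (localization R S)"
    then obtain d r where d: "d \<in> carrier R" "r \<in> S" and Z: "Z = loc_frac R S d r" by (metis localization_carrE)
    show "X \<otimes>\<^bsub>localization R S\<^esub> Y \<otimes>\<^bsub>localization R S\<^esub> Z = X \<otimes>\<^bsub>localization R S\<^esub> (Y \<otimes>\<^bsub>localization R S\<^esub> Z)"
      unfolding XY Z using c d by (simp add: loc_frac_mult m_assoc)
  next
    show "\<one>\<^bsub>localization R S\<^esub> \<in> carrier (localization R S)"
      unfolding localization_one by (simp add: loc_frac_closed)
    fix X assume "X \<in> carrier (localization R S)"
    then obtain a s where c: "a \<in> carrier R" "s \<in> S" and X: "X = loc_frac R S a s" by (metis localization_carrE)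
    show "\<one>\<^bsub>localization R S\<^esub> \<otimes>\<^bsub>localization R S\<^esub> X = X"
      unfolding X localization_one using c by (simp add: loc_frac_mult)
  qed
  fix X Y Z assume "X \<in> carrier (localization R S)" "Y \<in> carrier (localization R S)" "Z \<in> carrier (localization R S)"
  then obtain a s b t d r where c: "a \<in> carrier R" "s \<in> S" "b \<in> carrier R" "t \<in> S" "d \<in> carrier R" "r \<in> S"
      and XYZ: "X = loc_frac R S a s" "Y = loc_frac R S b t" "Z = loc_frac R S d r" by (metis localization_carrE)
  have "loc_frac R S ((t \<otimes> a \<oplus> s \<otimes> b) \<otimes> d) (s \<otimes> t \<otimes> r)
      = loc_frac R S (r \<otimes> ((t \<otimes> a \<oplus> s \<otimes> b) \<otimes> d)) (r \<otimes> (s \<otimes> t \<otimes> r))"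
    using c by (simp add: loc_frac_cancel)
  also have "r \<otimes> ((t \<otimes> a \<oplus> s \<otimes> b) \<otimes> d) = t \<otimes> r \<otimes> (a \<otimes> d) \<oplus> s \<otimes> r \<otimes> (b \<otimes> d)"
    using c by (simp add: l_distr r_distr m_ac)
  also have "r \<otimes> (s \<otimes> t \<otimes> r) = s \<otimes> r \<otimes> (t \<otimes> r)" using c by (simp add: m_ac)
  finally show "(X \<oplus>\<^bsub>localization R S\<^esub> Y) \<otimes>\<^bsub>localization R S\<^esub> Z
      = X \<otimes>\<^bsub>localization R S\<^esub> Z \<oplus>\<^bsub>localization R S\<^esub> Y \<otimes>\<^bsub>localization R S\<^esub> Z"
    unfolding XYZ using c by (simp add: loc_frac_mult loc_frac_add)
qed

lemma loc_frac_zero_iff: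
  assumes "a \<in> carrier R" "s \<in> S"
  shows "loc_frac R S a s = \<zero>\<^bsub>localization R S\<^esub> \<longleftrightarrow> (\<exists>u\<in>S. u \<otimes> a = \<zero>)"
  using self.mfrac_eq_zero_iff[of a s] assms by (simp add: loc_frac_eq_mfrac localization_zero)

end

lemma (in domain) nonzero_submonoid: "ring_localization R (carrier R - {\<zero>})"
  unfolding ring_localization_def
  by (auto intro!: is_cring submonoid.intro simp: integral_iff)

lemma (in domain) fraction_field_field: "field (fraction_field R)"
proof -
  define S where "S = carrier R - {\<zero>}"
  interpret ring_localization R S unfolding S_def by (rule nonzero_submonoid)
  have S_I: "s \<in> S" if "s \<in> carrier R" "s \<noteq> \<zero>" for s using that unfolding S_def by auto
  have S_nz: "s \<noteq> \<zero>" if "s \<in> S" for s using that unfolding S_def by auto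
  have nz: "loc_frac R S a s = \<zero>\<^bsub>localization R S\<^esub> \<longleftrightarrow> a = \<zero>" if "a \<in> carrier R" "s \<in> S" for a s
    unfolding loc_frac_zero_iff[OF that] using S_nz integral[OF _ mem_carrier that(1)] one_closed that(1)
    by (metis l_one)
  show ?thesis unfolding fraction_field_def S_def[symmetric]
  proof (rule cring.cring_fieldI2[OF localization_cring])
    show "\<zero>\<^bsub>localization R S\<^esub> \<noteq> \<one>\<^bsub>localization R S\<^esub>"
      using nz[of \<one> \<one>] unfolding localization_one by (metis one_closed one_not_zero mem_carrier)
    fix X assume "X \<in> carrier (localization R S)" and "X \<noteq> \<zero>\<^bsub>localization R S\<^esub>"
    then obtain a s where c: "a \<in> carrier R" "s \<in> S" and X: "X = loc_frac R S a s" and "a \<noteq> \<zero>"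
      using nz by (metis localization_carrE)
    then have a: "a \<in> S" by (intro S_I)
    have "X \<otimes>\<^bsub>localization R S\<^esub> loc_frac R S s a = loc_frac R S (a \<otimes> s) (s \<otimes> a)"
      unfolding X using loc_frac_mult[OF c, of s a] a c by simp
    also have "\<dots> = loc_frac R S ((a \<otimes> s) \<otimes> \<one>) ((a \<otimes> s) \<otimes> \<one>)" using c m_comm[of a s] by simp
    also have "\<dots> = \<one>\<^bsub>localization R S\<^esub>"
      unfolding localization_one using a c by (intro loc_frac_cancel) auto
    finally show "\<exists>Y\<in>carrier (localization R S). X \<otimes>\<^bsub>localization R S\<^esub> Y = \<one>\<^bsub>localization R S\<^esub>"
      using loc_frac_closed[of s a] a c by auto
  qed
qed


section \<open>Base change to the fraction field and the rank\<close>

locale base_change_setting = Module.module D M + K: cring K for D (structure) and M and K and \<phi> +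
  assumes \<phi>_closed: "d \<in> carrier D \<Longrightarrow> \<phi> d \<in> carrier K"
begin

abbreviation F where "F \<equiv> free_Abelian_group (carrier M \<times> carrier K)"
abbreviation T where "T \<equiv> tensor_kernel D K \<phi> M"
abbreviation V where "V \<equiv> base_change D K \<phi> M"

text \<open>The endomorphism \<open>m \<otimes> l \<mapsto> m \<otimes> kl\<close> before passing to the quotient by the relations.\<close>
definition act where
  "act k = frag_extend (\<lambda>(m, l). frag_of (m, k \<otimes>\<^bsub>K\<^esub> l))"

lemma F_closed: "x \<in> carrier F \<Longrightarrow> y \<in> carrier F \<Longrightarrow> x + y \<in> carrier F"
    "x \<in> carrier F \<Longrightarrow> y \<in> carrier F \<Longrightarrow> x - y \<in> carrier F"
    "0 \<in> carrier F" "(m, l) \<in> carrier M \<times> carrier K \<Longrightarrow> frag_of (m, l) \<in> carrier F"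
  using keys_add[of x y] keys_diff[of x y] by auto

lemma F_induct [consumes 1, case_names zero diff of]:
  assumes "x \<in> carrier F" "P 0"
    "\<And>x y. x \<in> carrier F \<Longrightarrow> y \<in> carrier F \<Longrightarrow> P x \<Longrightarrow> P y \<Longrightarrow> P (x - y)"
    "\<And>m l. m \<in> carrier M \<Longrightarrow> l \<in> carrier K \<Longrightarrow> P (frag_of (m, l))"
  shows "P x"
  using assms(1) unfolding carrier_free_Abelian_group_iff
  by (rule free_Abelian_group_induct) (use assms in auto)

lemma relations_subset: "tensor_relations D K \<phi> M \<subseteq> carrier F"
  unfolding tensor_relations_def by (auto intro!: F_closed simp: \<phi>_closed simp del: carrier_free_Abelian_group_iff)

lemma T_subgroup: "subgroup T F"
  unfolding tensor_kernel_def using group.generate_is_subgroup[OF group_free_Abelian_group relations_subset] .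

lemma T_normal: "T \<lhd> F"
  using comm_group.subgroup_imp_normal[OF abelian_free_Abelian_group T_subgroup] .

lemma T_closed:
  "x \<in> T \<Longrightarrow> y \<in> T \<Longrightarrow> x + y \<in> T" "x \<in> T \<Longrightarrow> - x \<in> T" "0 \<in> T" "x \<in> T \<Longrightarrow> x \<in> carrier F"
  "x \<in> T \<Longrightarrow> y \<in> T \<Longrightarrow> x - y \<in> T"
proof -
  show c: "x \<in> T \<Longrightarrow> x \<in> carrier F" for x using subgroup.mem_carrier[OF T_subgroup] .
  show add: "x \<in> T \<Longrightarrow> y \<in> T \<Longrightarrow> x + y \<in> T" for x y using subgroup.m_closed[OF T_subgroup] by auto
  show "0 \<in> T" using subgroup.one_closed[OF T_subgroup] by auto
  show neg: "x \<in> T \<Longrightarrow> - x \<in> T" for x using subgroup.m_inv_closed[OF T_subgroup, of x] c[of x] by auto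
  show "x \<in> T \<Longrightarrow> y \<in> T \<Longrightarrow> x - y \<in> T" using add[of x "- y"] neg[of y] by simp
qed

lemma T_relations:
  "\<lbrakk>m \<in> carrier M; m' \<in> carrier M; l \<in> carrier K\<rbrakk> \<Longrightarrow> frag_of (m \<oplus>\<^bsub>M\<^esub> m', l) - frag_of (m, l) - frag_of (m', l) \<in> T"
  "\<lbrakk>m \<in> carrier M; l \<in> carrier K; l' \<in> carrier K\<rbrakk> \<Longrightarrow> frag_of (m, l \<oplus>\<^bsub>K\<^esub> l') - frag_of (m, l) - frag_of (m, l') \<in> T"
  "\<lbrakk>d \<in> carrier D; m \<in> carrier M; l \<in> carrier K\<rbrakk> \<Longrightarrow> frag_of (d \<odot>\<^bsub>M\<^esub> m, l) - frag_of (m, \<phi> d \<otimes>\<^bsub>K\<^esub> l) \<in> T"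
  unfolding tensor_kernel_def tensor_relations_def by (rule generate.incl, blast)+

text \<open>The universal property of the tensor product in the form used below: a subgroup that contains the
  relations, such as the kernel of a homomorphism, contains the subgroup they generate.\<close>
lemma T_least:
  assumes H: "subgroup H F"
    and "\<And>m m' l. \<lbrakk>m \<in> carrier M; m' \<in> carrier M; l \<in> carrier K\<rbrakk> \<Longrightarrow> frag_of (m \<oplus>\<^bsub>M\<^esub> m', l) - frag_of (m, l) - frag_of (m', l) \<in> H"
    and "\<And>m l l'. \<lbrakk>m \<in> carrier M; l \<in> carrier K; l' \<in> carrier K\<rbrakk> \<Longrightarrow> frag_of (m, l \<oplus>\<^bsub>K\<^esub> l') - frag_of (m, l) - frag_of (m, l') \<in> H"
    and "\<And>d m l. \<lbrakk>d \<in> carrier D; m \<in> carrier M; l \<in> carrier K\<rbrakk> \<Longrightarrow> frag_of (d \<odot>\<^bsub>M\<^esub> m, l) - frag_of (m, \<phi> d \<otimes>\<^bsub>K\<^esub> l) \<in> H"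
  shows "T \<subseteq> H"
  unfolding tensor_kernel_def
  by (rule group.generate_subgroup_incl[OF group_free_Abelian_group _ H])
    (use assms(2-4) in \<open>auto simp: tensor_relations_def\<close>)

lemma act_simps:
  "act k 0 = 0" "act k (frag_of (m, l)) = frag_of (m, k \<otimes>\<^bsub>K\<^esub> l)"
  "act k (x - y) = act k x - act k y" "act k (x + y) = act k x + act k y" "act k (- x) = - act k x"
  unfolding act_def by (simp_all add: frag_extend_diff frag_extend_add frag_extend_minus)

lemma act_closed: "x \<in> carrier F \<Longrightarrow> k \<in> carrier K \<Longrightarrow> act k x \<in> carrier F"
  by (induction rule: F_induct) (auto simp: act_simps simp del: carrier_free_Abelian_group_iff intro!: F_closed)

lemma act_T:
  assumes k: "k \<in> carrier K" and "x \<in> T"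
  shows "act k x \<in> T"
proof -
  define H where "H = {x \<in> carrier F. act k x \<in> T}"
  have "T \<subseteq> H"
  proof (rule T_least)
    show "subgroup H F"
    proof (rule group.subgroupI[OF group_free_Abelian_group])
      show "H \<subseteq> carrier F" unfolding H_def by blast
      have "act k 0 \<in> T" unfolding act_simps(1) by (rule T_closed(3))
      then have "0 \<in> H" unfolding H_def using F_closed(3) by blast
      then show "H \<noteq> {}" by blast
      show "inv\<^bsub>F\<^esub> x \<in> H" if "x \<in> H" for x
        using that T_closed(2) unfolding H_def by (auto simp: act_simps keys_minus)
      show "x \<otimes>\<^bsub>F\<^esub> y \<in> H" if "x \<in> H" "y \<in> H" for x y
        using that T_closed(1) F_closed(1) unfolding H_def by (simp add: act_simps del: carrier_free_Abelian_group_iff)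
    qed
  next
    fix m m' l assume *: "m \<in> carrier M" "m' \<in> carrier M" "l \<in> carrier K"
    have "frag_of (m \<oplus>\<^bsub>M\<^esub> m', l) - frag_of (m, l) - frag_of (m', l) \<in> carrier F"
      using T_relations(1)[OF *] T_closed(4) by blast
    then show "frag_of (m \<oplus>\<^bsub>M\<^esub> m', l) - frag_of (m, l) - frag_of (m', l) \<in> H"
      unfolding H_def using T_relations(1)[of m m' "k \<otimes>\<^bsub>K\<^esub> l"] * k by (simp add: act_simps)
  next
    fix m l l' assume *: "m \<in> carrier M" "l \<in> carrier K" "l' \<in> carrier K"
    have "frag_of (m, l \<oplus>\<^bsub>K\<^esub> l') - frag_of (m, l) - frag_of (m, l') \<in> carrier F"
      using T_relations(2)[OF *] T_closed(4) by blast
    then show "frag_of (m, l \<oplus>\<^bsub>K\<^esub> l') - frag_of (m, l) - frag_of (m, l') \<in> H"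
      unfolding H_def using T_relations(2)[of m "k \<otimes>\<^bsub>K\<^esub> l" "k \<otimes>\<^bsub>K\<^esub> l'"] * k by (simp add: act_simps K.r_distr)
  next
    fix d m l assume *: "d \<in> carrier D" "m \<in> carrier M" "l \<in> carrier K"
    have "frag_of (d \<odot>\<^bsub>M\<^esub> m, l) - frag_of (m, \<phi> d \<otimes>\<^bsub>K\<^esub> l) \<in> carrier F"
      using T_relations(3)[OF *] T_closed(4) by blast
    then show "frag_of (d \<odot>\<^bsub>M\<^esub> m, l) - frag_of (m, \<phi> d \<otimes>\<^bsub>K\<^esub> l) \<in> H"
      unfolding H_def using T_relations(3)[of d m "k \<otimes>\<^bsub>K\<^esub> l"] * k \<phi>_closed[OF *(1)]
      by (simp add: act_simps K.m_lcomm)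
  qed
  then show ?thesis using assms(2) unfolding H_def by blast
qed

lemma coset_mem: "y \<in> T #>\<^bsub>F\<^esub> x \<longleftrightarrow> y - x \<in> T"
  unfolding r_coset_def by (auto simp: algebra_simps intro!: bexI[of _ "y - x"])

lemma coset_eq_iff: "T #>\<^bsub>F\<^esub> x = T #>\<^bsub>F\<^esub> y \<longleftrightarrow> x - y \<in> T"
proof
  assume "T #>\<^bsub>F\<^esub> x = T #>\<^bsub>F\<^esub> y"
  then show "x - y \<in> T" using coset_mem[of x x] coset_mem[of x y] T_closed(3) by simp
next
  assume xy: "x - y \<in> T"
  have *: "z - x \<in> T \<longleftrightarrow> z - y \<in> T" for z
  proof -
    have "z - x + (x - y) = z - y" "z - y - (x - y) = z - x" by simp_all
    then show ?thesis using T_closed(1)[OF _ xy, of "z - x"] T_closed(5)[OF _ xy, of "z - y"] by metis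
  qed
  show "T #>\<^bsub>F\<^esub> x = T #>\<^bsub>F\<^esub> y" by (rule Set.set_eqI) (simp only: coset_mem *)
qed

lemma V_carrier: "carrier V = {T #>\<^bsub>F\<^esub> x | x. x \<in> carrier F}"
  unfolding base_change_def Let_def FactGroup_def RCOSETS_def by auto

lemma V_carrE:
  assumes "X \<in> carrier V" obtains x where "x \<in> carrier F" "X = T #>\<^bsub>F\<^esub> x"
  using assms unfolding V_carrier by blast

lemma V_closed: "x \<in> carrier F \<Longrightarrow> T #>\<^bsub>F\<^esub> x \<in> carrier V"
  unfolding V_carrier by blast

lemma V_zero: "\<zero>\<^bsub>V\<^esub> = T"
  unfolding base_change_def Let_def FactGroup_def by simp

lemma V_zero_coset: "\<zero>\<^bsub>V\<^esub> = T #>\<^bsub>F\<^esub> 0"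
  unfolding V_zero by (rule Set.set_eqI) (simp add: coset_mem)

lemma V_add:
  assumes "x \<in> carrier F" "y \<in> carrier F"
  shows "(T #>\<^bsub>F\<^esub> x) \<oplus>\<^bsub>V\<^esub> (T #>\<^bsub>F\<^esub> y) = T #>\<^bsub>F\<^esub> (x + y)"
  using normal.rcos_sum[OF T_normal assms] unfolding base_change_def Let_def FactGroup_def by simp

lemma V_smult:
  assumes k: "k \<in> carrier K" and x: "x \<in> carrier F"
  shows "k \<odot>\<^bsub>V\<^esub> (T #>\<^bsub>F\<^esub> x) = T #>\<^bsub>F\<^esub> act k x"
proof -
  have "T #>\<^bsub>F\<^esub> act k y = T #>\<^bsub>F\<^esub> act k x" if "y \<in> T #>\<^bsub>F\<^esub> x" for y
    using act_T[OF k, of "y - x"] that unfolding coset_mem coset_eq_iff act_simps(3) by simp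
  then have "k \<odot>\<^bsub>V\<^esub> (T #>\<^bsub>F\<^esub> x) = (\<Union>y\<in>T #>\<^bsub>F\<^esub> x. T #>\<^bsub>F\<^esub> act k x)"
    unfolding base_change_def Let_def act_def[symmetric] by simp
  moreover have "x \<in> T #>\<^bsub>F\<^esub> x" using coset_mem T_closed(3) by simp
  ultimately show ?thesis by auto
qed

text \<open>Only this module axiom fails on the free group itself and needs the relations.\<close>
lemma act_distrib:
  assumes "x \<in> carrier F" and kl: "k \<in> carrier K" "l \<in> carrier K"
  shows "act (k \<oplus>\<^bsub>K\<^esub> l) x - (act k x + act l x) \<in> T"
  using assms(1)
proof (induction rule: F_induct)
  case zero
  then show ?case using T_closed(3) by (simp add: act_simps)
next
  case (diff x y)
  have "act (k \<oplus>\<^bsub>K\<^esub> l) (x - y) - (act k (x - y) + act l (x - y))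
      = (act (k \<oplus>\<^bsub>K\<^esub> l) x - (act k x + act l x)) - (act (k \<oplus>\<^bsub>K\<^esub> l) y - (act k y + act l y))"
    by (simp add: act_simps algebra_simps)
  then show ?case using T_closed(5)[OF diff(3,4)] by simp
next
  case (of m q)
  have "frag_of (m, k \<otimes>\<^bsub>K\<^esub> q \<oplus>\<^bsub>K\<^esub> l \<otimes>\<^bsub>K\<^esub> q) - frag_of (m, k \<otimes>\<^bsub>K\<^esub> q) - frag_of (m, l \<otimes>\<^bsub>K\<^esub> q) \<in> T"
    using of kl by (intro T_relations) auto
  then show ?case using of kl by (simp add: act_simps K.l_distr algebra_simps)
qed

lemma act_act:
  assumes "x \<in> carrier F" "k \<in> carrier K" "l \<in> carrier K"
  shows "act (k \<otimes>\<^bsub>K\<^esub> l) x = act k (act l x)"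
  using assms(1) by (induction rule: F_induct) (use assms(2,3) in \<open>simp_all add: act_simps K.m_assoc\<close>)

lemma act_one: "x \<in> carrier F \<Longrightarrow> act \<one>\<^bsub>K\<^esub> x = x"
  by (induction rule: F_induct) (simp_all add: act_simps)

lemma base_change_module: "Module.module K V"
proof (rule moduleI)
  show "cring K" by (rule K.is_cring)
  show "abelian_group V"
  proof (rule abelian_groupI)
    fix X Y assume "X \<in> carrier V" "Y \<in> carrier V"
    then obtain x y where x: "x \<in> carrier F" "X = T #>\<^bsub>F\<^esub> x" and y: "y \<in> carrier F" "Y = T #>\<^bsub>F\<^esub> y"
      by (metis V_carrE)
    show "X \<oplus>\<^bsub>V\<^esub> Y \<in> carrier V"
      unfolding x(2) y(2) V_add[OF x(1) y(1)] by (rule V_closed[OF F_closed(1)[OF x(1) y(1)]])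
    show "X \<oplus>\<^bsub>V\<^esub> Y = Y \<oplus>\<^bsub>V\<^esub> X"
      unfolding x(2) y(2) V_add[OF x(1) y(1)] V_add[OF y(1) x(1)] by (simp only: add.commute)
    fix Z assume "Z \<in> carrier V"
    then obtain z where z: "z \<in> carrier F" "Z = T #>\<^bsub>F\<^esub> z" by (metis V_carrE)
    show "X \<oplus>\<^bsub>V\<^esub> Y \<oplus>\<^bsub>V\<^esub> Z = X \<oplus>\<^bsub>V\<^esub> (Y \<oplus>\<^bsub>V\<^esub> Z)"
      unfolding x(2) y(2) z(2) V_add[OF x(1) y(1)] V_add[OF y(1) z(1)]
        V_add[OF F_closed(1)[OF x(1) y(1)] z(1)] V_add[OF x(1) F_closed(1)[OF y(1) z(1)]]
      by (simp only: add.assoc)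
  next
    show "\<zero>\<^bsub>V\<^esub> \<in> carrier V" using V_closed[OF F_closed(3)] V_zero_coset by simp
    fix X assume "X \<in> carrier V"
    then obtain x where x: "x \<in> carrier F" "X = T #>\<^bsub>F\<^esub> x" by (metis V_carrE)
    show "\<zero>\<^bsub>V\<^esub> \<oplus>\<^bsub>V\<^esub> X = X"
      unfolding x(2) V_zero_coset V_add[OF F_closed(3) x(1)] by (simp only: add_0)
    have nx: "0 - x \<in> carrier F" using F_closed(2)[OF F_closed(3) x(1)] .
    have "(T #>\<^bsub>F\<^esub> (0 - x)) \<oplus>\<^bsub>V\<^esub> X = \<zero>\<^bsub>V\<^esub>"
      unfolding x(2) V_zero_coset V_add[OF nx x(1)] by simp
    then show "\<exists>Y\<in>carrier V. Y \<oplus>\<^bsub>V\<^esub> X = \<zero>\<^bsub>V\<^esub>" using V_closed[OF nx] by blast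
  qed
next
  fix k X assume k: "k \<in> carrier K" and "X \<in> carrier V"
  then obtain x where x: "x \<in> carrier F" "X = T #>\<^bsub>F\<^esub> x" by (metis V_carrE)
  show "k \<odot>\<^bsub>V\<^esub> X \<in> carrier V" unfolding x(2) V_smult[OF k x(1)] using V_closed[OF act_closed[OF x(1) k]] .
  fix l assume l: "l \<in> carrier K"
  show "(k \<oplus>\<^bsub>K\<^esub> l) \<odot>\<^bsub>V\<^esub> X = k \<odot>\<^bsub>V\<^esub> X \<oplus>\<^bsub>V\<^esub> l \<odot>\<^bsub>V\<^esub> X"
    unfolding x(2) V_smult[OF k x(1)] V_smult[OF l x(1)] V_smult[OF K.a_closed[OF k l] x(1)]
      V_add[OF act_closed[OF x(1) k] act_closed[OF x(1) l]]
    using act_distrib[OF x(1) k l] coset_eq_iff by blast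
  show "(k \<otimes>\<^bsub>K\<^esub> l) \<odot>\<^bsub>V\<^esub> X = k \<odot>\<^bsub>V\<^esub> (l \<odot>\<^bsub>V\<^esub> X)"
    unfolding x(2) V_smult[OF l x(1)] V_smult[OF K.m_closed[OF k l] x(1)] V_smult[OF k act_closed[OF x(1) l]]
      act_act[OF x(1) k l] ..
next
  fix k X Y assume k: "k \<in> carrier K" and "X \<in> carrier V" "Y \<in> carrier V"
  then obtain x y where x: "x \<in> carrier F" "X = T #>\<^bsub>F\<^esub> x" and y: "y \<in> carrier F" "Y = T #>\<^bsub>F\<^esub> y"
    by (metis V_carrE)
  show "k \<odot>\<^bsub>V\<^esub> (X \<oplus>\<^bsub>V\<^esub> Y) = k \<odot>\<^bsub>V\<^esub> X \<oplus>\<^bsub>V\<^esub> k \<odot>\<^bsub>V\<^esub> Y"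
    unfolding x(2) y(2) V_add[OF x(1) y(1)] V_smult[OF k x(1)] V_smult[OF k y(1)]
      V_smult[OF k F_closed(1)[OF x(1) y(1)]] V_add[OF act_closed[OF x(1) k] act_closed[OF y(1) k]] act_simps(4) ..
next
  fix X assume "X \<in> carrier V"
  then obtain x where x: "x \<in> carrier F" "X = T #>\<^bsub>F\<^esub> x" by (metis V_carrE)
  show "\<one>\<^bsub>K\<^esub> \<odot>\<^bsub>V\<^esub> X = X" unfolding x(2) V_smult[OF K.one_closed x(1)] act_one[OF x(1)] ..
qed

lemma base_change_trivial_iff: "carrier V = {\<zero>\<^bsub>V\<^esub>} \<longleftrightarrow> T = carrier F"
proof
  assume V: "carrier V = {\<zero>\<^bsub>V\<^esub>}"
  have "x \<in> T" if "x \<in> carrier F" for x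
  proof -
    have "T #>\<^bsub>F\<^esub> x = T" using V_closed[OF that] V V_zero by blast
    then show ?thesis using coset_mem[of x x] T_closed(3) by simp
  qed
  then show "T = carrier F" using T_closed(4) by blast
next
  assume T: "T = carrier F"
  have T0: "T #>\<^bsub>F\<^esub> 0 = T" using V_zero V_zero_coset by simp
  have "T #>\<^bsub>F\<^esub> x = T" if "x \<in> carrier F" for x
  proof -
    have "x - 0 \<in> T" using that T by simp
    then show ?thesis using coset_eq_iff[of x 0] T0 by simp
  qed
  then show "carrier V = {\<zero>\<^bsub>V\<^esub>}" unfolding V_carrier V_zero using F_closed(3) by blast
qed

end

text \<open>The dimension is the least size of a generating set, so it is zero iff the empty set generates.\<close>
lemma (in vectorspace) vs_dim_eq_zero_iff: "vs_dim K V = 0 \<longleftrightarrow> carrier V = {\<zero>\<^bsub>V\<^esub>}"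
proof -
  have span_empty: "span {} = {\<zero>\<^bsub>V\<^esub>}"
    unfolding span_def lincomb_def by auto
  have "vs_dim K V = 0 \<longleftrightarrow> fin_dim \<and> dim = 0"
    unfolding vs_dim_def by (auto simp: zero_enat_def)
  also have "\<dots> \<longleftrightarrow> span {} = carrier V"
  proof
    assume "fin_dim \<and> dim = 0"
    then have "\<exists>n A. finite A \<and> card A = n \<and> A \<subseteq> carrier V \<and> span A = carrier V" and d: "dim = 0"
      unfolding fin_dim_def by auto
    from LeastI_ex[OF this(1)] obtain A where "finite A" "card A = dim" "span A = carrier V"
      unfolding dim_def by auto
    then show "span {} = carrier V" using d by simp
  next
    assume "span {} = carrier V"
    then have *: "\<exists>A. finite A \<and> card A = 0 \<and> A \<subseteq> carrier V \<and> span A = carrier V" by (intro exI[of _ "{}"]) auto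
    then have "dim \<le> 0" unfolding dim_def by (intro Least_le)
    then show "fin_dim \<and> dim = 0" using * unfolding fin_dim_def by auto
  qed
  finally show ?thesis unfolding span_empty by auto
qed

text \<open>If \<open>M \<otimes> K = 0\<close>, the homomorphism \<open>m \<otimes> a/s \<mapsto> am/s\<close> to the localization of \<open>M\<close> sends \<open>m \<otimes> 1\<close> to \<open>m/1 = 0\<close>, and
  \<open>m\<close> is torsion. If \<open>dm = 0\<close> with \<open>d \<noteq> 0\<close>, then \<open>m \<otimes> l = m \<otimes> d(l/d) = dm \<otimes> l/d = 0\<close>.\<close>
lemma rank_zero_iff_torsion:
  assumes "domain D" and M: "Module.module D M"
  shows "module_rank D M = 0 \<longleftrightarrow> torsion_module D M"
proof -
  interpret D: domain D by fact
  define S where "S = carrier D - {\<zero>\<^bsub>D\<^esub>}"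
  define K where "K = localization D S"
  have K_eq: "K = fraction_field D" unfolding K_def S_def fraction_field_def ..
  interpret L: ring_localization D S unfolding S_def by (rule D.nonzero_submonoid)
  interpret LM: module_localization D M S
    unfolding module_localization_def using M L.submonoid_axioms by blast
  interpret K: field K unfolding K_eq by (rule D.fraction_field_field)
  define \<phi> where "\<phi> = fraction_map D"
  have \<phi>: "\<phi> d = loc_frac D S d \<one>\<^bsub>D\<^esub>" for d unfolding \<phi>_def fraction_map_def loc_map_def S_def ..
  have Kc: "carrier K = {loc_frac D S a s | a s. a \<in> carrier D \<and> s \<in> S}"
    unfolding K_def by (rule L.localization_carrier)
  have K_carrE: "\<exists>a s. a \<in> carrier D \<and> s \<in> S \<and> l = loc_frac D S a s" if "l \<in> carrier K" for l
    using that unfolding Kc by blast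
  interpret B: base_change_setting D M K \<phi>
  proof (intro base_change_setting.intro base_change_setting_axioms.intro M K.is_cring)
    show "\<phi> d \<in> carrier K" if "d \<in> carrier D" for d
      unfolding \<phi> Kc using that L.one_closed by blast
  qed
  interpret V: vectorspace K B.V
    unfolding vectorspace_def using B.base_change_module K.field_axioms by blast
  have S_iff: "(\<exists>u\<in>S. P u) \<longleftrightarrow> (\<exists>u\<in>carrier D - {\<zero>\<^bsub>D\<^esub>}. P u)" for P unfolding S_def ..
  have "module_rank D M = vs_dim K B.V" unfolding module_rank_def Let_def K_eq[symmetric] \<phi>_def ..
  then have "module_rank D M = 0 \<longleftrightarrow> B.T = carrier B.F"
    using V.vs_dim_eq_zero_iff B.base_change_trivial_iff by simp
  also have "\<dots> \<longleftrightarrow> torsion_module D M"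
  proof
    assume T: "B.T = carrier B.F"
    define \<beta> where "\<beta> m X = (\<Union>x\<in>X. LM.mfrac (fst x \<odot>\<^bsub>M\<^esub> m) (snd x))" for m X
    have \<beta>: "\<beta> m (loc_frac D S a s) = LM.mfrac (a \<odot>\<^bsub>M\<^esub> m) s"
      if c: "m \<in> carrier M" "a \<in> carrier D" "s \<in> S" for m a s
    proof -
      have "LM.mfrac (b \<odot>\<^bsub>M\<^esub> m) t = LM.mfrac (a \<odot>\<^bsub>M\<^esub> m) s" if "(b, t) \<in> loc_frac D S a s" for b t
      proof -
        obtain u where u: "b \<in> carrier D" "t \<in> S" "u \<in> S" "u \<otimes>\<^bsub>D\<^esub> (t \<otimes>\<^bsub>D\<^esub> a) = u \<otimes>\<^bsub>D\<^esub> (s \<otimes>\<^bsub>D\<^esub> b)"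
          using L.loc_frac_memE[OF \<open>(b, t) \<in> loc_frac D S a s\<close>] by (metis prod.inject)
        have "u \<odot>\<^bsub>M\<^esub> (t \<odot>\<^bsub>M\<^esub> (a \<odot>\<^bsub>M\<^esub> m)) = (u \<otimes>\<^bsub>D\<^esub> (t \<otimes>\<^bsub>D\<^esub> a)) \<odot>\<^bsub>M\<^esub> m"
          using c u(1-3) by (simp add: LM.smult_assoc)
        also have "\<dots> = u \<odot>\<^bsub>M\<^esub> (s \<odot>\<^bsub>M\<^esub> (b \<odot>\<^bsub>M\<^esub> m))"
          unfolding u(4) using c u(1-3) by (simp add: LM.smult_assoc)
        finally show ?thesis using c u(1-3) by (intro LM.mfrac_eqI[symmetric, of _ _ _ _ u]) auto
      qed
      then have "\<beta> m (loc_frac D S a s) = (\<Union>x\<in>loc_frac D S a s. LM.mfrac (a \<odot>\<^bsub>M\<^esub> m) s)"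
        unfolding \<beta>_def by (intro SUP_cong refl) auto
      then show ?thesis using L.loc_frac_self[OF c(2,3)] by auto
    qed
    interpret G: comm_group LM.frac_group by (rule LM.frac_group_comm_group)
    have \<beta>_closed: "\<beta> m l \<in> carrier LM.frac_group" if "m \<in> carrier M" "l \<in> carrier K" for m l
      using that \<beta> unfolding Kc by (auto intro!: LM.mfrac_closed)
    then have "(\<lambda>(m, l). \<beta> m l) ` (carrier M \<times> carrier K) \<subseteq> carrier LM.frac_group" by auto
    then obtain h where h: "h \<in> hom B.F LM.frac_group"
        and h_of': "\<And>x. x \<in> carrier M \<times> carrier K \<Longrightarrow> h (frag_of x) = (\<lambda>(m, l). \<beta> m l) x"
      using G.free_Abelian_group_universal by metis
    have h_of: "h (frag_of (m, l)) = \<beta> m l" if "m \<in> carrier M" "l \<in> carrier K" for m l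
      using h_of'[of "(m, l)"] that by simp
    interpret h: group_hom B.F LM.frac_group h
      by (intro group_hom.intro group_hom_axioms.intro group_free_Abelian_group G.is_group h)
    have h_diff: "h (x - y) = \<one>\<^bsub>LM.frac_group\<^esub>" if "x \<in> carrier B.F" "y \<in> carrier B.F" "h x = h y" for x y
    proof -
      have xy: "x - y \<in> carrier B.F" using B.F_closed(2)[OF that(1,2)] .
      have "h (x - y) \<otimes>\<^bsub>LM.frac_group\<^esub> h y = h x" using h.hom_mult[OF xy that(2)] by simp
      also have "\<dots> = \<one>\<^bsub>LM.frac_group\<^esub> \<otimes>\<^bsub>LM.frac_group\<^esub> h y"
        using that(3) G.l_one[OF h.hom_closed[OF that(2)]] by simp
      finally show ?thesis
        using G.right_cancel[OF h.hom_closed[OF that(2)] h.hom_closed[OF xy] G.one_closed] by blast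
    qed
    have h_diff2: "h (x - y - z) = \<one>\<^bsub>LM.frac_group\<^esub>"
      if "x \<in> carrier B.F" "y \<in> carrier B.F" "z \<in> carrier B.F" "h x = h y \<otimes>\<^bsub>LM.frac_group\<^esub> h z" for x y z
    proof -
      have "h (y + z) = h y \<otimes>\<^bsub>LM.frac_group\<^esub> h z" using h.hom_mult[OF that(2,3)] by simp
      then show ?thesis using h_diff[of x "y + z"] that B.F_closed(1)[OF that(2,3)] by (simp add: algebra_simps)
    qed
    have "B.T \<subseteq> kernel B.F LM.frac_group h"
    proof (rule B.T_least[OF h.subgroup_kernel])
      fix m m' l assume c: "m \<in> carrier M" "m' \<in> carrier M" "l \<in> carrier K"
      obtain a s where as: "a \<in> carrier D" "s \<in> S" "l = loc_frac D S a s" using K_carrE[OF c(3)] by auto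
      have "\<beta> (m \<oplus>\<^bsub>M\<^esub> m') l = LM.mfrac (s \<odot>\<^bsub>M\<^esub> (a \<odot>\<^bsub>M\<^esub> (m \<oplus>\<^bsub>M\<^esub> m'))) (s \<otimes>\<^bsub>D\<^esub> s)"
        using c as \<beta> by (simp add: LM.mfrac_cancel)
      also have "\<dots> = \<beta> m l \<otimes>\<^bsub>LM.frac_group\<^esub> \<beta> m' l"
        using c as \<beta> by (simp add: LM.mfrac_add LM.smult_r_distr)
      finally have "h (frag_of (m \<oplus>\<^bsub>M\<^esub> m', l) - frag_of (m, l) - frag_of (m', l)) = \<one>\<^bsub>LM.frac_group\<^esub>"
        using c by (intro h_diff2) (auto simp: h_of)
      then show "frag_of (m \<oplus>\<^bsub>M\<^esub> m', l) - frag_of (m, l) - frag_of (m', l) \<in> kernel B.F LM.frac_group h"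
        unfolding kernel_def using B.T_closed(4)[OF B.T_relations(1)[OF c]] by blast
    next
      fix m l l' assume c: "m \<in> carrier M" "l \<in> carrier K" "l' \<in> carrier K"
      obtain a s b t where as: "a \<in> carrier D" "s \<in> S" "l = loc_frac D S a s"
        "b \<in> carrier D" "t \<in> S" "l' = loc_frac D S b t" using K_carrE[OF c(2)] K_carrE[OF c(3)] by auto
      have "l \<oplus>\<^bsub>K\<^esub> l' = loc_frac D S (t \<otimes>\<^bsub>D\<^esub> a \<oplus>\<^bsub>D\<^esub> s \<otimes>\<^bsub>D\<^esub> b) (s \<otimes>\<^bsub>D\<^esub> t)"
        unfolding K_def as(3,6) using L.loc_frac_add as by blast
      then have "\<beta> m (l \<oplus>\<^bsub>K\<^esub> l') = \<beta> m l \<otimes>\<^bsub>LM.frac_group\<^esub> \<beta> m l'"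
        using c as \<beta> by (simp add: LM.mfrac_add LM.smult_l_distr LM.smult_assoc)
      then have "h (frag_of (m, l \<oplus>\<^bsub>K\<^esub> l') - frag_of (m, l) - frag_of (m, l')) = \<one>\<^bsub>LM.frac_group\<^esub>"
        using c by (intro h_diff2) (auto simp: h_of)
      then show "frag_of (m, l \<oplus>\<^bsub>K\<^esub> l') - frag_of (m, l) - frag_of (m, l') \<in> kernel B.F LM.frac_group h"
        unfolding kernel_def using B.T_closed(4)[OF B.T_relations(2)[OF c]] by blast
    next
      fix d m l assume c: "d \<in> carrier D" "m \<in> carrier M" "l \<in> carrier K"
      obtain a s where as: "a \<in> carrier D" "s \<in> S" "l = loc_frac D S a s" using K_carrE[OF c(3)] by auto
      have "\<phi> d \<otimes>\<^bsub>K\<^esub> l = loc_frac D S (d \<otimes>\<^bsub>D\<^esub> a) s"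
        unfolding K_def as(3) \<phi> using L.loc_frac_mult[of d "\<one>\<^bsub>D\<^esub>" a s] as c by simp
      then have "\<beta> (d \<odot>\<^bsub>M\<^esub> m) l = \<beta> m (\<phi> d \<otimes>\<^bsub>K\<^esub> l)"
        using c as \<beta> by (simp add: LM.smult_ac)
      then have "h (frag_of (d \<odot>\<^bsub>M\<^esub> m, l) - frag_of (m, \<phi> d \<otimes>\<^bsub>K\<^esub> l)) = \<one>\<^bsub>LM.frac_group\<^esub>"
        using c B.\<phi>_closed[OF c(1)] by (intro h_diff) (auto simp: h_of)
      then show "frag_of (d \<odot>\<^bsub>M\<^esub> m, l) - frag_of (m, \<phi> d \<otimes>\<^bsub>K\<^esub> l) \<in> kernel B.F LM.frac_group h"
        unfolding kernel_def using B.T_closed(4)[OF B.T_relations(3)[OF c]] by blast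
    qed
    show "torsion_module D M" unfolding torsion_module_def
    proof
      fix m assume m: "m \<in> carrier M"
      have one: "loc_frac D S \<one>\<^bsub>D\<^esub> \<one>\<^bsub>D\<^esub> \<in> carrier K" unfolding Kc using L.one_closed D.one_closed by blast
      have "frag_of (m, loc_frac D S \<one>\<^bsub>D\<^esub> \<one>\<^bsub>D\<^esub>) \<in> B.T" unfolding T using m one by simp
      then have "\<beta> m (loc_frac D S \<one>\<^bsub>D\<^esub> \<one>\<^bsub>D\<^esub>) = \<one>\<^bsub>LM.frac_group\<^esub>"
        using \<open>B.T \<subseteq> kernel B.F LM.frac_group h\<close> h_of[OF m one] unfolding kernel_def by auto
      then have "LM.mfrac m \<one>\<^bsub>D\<^esub> = LM.mfrac \<zero>\<^bsub>M\<^esub> \<one>\<^bsub>D\<^esub>"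
        using \<beta>[OF m D.one_closed L.one_closed] m unfolding LM.frac_group_one by simp
      then show "\<exists>d\<in>carrier D - {\<zero>\<^bsub>D\<^esub>}. d \<odot>\<^bsub>M\<^esub> m = \<zero>\<^bsub>M\<^esub>"
        using LM.mfrac_eq_zero_iff[OF m L.one_closed] S_iff by simp
    qed
  next
    assume tors: "torsion_module D M"
    have gen: "frag_of (m, l) \<in> B.T" if c: "m \<in> carrier M" "l \<in> carrier K" for m l
    proof -
      obtain a s where as: "a \<in> carrier D" "s \<in> S" "l = loc_frac D S a s" using K_carrE[OF c(2)] by auto
      obtain d where d: "d \<in> S" "d \<odot>\<^bsub>M\<^esub> m = \<zero>\<^bsub>M\<^esub>"
        using bspec[OF tors[unfolded torsion_module_def] c(1)] unfolding S_def by blast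
      have dc: "d \<in> carrier D" using d(1) by simp
      define l' where "l' = loc_frac D S a (d \<otimes>\<^bsub>D\<^esub> s)"
      have l': "l' \<in> carrier K" unfolding l'_def Kc using as d(1) L.m_closed by blast
      have "\<phi> d \<otimes>\<^bsub>K\<^esub> l' = loc_frac D S (d \<otimes>\<^bsub>D\<^esub> a) (d \<otimes>\<^bsub>D\<^esub> s)"
        unfolding K_def l'_def \<phi> using L.loc_frac_mult[of d "\<one>\<^bsub>D\<^esub>" a "d \<otimes>\<^bsub>D\<^esub> s"] as d(1) dc by simp
      then have eq: "\<phi> d \<otimes>\<^bsub>K\<^esub> l' = l" using L.loc_frac_cancel[OF as(1,2) d(1)] as(3) by simp
      have "frag_of (\<zero>\<^bsub>M\<^esub>, l') \<in> B.T"
        using B.T_closed(2)[OF B.T_relations(1)[of "\<zero>\<^bsub>M\<^esub>" "\<zero>\<^bsub>M\<^esub>" l']] l' by simp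
      moreover have "frag_of (\<zero>\<^bsub>M\<^esub>, l') - frag_of (m, l) \<in> B.T"
        using B.T_relations(3)[OF dc c(1) l'] d(2) eq by simp
      ultimately show ?thesis using B.T_closed(5) by fastforce
    qed
    have "x \<in> B.T" if "x \<in> carrier B.F" for x
      using that by (induction rule: B.F_induct) (use gen B.T_closed in auto)
    then show "B.T = carrier B.F" using B.T_closed(4) by blast
  qed
  finally show ?thesis .
qed


section \<open>Cosets and the conormal module\<close>

context cring begin

lemma coset_eq_iff:
  assumes "ideal J R" "x \<in> carrier R" "y \<in> carrier R"
  shows "J +> x = J +> y \<longleftrightarrow> x \<ominus> y \<in> J"
proof -
  interpret J: ideal J R by fact
  have mem: "z \<in> J +> x \<longleftrightarrow> z \<in> carrier R \<and> z \<ominus> x \<in> J" if "x \<in> carrier R" for x z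
  proof -
    have "z \<in> carrier R \<Longrightarrow> z = (z \<ominus> x) \<oplus> x" "\<And>h. h \<in> carrier R \<Longrightarrow> (h \<oplus> x) \<ominus> x = h"
      using that by algebra+
    then show ?thesis unfolding a_r_coset_def' using J.a_Hcarr that by auto
  qed
  show ?thesis
  proof
    assume "J +> x = J +> y"
    then have "x \<in> J +> y" using mem[OF assms(2), of x] assms(2) by (simp add: a_minus_def r_neg J.zero_closed)
    then show "x \<ominus> y \<in> J" using mem[OF assms(3)] by blast
  next
    assume xy: "x \<ominus> y \<in> J"
    have "z \<ominus> x \<in> J \<longleftrightarrow> z \<ominus> y \<in> J" if z: "z \<in> carrier R" for z
    proof -
      have "z \<ominus> y = (z \<ominus> x) \<oplus> (x \<ominus> y)" using z assms by algebra
      then show ?thesis using ideal_add_cancel(1)[OF assms(1) _ xy, of "z \<ominus> x"] z assms by simp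
    qed
    then show "J +> x = J +> y" by (intro Set.set_eqI) (auto simp: mem assms)
  qed
qed

lemma coset_eq_ideal_iff:
  assumes "ideal J R" "x \<in> carrier R"
  shows "J +> x = J \<longleftrightarrow> x \<in> J"
proof -
  have "J +> \<zero> = J" using assms(1) ideal_zero[OF assms(1)]
    by (intro abelian_subgroup.a_rcos_const abelian_subgroupI3 ideal.axioms(1) is_abelian_group)
  then show ?thesis using coset_eq_iff[OF assms zero_closed] assms by (simp add: a_minus_def)
qed

lemma coset_add:
  assumes "ideal J R" "x \<in> carrier R" "y \<in> carrier R"
  shows "(J +> x) <+>\<^bsub>R\<^esub> (J +> y) = J +> (x \<oplus> y)"
  using assms by (intro abelian_subgroup.a_rcos_sum abelian_subgroupI3 ideal.axioms(1) is_abelian_group)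

lemma Quot_carrier: "carrier (R Quot I) = {I +> r | r. r \<in> carrier R}"
  unfolding FactRing_def A_RCOSETS_def' by auto

text \<open>Changing \<open>r\<close> by an element of \<open>I\<close> changes \<open>rx\<close> by an element of \<open>I\<^sup>2\<close>, because \<open>x \<in> I\<close>.\<close>
lemma conormal_smult:
  assumes I: "ideal I R" and r: "r \<in> carrier R" and x: "x \<in> I"
  shows "(I +> r) \<odot>\<^bsub>conormal_module R I\<^esub> (I \<cdot> I +> x) = I \<cdot> I +> (r \<otimes> x)"
proof -
  let ?J = "I \<cdot> I"
  have J: "ideal ?J R" using ideal_prod_is_ideal[OF I I] .
  have xc: "x \<in> carrier R" using ideal_carr[OF I x] .
  have *: "?J +> (a \<otimes> b) = ?J +> (r \<otimes> x)" if "a \<in> I +> r" "b \<in> ?J +> x" for a b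
  proof -
    obtain i j where ij: "i \<in> I" "a = i \<oplus> r" "j \<in> ?J" "b = j \<oplus> x"
      using \<open>a \<in> I +> r\<close> \<open>b \<in> ?J +> x\<close> unfolding a_r_coset_def' by auto
    have c: "i \<in> carrier R" "j \<in> carrier R" using ij ideal_carr[OF I] ideal_carr[OF J] by auto
    have "a \<otimes> b \<ominus> r \<otimes> x = (i \<oplus> r) \<otimes> j \<oplus> i \<otimes> x" unfolding ij(2,4) using c r xc by algebra
    also have "\<dots> \<in> ?J"
      using ideal_add[OF J ideal_lmult[OF J _ ij(3)] ideal_prod.prod[OF ij(1) x]] c r by simp
    finally show ?thesis using coset_eq_iff[OF J] c r xc ij(2,4) by simp
  qed
  have "(I +> r) \<odot>\<^bsub>conormal_module R I\<^esub> (?J +> x) = (\<Union>a\<in>I +> r. \<Union>b\<in>?J +> x. ?J +> (r \<otimes> x))"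
    unfolding conormal_module_def rcoset_mult_def module.simps by (intro SUP_cong refl) (rule *)
  moreover have "\<zero> \<oplus> r \<in> I +> r" "\<zero> \<oplus> x \<in> ?J +> x"
    using ideal_zero[OF I] ideal_zero[OF J] unfolding a_r_coset_def' by auto
  ultimately show ?thesis by auto
qed

lemma conormal_simps:
  "carrier (conormal_module R I) = {I \<cdot> I +> x | x. x \<in> I}" "\<zero>\<^bsub>conormal_module R I\<^esub> = I \<cdot> I"
  "X \<oplus>\<^bsub>conormal_module R I\<^esub> Y = X <+>\<^bsub>R\<^esub> Y"
  unfolding conormal_module_def by auto

lemma conormal_module_module:
  assumes I: "ideal I R"
  shows "Module.module (R Quot I) (conormal_module R I)"
proof -
  let ?J = "I \<cdot> I" and ?M = "conormal_module R I"
  have J: "ideal ?J R" using ideal_prod_is_ideal[OF I I] .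
  note Ic = ideal_carr[OF I]
  have carrE: "\<exists>x\<in>I. X = ?J +> x" if "X \<in> carrier ?M" for X using that unfolding conormal_simps by blast
  have carrI: "?J +> x \<in> carrier ?M" if "x \<in> I" for x using that unfolding conormal_simps by blast
  have zero: "\<zero>\<^bsub>?M\<^esub> = ?J +> \<zero>" unfolding conormal_simps
    using coset_eq_ideal_iff[OF J zero_closed] ideal_zero[OF J] by simp
  have add: "(?J +> x) \<oplus>\<^bsub>?M\<^esub> (?J +> y) = ?J +> (x \<oplus> y)" if "x \<in> I" "y \<in> I" for x y
    unfolding conormal_simps using coset_add[OF J] Ic that by simp
  have QE: "\<exists>r\<in>carrier R. d = I +> r" if "d \<in> carrier (R Quot I)" for d using that unfolding Quot_carrier by blast
  have Qadd: "(I +> r) \<oplus>\<^bsub>R Quot I\<^esub> (I +> r') = I +> (r \<oplus> r')" if "r \<in> carrier R" "r' \<in> carrier R" for r r'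
    using coset_add[OF I that] unfolding FactRing_def by simp
  have Qmult: "(I +> r) \<otimes>\<^bsub>R Quot I\<^esub> (I +> r') = I +> (r \<otimes> r')" if "r \<in> carrier R" "r' \<in> carrier R" for r r'
    using ideal.rcoset_mult_add[OF I that] unfolding FactRing_def by simp
  have Qone: "\<one>\<^bsub>R Quot I\<^esub> = I +> \<one>" unfolding FactRing_def by simp
  note smult = conormal_smult[OF I]
  note c = ideal_add[OF I] ideal_lmult[OF I] ideal_neg[OF I] ideal_zero[OF I] Ic
  show ?thesis
  proof (rule moduleI)
    show "cring (R Quot I)" using ideal.quotient_is_cring[OF I is_cring] .
    show "abelian_group ?M"
    proof (rule abelian_groupI)
      fix X Y assume "X \<in> carrier ?M" "Y \<in> carrier ?M"
      then obtain x y where x: "x \<in> I" "X = ?J +> x" and y: "y \<in> I" "Y = ?J +> y" by (metis carrE)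
      show "X \<oplus>\<^bsub>?M\<^esub> Y \<in> carrier ?M" unfolding x(2) y(2) add[OF x(1) y(1)] by (intro carrI c x y)
      show "X \<oplus>\<^bsub>?M\<^esub> Y = Y \<oplus>\<^bsub>?M\<^esub> X"
        unfolding x(2) y(2) add[OF x(1) y(1)] add[OF y(1) x(1)] using a_comm[OF Ic[OF x(1)] Ic[OF y(1)]] by simp
      fix Z assume "Z \<in> carrier ?M"
      then obtain z where z: "z \<in> I" "Z = ?J +> z" by (metis carrE)
      show "X \<oplus>\<^bsub>?M\<^esub> Y \<oplus>\<^bsub>?M\<^esub> Z = X \<oplus>\<^bsub>?M\<^esub> (Y \<oplus>\<^bsub>?M\<^esub> Z)"
        unfolding x(2) y(2) z(2) add[OF x(1) y(1)] add[OF y(1) z(1)]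
          add[OF c(1)[OF x(1) y(1)] z(1)] add[OF x(1) c(1)[OF y(1) z(1)]]
        using a_assoc[OF Ic[OF x(1)] Ic[OF y(1)] Ic[OF z(1)]] by simp
    next
      show "\<zero>\<^bsub>?M\<^esub> \<in> carrier ?M" unfolding zero by (rule carrI[OF c(4)])
      fix X assume "X \<in> carrier ?M"
      then obtain x where x: "x \<in> I" "X = ?J +> x" by (metis carrE)
      show "\<zero>\<^bsub>?M\<^esub> \<oplus>\<^bsub>?M\<^esub> X = X" unfolding zero x(2) add[OF c(4) x(1)] using Ic[OF x(1)] by simp
      have "(?J +> \<ominus> x) \<oplus>\<^bsub>?M\<^esub> X = \<zero>\<^bsub>?M\<^esub>"
        unfolding zero x(2) add[OF c(3)[OF x(1)] x(1)] using Ic[OF x(1)] by (simp add: l_neg)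
      then show "\<exists>Y\<in>carrier ?M. Y \<oplus>\<^bsub>?M\<^esub> X = \<zero>\<^bsub>?M\<^esub>"
        by (rule bexI[OF _ carrI[OF c(3)[OF x(1)]]])
    qed
  next
    fix d X assume "d \<in> carrier (R Quot I)" "X \<in> carrier ?M"
    then obtain r x where r: "r \<in> carrier R" "d = I +> r" and x: "x \<in> I" "X = ?J +> x" by (metis carrE QE)
    show "d \<odot>\<^bsub>?M\<^esub> X \<in> carrier ?M"
      unfolding r(2) x(2) smult[OF r(1) x(1)] by (rule carrI[OF c(2)[OF r(1) x(1)]])
    fix d' assume "d' \<in> carrier (R Quot I)"
    then obtain r' where r': "r' \<in> carrier R" "d' = I +> r'" by (metis QE)
    show "(d \<oplus>\<^bsub>R Quot I\<^esub> d') \<odot>\<^bsub>?M\<^esub> X = d \<odot>\<^bsub>?M\<^esub> X \<oplus>\<^bsub>?M\<^esub> d' \<odot>\<^bsub>?M\<^esub> X"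
      unfolding r(2) r'(2) x(2) Qadd[OF r(1) r'(1)] smult[OF r(1) x(1)] smult[OF r'(1) x(1)]
        smult[OF a_closed[OF r(1) r'(1)] x(1)] add[OF c(2)[OF r(1) x(1)] c(2)[OF r'(1) x(1)]]
      using l_distr[OF r(1) r'(1) Ic[OF x(1)]] by simp
    show "(d \<otimes>\<^bsub>R Quot I\<^esub> d') \<odot>\<^bsub>?M\<^esub> X = d \<odot>\<^bsub>?M\<^esub> (d' \<odot>\<^bsub>?M\<^esub> X)"
      unfolding r(2) r'(2) x(2) Qmult[OF r(1) r'(1)] smult[OF r'(1) x(1)]
        smult[OF m_closed[OF r(1) r'(1)] x(1)] smult[OF r(1) c(2)[OF r'(1) x(1)]]
      using m_assoc[OF r(1) r'(1) Ic[OF x(1)]] by simp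
  next
    fix d X Y assume "d \<in> carrier (R Quot I)" "X \<in> carrier ?M" "Y \<in> carrier ?M"
    then obtain r x y where r: "r \<in> carrier R" "d = I +> r" and x: "x \<in> I" "X = ?J +> x"
      and y: "y \<in> I" "Y = ?J +> y" by (metis carrE QE)
    show "d \<odot>\<^bsub>?M\<^esub> (X \<oplus>\<^bsub>?M\<^esub> Y) = d \<odot>\<^bsub>?M\<^esub> X \<oplus>\<^bsub>?M\<^esub> d \<odot>\<^bsub>?M\<^esub> Y"
      unfolding r(2) x(2) y(2) add[OF x(1) y(1)] smult[OF r(1) x(1)] smult[OF r(1) y(1)]
        smult[OF r(1) c(1)[OF x(1) y(1)]] add[OF c(2)[OF r(1) x(1)] c(2)[OF r(1) y(1)]]
      using r_distr[OF Ic[OF x(1)] Ic[OF y(1)] r(1)] by simp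
  next
    fix X assume "X \<in> carrier ?M"
    then obtain x where x: "x \<in> I" "X = ?J +> x" by (metis carrE)
    show "\<one>\<^bsub>R Quot I\<^esub> \<odot>\<^bsub>?M\<^esub> X = X"
      unfolding Qone x(2) smult[OF one_closed x(1)] using Ic[OF x(1)] by simp
  qed
qed

lemma torsion_conormal_iff:
  assumes I: "ideal I R"
  shows "torsion_module (R Quot I) (conormal_module R I)
    \<longleftrightarrow> (\<forall>x\<in>I. \<exists>r\<in>carrier R - I. r \<otimes> x \<in> I \<cdot> I)"
proof -
  have J: "ideal (I \<cdot> I) R" using ideal_prod_is_ideal[OF I I] .
  have zero: "\<zero>\<^bsub>R Quot I\<^esub> = I" unfolding FactRing_def by simp
  have smult: "(I +> r) \<odot>\<^bsub>conormal_module R I\<^esub> (I \<cdot> I +> x) = \<zero>\<^bsub>conormal_module R I\<^esub> \<longleftrightarrow> r \<otimes> x \<in> I \<cdot> I"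
    if "r \<in> carrier R" "x \<in> I" for r x
    unfolding conormal_smult[OF I that] conormal_simps
    using coset_eq_ideal_iff[OF J] that ideal_carr[OF I] by simp
  have nz: "carrier (R Quot I) - {\<zero>\<^bsub>R Quot I\<^esub>} = {I +> r | r. r \<in> carrier R - I}"
    unfolding Quot_carrier zero using coset_eq_ideal_iff[OF I] by auto
  have "torsion_module (R Quot I) (conormal_module R I) \<longleftrightarrow>
      (\<forall>x\<in>I. \<exists>r\<in>carrier R - I. (I +> r) \<odot>\<^bsub>conormal_module R I\<^esub> (I \<cdot> I +> x) = \<zero>\<^bsub>conormal_module R I\<^esub>)"
    unfolding torsion_module_def nz conormal_simps(1) by blast
  also have "\<dots> \<longleftrightarrow> (\<forall>x\<in>I. \<exists>r\<in>carrier R - I. r \<otimes> x \<in> I \<cdot> I)"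
    using smult by (intro ball_cong bex_cong refl) auto
  finally show ?thesis .
qed

section \<open>Translation of the conditions\<close>

lemma ideal_module_submodule_iff:
  assumes I: "ideal I R"
  shows "Module.submodule N R (ideal_module R I) \<longleftrightarrow> ideal N R \<and> N \<subseteq> I"
proof -
  let ?M = "ideal_module R I"
  interpret M: Module.module R ?M by (rule ideal_module_module[OF is_cring I])
  have sel: "carrier ?M = I" "x \<oplus>\<^bsub>?M\<^esub> y = x \<oplus> y" "\<zero>\<^bsub>?M\<^esub> = \<zero>" "x \<odot>\<^bsub>?M\<^esub> y = x \<otimes> y" for x y
    unfolding ideal_module_def by auto
  have neg: "\<ominus>\<^bsub>?M\<^esub> x = \<ominus> x" if "x \<in> I" for x
    using that ideal_carr[OF I that] ideal_neg[OF I that] by (intro M.minus_equality) (auto simp: sel l_neg)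
  show ?thesis
  proof
    assume N: "Module.submodule N R ?M"
    note E = M.submoduleE[OF N, unfolded sel]
    have "ideal N R"
    proof (rule idealI[OF ring_axioms])
      show "subgroup N (add_monoid R)"
      proof (rule add.subgroupI)
        show "N \<subseteq> carrier R" using E(1) ideal_carr[OF I] by blast
        show "N \<noteq> {}" using E(2) .
        show "\<ominus> a \<in> N" if "a \<in> N" for a using E(3)[OF that] neg E(1) that by auto
        show "a \<oplus> b \<in> N" if "a \<in> N" "b \<in> N" for a b using E(5)[OF that] .
      qed
      fix a x assume a: "a \<in> N" and x: "x \<in> carrier R"
      show "x \<otimes> a \<in> N" using E(4)[OF x a] .
      then show "a \<otimes> x \<in> N" using m_comm[OF x] ideal_carr[OF I] E(1) a by auto
    qed
    then show "ideal N R \<and> N \<subseteq> I" using E(1) by blast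
  next
    assume N: "ideal N R \<and> N \<subseteq> I"
    then have Ni: "ideal N R" by simp
    show "Module.submodule N R ?M"
      by (rule M.submoduleI)
        (use N neg ideal_zero[OF Ni] ideal_neg[OF Ni] ideal_add[OF Ni] ideal_lmult[OF Ni] in \<open>auto simp: sel\<close>)
  qed
qed

lemma finite_length_of_between:
  assumes I: "ideal I R" and fin: "finite_length_between R {\<zero>} I"
  shows "finite_length R (ideal_module R I)"
proof -
  obtain l where l: "\<And>A B. ideal A R \<Longrightarrow> ideal B R \<Longrightarrow> {\<zero>} \<subseteq> A \<Longrightarrow> A \<subset> B \<Longrightarrow> B \<subseteq> I \<Longrightarrow> l A < (l B :: nat)"
    using fin unfolding finite_length_between_def by metis
  have bound: "n \<le> l I"
    if N: "\<And>i. i \<le> n \<Longrightarrow> ideal (N i) R \<and> N i \<subseteq> I" "\<And>i. i < n \<Longrightarrow> N i \<subset> N (Suc i)" for n and N :: "nat \<Rightarrow> 'a set"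
  proof -
    have step: "l A < l B" if "ideal A R" "ideal B R" "A \<subset> B" "B \<subseteq> I" for A B
      using l[of A B] that ideal_zero[OF that(1)] by simp
    have "i \<le> n \<Longrightarrow> i \<le> l (N i)" for i
    proof (induction i)
      case (Suc i)
      then have "l (N i) < l (N (Suc i))" using N by (intro step) auto
      then show ?case using Suc by simp
    qed simp
    then have "n \<le> l (N n)" by simp
    also have "l (N n) \<le> l I"
      using step[of "N n" I] N(1)[of n] I by (cases "N n = I") (auto intro: less_imp_le)
    finally show ?thesis .
  qed
  have "module_length R (ideal_module R I) \<le> enat (l I)"
    unfolding module_length_def ideal_module_submodule_iff[OF I]
  proof (rule Sup_least)
    fix x assume "x \<in> {enat n | n. \<exists>N. (\<forall>i\<le>n. ideal (N i) R \<and> N i \<subseteq> I) \<and> (\<forall>i<n. N i \<subset> N (Suc i))}"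
    then obtain n N where "x = enat n" and N: "\<forall>i\<le>n. ideal (N i) R \<and> N i \<subseteq> I" "\<forall>i<n. N i \<subset> N (Suc i)"
      by blast
    then show "x \<le> enat (l I)" using bound[of n N] by simp
  qed
  also have "\<dots> < \<infinity>" by simp
  finally show ?thesis unfolding finite_length_def .
qed

text \<open>A descending chain without repetition, read backwards from index \<open>k + 1\<close>, would be a chain of
  length \<open>k + 1\<close>, where \<open>k\<close> is the length of the module.\<close>
lemma finite_length_dcc:
  assumes I: "ideal I R" and fin: "finite_length R (ideal_module R I)"
    and C: "\<And>n :: nat. ideal (C n) R" "\<And>n. C n \<subseteq> I" "\<And>n. C (Suc n) \<subseteq> C n"
  shows "\<exists>n. C n \<subseteq> C (Suc n)"
proof (rule ccontr)
  assume "\<not> ?thesis"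
  then have strict: "C (Suc n) \<subset> C n" for n using C(3) by blast
  obtain k where k: "module_length R (ideal_module R I) = enat k"
    using fin unfolding finite_length_def by auto
  define N where "N i = C (Suc k - i)" for i
  have "N i \<subset> N (Suc i)" if "i < Suc k" for i
    unfolding N_def using strict[of "k - i"] that by (simp add: Suc_diff_le)
  moreover have "Module.submodule (N i) R (ideal_module R I)" for i
    unfolding ideal_module_submodule_iff[OF I] N_def using C by blast
  ultimately have "enat (Suc k) \<le> module_length R (ideal_module R I)"
    unfolding module_length_def by (intro Sup_upper) blast
  then show False unfolding k by simp
qed

lemma extended_ideal_zero_iff:
  assumes P: "primeideal P R" and I: "ideal I R"
  shows "extended_ideal R P I = {\<zero>\<^bsub>localization_at_prime R P\<^esub>}
    \<longleftrightarrow> (\<forall>x\<in>I. \<exists>u\<in>carrier R - P. u \<otimes> x = \<zero>)"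
proof -
  define S where "S = carrier R - P"
  have "submonoid S R"
  proof (rule submonoid.intro)
    show "S \<subseteq> carrier R" unfolding S_def by blast
    show "x \<otimes> y \<in> S" if "x \<in> S" "y \<in> S" for x y
      using primeideal.I_prime[OF P, of x y] that unfolding S_def by blast
    show "\<one> \<in> S"
      using ideal.one_imp_carrier[OF primeideal.axioms(1)[OF P]] primeideal.I_notcarr[OF P] unfolding S_def by auto
  qed
  then interpret L: ring_localization R S unfolding ring_localization_def using is_cring by blast
  let ?L = "localization R S"
  interpret Loc: cring ?L by (rule L.localization_cring)
  have loc: "loc_map R S x = \<zero>\<^bsub>?L\<^esub> \<longleftrightarrow> (\<exists>u\<in>S. u \<otimes> x = \<zero>)" if "x \<in> I" for x
    unfolding loc_map_def using L.loc_frac_zero_iff[OF ideal_carr[OF I that] L.one_closed] .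
  have "extended_ideal R P I = {\<zero>\<^bsub>?L\<^esub>} \<longleftrightarrow> (\<forall>x\<in>I. loc_map R S x = \<zero>\<^bsub>?L\<^esub>)"
  proof
    assume "extended_ideal R P I = {\<zero>\<^bsub>?L\<^esub>}"
    moreover have "loc_map R S ` I \<subseteq> extended_ideal R P I"
      unfolding extended_ideal_def localization_at_prime_def S_def genideal_def by blast
    ultimately show "\<forall>x\<in>I. loc_map R S x = \<zero>\<^bsub>?L\<^esub>" by blast
  next
    assume "\<forall>x\<in>I. loc_map R S x = \<zero>\<^bsub>?L\<^esub>"
    then have "loc_map R S ` I = {\<zero>\<^bsub>?L\<^esub>}" using ideal_zero[OF I] by auto
    then show "extended_ideal R P I = {\<zero>\<^bsub>?L\<^esub>}"
      unfolding extended_ideal_def localization_at_prime_def S_def[symmetric] using Loc.genideal_zero by simp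
  qed
  also have "\<dots> \<longleftrightarrow> (\<forall>x\<in>I. \<exists>u\<in>S. u \<otimes> x = \<zero>)" using loc by auto
  finally show ?thesis unfolding localization_at_prime_def S_def .
qed

lemma principal_mod_prime:
  assumes P: "ideal P R" and D: "principal_domain (R Quot P)" and I: "ideal I R"
  shows "\<exists>y\<in>I. \<forall>x\<in>I. \<exists>r\<in>carrier R. x \<ominus> r \<otimes> y \<in> P"
proof -
  interpret D: principal_domain "R Quot P" by fact
  have "ideal ((+>) P ` I) (R Quot P)" using ring_ideal_imp_quot_ideal[OF P I] .
  then obtain d where d: "d \<in> carrier (R Quot P)" "(+>) P ` I = PIdl\<^bsub>R Quot P\<^esub> d" using D.exists_gen by blast
  then have "d \<in> (+>) P ` I" using D.cgenideal_self by blast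
  then obtain y where y: "y \<in> I" "d = P +> y" by blast
  have "\<exists>r\<in>carrier R. x \<ominus> r \<otimes> y \<in> P" if x: "x \<in> I" for x
  proof -
    have "P +> x \<in> PIdl\<^bsub>R Quot P\<^esub> d" using d(2) x by blast
    then obtain c where "c \<in> carrier (R Quot P)" "P +> x = c \<otimes>\<^bsub>R Quot P\<^esub> d" unfolding cgenideal_def by blast
    then obtain r where r: "r \<in> carrier R" "P +> x = (P +> r) \<otimes>\<^bsub>R Quot P\<^esub> (P +> y)"
      unfolding Quot_carrier y(2) by blast
    have c: "x \<in> carrier R" "y \<in> carrier R" using ideal_carr[OF I] x y by auto
    have "P +> x = P +> (r \<otimes> y)"
      using r(2) ideal.rcoset_mult_add[OF P r(1) c(2)] unfolding FactRing_def by simp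
    then show ?thesis using coset_eq_iff[OF P c(1), of "r \<otimes> y"] r(1) c(2) by auto
  qed
  then show ?thesis using y(1) by blast
qed

end

lemma krull_dim_ge:
  assumes "\<And>i. i \<le> n \<Longrightarrow> primeideal (Q i) R" "\<And>i. i < n \<Longrightarrow> Q i \<subset> Q (Suc i)"
  shows "enat n \<le> krull_dim R"
  unfolding krull_dim_def by (rule Sup_upper) (use assms in blast)

text \<open>Two further steps down from \<open>Q\<close> would give a chain of primes of length two.\<close>
lemma minimal_prime_below_prime:
  assumes dim: "krull_dim R \<le> 1" and Q: "primeideal Q R"
  shows "\<exists>P\<in>minimal_primes R. P \<subseteq> Q"
proof (rule ccontr)
  assume *: "\<not> ?thesis"
  then obtain Q1 where Q1: "primeideal Q1 R" "Q1 \<subset> Q" using Q unfolding minimal_primes_def by blast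
  then obtain Q0 where Q0: "primeideal Q0 R" "Q0 \<subset> Q1" using * unfolding minimal_primes_def by blast
  define C where "C i = (if i = 0 then Q0 else if i = 1 then Q1 else Q)" for i :: nat
  have "enat 2 \<le> krull_dim R"
  proof (rule krull_dim_ge[of 2 C])
    show "primeideal (C i) R" for i unfolding C_def using Q Q1 Q0 by simp
    show "C i \<subset> C (Suc i)" if "i < 2" for i
    proof -
      have "i = 0 \<or> i = 1" using that by auto
      then show ?thesis unfolding C_def using Q1 Q0 by auto
    qed
  qed
  then have "enat 2 \<le> 1" using dim by (rule order_trans)
  then show False by (simp add: one_enat_def)
qed

lemma strict_chain_of_krull_dim:
  assumes "krull_dim R \<ge> 1"
  shows "\<exists>Q Q'. primeideal Q R \<and> primeideal Q' R \<and> Q \<subset> Q'"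
proof (rule ccontr)
  assume *: "\<not> ?thesis"
  have "krull_dim R \<le> 0"
    unfolding krull_dim_def
  proof (rule Sup_least, clarify)
    fix n and Q :: "nat \<Rightarrow> 'a set"
    assume "\<forall>i\<le>n. primeideal (Q i) R" "\<forall>i<n. Q i \<subset> Q (Suc i)"
    then have "n = 0" using *
      by (metis One_nat_def Suc_leI gr0I le0)
    then show "enat n \<le> 0" by (simp add: zero_enat_def)
  qed
  then show False using assms by simp
qed

lemma unique_minimal_primeI:
  fixes R (structure)
  assumes "cring R" "noetherian_ring R" "krull_dim R = 1" "minimal_primes R = {\<pp>}" "principal_domain (R Quot \<pp>)"
  shows "unique_minimal_prime R \<pp>"
proof -
  interpret cring R by fact
  have p: "primeideal \<pp> R" using assms(4) unfolding minimal_primes_def by blast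
  have least: "\<pp> \<subseteq> Q" if "primeideal Q R" for Q
    using minimal_prime_below_prime[OF _ that] assms(3,4) by simp
  obtain Q Q' where QQ: "primeideal Q R" "primeideal Q' R" "Q \<subset> Q'"
    using strict_chain_of_krull_dim[of R] assms(3) by auto
  have "\<exists>Q. primeideal Q R \<and> \<pp> \<subset> Q" using QQ least[OF QQ(1)] by blast
  then show ?thesis
    unfolding unique_minimal_prime_def unique_minimal_prime_axioms_def
    using assms(1,2) p least principal_mod_prime[OF primeideal.axioms(1)[OF p] assms(5)] by blast
qed

theorem theorem1p1:
  fixes R :: "('a, 'b) ring_scheme" and \<pp> :: "'a set"
  assumes "cring R"
    and "noetherian_ring R"
    and "krull_dim R = 1"
    and "minimal_primes R = {\<pp>}"
    and "principal_domain (R Quot \<pp>)"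
  shows "(iso_artinian R \<longleftrightarrow>
            extended_ideal R \<pp> \<pp> = {\<zero>\<^bsub>localization_at_prime R \<pp>\<^esub>}) \<and>
         (iso_artinian R \<longleftrightarrow> finite_length R (ideal_module R \<pp>)) \<and>
         (iso_artinian R \<longleftrightarrow> torsion_module (R Quot \<pp>) (conormal_module R \<pp>)) \<and>
         (iso_artinian R \<longleftrightarrow> module_rank (R Quot \<pp>) (conormal_module R \<pp>) = 0) \<and>
         (iso_artinian R \<longleftrightarrow> (\<exists>s \<in> carrier R - \<pp>. \<forall>x\<in>\<pp>. s \<otimes>\<^bsub>R\<^esub> x = \<zero>\<^bsub>R\<^esub>)) \<and>
         (\<not> iso_artinian R \<longleftrightarrow> module_rank (R Quot \<pp>) (conormal_module R \<pp>) > 0)"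
proof -
  interpret unique_minimal_prime R \<pp> by (rule unique_minimal_primeI[OF assms])
  interpret D: principal_domain "R Quot \<pp>" by fact
  let ?ann = "\<exists>s \<in> carrier R - \<pp>. \<forall>x\<in>\<pp>. s \<otimes>\<^bsub>R\<^esub> x = \<zero>\<^bsub>R\<^esub>"
  have J: "ideal (\<pp> \<cdot>\<^bsub>R\<^esub> \<pp>) R" using ideal_prod_is_ideal[OF p_ideal p_ideal] .
  have i: "iso_artinian R \<longleftrightarrow> ?ann"
    using annihilator_of_iso_artinian iso_artinian_of_annihilator by blast
  have ii: "extended_ideal R \<pp> \<pp> = {\<zero>\<^bsub>localization_at_prime R \<pp>\<^esub>} \<longleftrightarrow> ?ann"
    unfolding extended_ideal_zero_iff[OF prime p_ideal]
    using uniform_annihilator[OF zeroideal] by auto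
  have iii: "finite_length R (ideal_module R \<pp>) \<longleftrightarrow> ?ann"
  proof
    assume "finite_length R (ideal_module R \<pp>)"
    then show ?ann using annihilator_of_dcc finite_length_dcc[OF p_ideal] by blast
  next
    assume ?ann
    then show "finite_length R (ideal_module R \<pp>)"
      using finite_length_of_between[OF p_ideal] finite_length_p by blast
  qed
  have iv: "torsion_module (R Quot \<pp>) (conormal_module R \<pp>) \<longleftrightarrow> ?ann"
    unfolding torsion_conormal_iff[OF p_ideal]
  proof
    assume "\<forall>x\<in>\<pp>. \<exists>r\<in>carrier R - \<pp>. r \<otimes>\<^bsub>R\<^esub> x \<in> \<pp> \<cdot>\<^bsub>R\<^esub> \<pp>"
    then obtain s where "s \<in> carrier R - \<pp>" "\<And>x. x \<in> \<pp> \<Longrightarrow> s \<otimes>\<^bsub>R\<^esub> x \<in> \<pp> \<cdot>\<^bsub>R\<^esub> \<pp>"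
      using uniform_annihilator[OF J] by blast
    then show ?ann by (rule annihilator_of_conormal_torsion)
  next
    assume ?ann
    then show "\<forall>x\<in>\<pp>. \<exists>r\<in>carrier R - \<pp>. r \<otimes>\<^bsub>R\<^esub> x \<in> \<pp> \<cdot>\<^bsub>R\<^esub> \<pp>" using ideal_zero[OF J] by metis
  qed
  have v: "module_rank (R Quot \<pp>) (conormal_module R \<pp>) = 0 \<longleftrightarrow> ?ann"
    using rank_zero_iff_torsion[OF D.domain_axioms conormal_module_module[OF p_ideal]] iv by simp
  show ?thesis using i ii iii iv v by (simp add: zero_less_iff_neq_zero)
qed

end
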